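(* Let $\mathscr{R}$ be an arbitrary $\mathbb{Z}_p$-algebra and let $\mathfrak{M}$ be an object of $\mathrm{Mod}^{\varphi}_{/\mathfrak{S}_{\mathscr{R}}}$. If $\mathfrak{M}/u\mathfrak{M}$ is a finitely generated projective $\mathscr{R}$-module and $\mathfrak{M}$ is $u$-adically complete, $u$-adically separated and $u$-torsion free, then $\mathfrak{M}$ is finitely generated and projective as an $(\mathscr{R}\otimes_{\mathbb{Z}_p}W(\kappa))[\![u]\!]$-module.
   Context: Fix a prime $p$, a finite extension $K$ of $\mathbb{Q}_p$ with ring of integers $\mathscr{O}_K$, uniformizer $\pi$ and residue field $\kappa$. Let $W(\kappa)$ be the ring of Witt vectors of $\kappa$, $E(u)$ the minimal (Eisenstein) polynomial of $\pi$ over $W(\kappa)$, $\mathfrak{S}:=W(\kappa)[\![u]\!]$, and $\varphi_{\mathfrak{S}}:\mathfrak{S}\to\mathfrak{S}$ the ring endomorphism extending the Frobenius on $W(\kappa)$ with $\varphi_{\mathfrak{S}}(u)=u^p$. A Breuil-Kisin module of height $h$ (a positive integer) is a finitely generated free $\mathfrak{S}$-module $\mathfrak{M}$ with a $\varphi_{\mathfrak{S}}$-semilinear endomorphism $\varphi_{\mathfrak{M}}:\mathfrak{M}\to\mathfrak{M}$ such that $E(u)^h$ kills the cokernel of the linearization $1\otimes\varphi_{\mathfrak{M}}:\varphi_{\mathfrak{S}}^{*}(\mathfrak{M}):=\mathfrak{S}\otimes_{\varphi_{\mathfrak{S}},\mathfrak{S}}\mathfrak{M}\to\mathfrak{M}$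 (in particular $\varphi_{\mathfrak{M}}$ is injective). The category of such modules is $\mathrm{Mod}^{\varphi}_{/\mathfrak{S}}$. For a (commutative) $\mathbb{Z}_p$-algebra $\mathscr{R}$, put $\mathfrak{S}_{\mathscr{R}}:=(\mathscr{R}\otimes_{\mathbb{Z}_p}W(\kappa))[\![u]\!]$. $\mathrm{Mod}^{\varphi}_{/\mathfrak{S}_{\mathscr{R}}}$ is the category of objects of $\mathrm{Mod}^{\varphi}_{/\mathfrak{S}}$ equipped with an $\mathscr{R}$-action (compatible with $\varphi_{\mathfrak{M}}$), so that each such $\mathfrak{M}$ is an $\mathfrak{S}_{\mathscr{R}}$-module. *)

theory Defs
  imports "HOL-Computational_Algebra.Primes" "HOL-Algebra.Embedded_Algebras" "HOL-Algebra.UnivPoly"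
    "HOL-Algebra.QuotRing" "HOL-Algebra.Generated_Groups" "HOL-Algebra.Free_Abelian_Groups"
begin

section \<open>Modules\<close>

text \<open>Only the additive fields and the action of a module record are meaningful; its
  multiplicative fields play no role (as in the locale \<^locale>\<open>module\<close>).\<close>

definition mod_hom :: "('r, 'c) ring_scheme \<Rightarrow> ('r, 'm) module \<Rightarrow> ('r, 'n) module \<Rightarrow> ('m \<Rightarrow> 'n) set"
  where "mod_hom R M N = {f. f \<in> carrier M \<rightarrow> carrier N \<and>
    (\<forall>x\<in>carrier M. \<forall>y\<in>carrier M. f (x \<oplus>\<^bsub>M\<^esub> y) = f x \<oplus>\<^bsub>N\<^esub> f y) \<and>
    (\<forall>r\<in>carrier R. \<forall>x\<in>carrier M. f (r \<odot>\<^bsub>M\<^esub> x) = r \<odot>\<^bsub>N\<^esub> f x)}"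

definition fin_gen_module :: "('r, 'c) ring_scheme \<Rightarrow> ('r, 'm) module \<Rightarrow> bool"
  where "fin_gen_module R M \<longleftrightarrow> module R M \<and>
    (\<exists>B. finite B \<and> B \<subseteq> carrier M \<and>
      (\<forall>x\<in>carrier M. \<exists>c\<in>B \<rightarrow> carrier R. x = (\<Oplus>\<^bsub>M\<^esub>b\<in>B. c b \<odot>\<^bsub>M\<^esub> b)))"

definition fin_free_module :: "('r, 'c) ring_scheme \<Rightarrow> ('r, 'm) module \<Rightarrow> bool"
  where "fin_free_module R M \<longleftrightarrow> module R M \<and>
    (\<exists>B. finite B \<and> B \<subseteq> carrier M \<and>
      (\<forall>x\<in>carrier M. \<exists>!c. c \<in> B \<rightarrow>\<^sub>E carrier R \<and> x = (\<Oplus>\<^bsub>M\<^esub>b\<in>B. c b \<odot>\<^bsub>M\<^esub> b)))"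

definition free_module :: "('r, 'c) ring_scheme \<Rightarrow> 'x set \<Rightarrow> ('r, 'x \<Rightarrow> 'r) module"
  where "free_module R B =
    \<lparr>carrier = {c. (\<forall>x. c x \<in> carrier R) \<and> {x. c x \<noteq> \<zero>\<^bsub>R\<^esub>} \<subseteq> B \<and> finite {x. c x \<noteq> \<zero>\<^bsub>R\<^esub>}},
     mult = undefined, one = undefined,
     ring.zero = (\<lambda>x. \<zero>\<^bsub>R\<^esub>), add = (\<lambda>c d x. c x \<oplus>\<^bsub>R\<^esub> d x),
     smult = (\<lambda>r c x. r \<otimes>\<^bsub>R\<^esub> c x)\<rparr>"

text \<open>Projective means: a direct summand of a free module.  Taking the basis \<open>X\<close> inside the type of
  elements of \<open>P\<close> is no restriction, since a projective module is a direct summand of the free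
  module on its own underlying set.\<close>

definition projective_module :: "('r, 'c) ring_scheme \<Rightarrow> ('r, 'm) module \<Rightarrow> bool"
  where "projective_module R P \<longleftrightarrow> module R P \<and>
    (\<exists>(B :: 'm set) s q. s \<in> mod_hom R P (free_module R B) \<and> q \<in> mod_hom R (free_module R B) P \<and>
      (\<forall>x\<in>carrier P. q (s x) = x))"

text \<open>The abelian group underlying \<open>M\<close>, with another ring acting on it.\<close>

definition with_action :: "('s, 'm) module \<Rightarrow> ('r \<Rightarrow> 'm \<Rightarrow> 'm) \<Rightarrow> ('r, 'm) module"
  where "with_action M act =
    \<lparr>carrier = carrier M, mult = mult M, one = \<one>\<^bsub>M\<^esub>, ring.zero = \<zero>\<^bsub>M\<^esub>, add = add M, smult = act\<rparr>"

definition quot_module :: "('r, 'm) module \<Rightarrow> 'm set \<Rightarrow> ('r, 'm set) module"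
  where "quot_module M N =
    \<lparr>carrier = a_rcosets\<^bsub>M\<^esub> N, mult = undefined, one = undefined, ring.zero = N, add = set_add M,
     smult = (\<lambda>r C. \<Union>x\<in>C. N +>\<^bsub>M\<^esub> (r \<odot>\<^bsub>M\<^esub> x))\<rparr>"


section \<open>Tensor products\<close>

text \<open>The relations imposed on the free abelian group on \<open>A \<times> B\<close> to obtain \<open>A \<otimes>\<^sub>C B\<close>, where
  \<open>C\<close> acts on \<open>A\<close> and \<open>B\<close> through \<open>\<alpha>\<close> and \<open>\<beta>\<close>.\<close>

definition tensor_rels ::
    "('c, 'z) ring_scheme \<Rightarrow> ('c \<Rightarrow> 'a \<Rightarrow> 'a) \<Rightarrow> ('a, 'x) ring_scheme \<Rightarrow>
     ('c \<Rightarrow> 'b \<Rightarrow> 'b) \<Rightarrow> ('b, 'y) ring_scheme \<Rightarrow> ('a \<times> 'b \<Rightarrow>\<^sub>0 int) set"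
  where "tensor_rels C \<alpha> A \<beta> B =
    {frag_of (a \<oplus>\<^bsub>A\<^esub> a', b) - frag_of (a, b) - frag_of (a', b) | a a' b.
       a \<in> carrier A \<and> a' \<in> carrier A \<and> b \<in> carrier B} \<union>
    {frag_of (a, b \<oplus>\<^bsub>B\<^esub> b') - frag_of (a, b) - frag_of (a, b') | a b b'.
       a \<in> carrier A \<and> b \<in> carrier B \<and> b' \<in> carrier B} \<union>
    {frag_of (\<alpha> c a, b) - frag_of (a, \<beta> c b) | c a b.
       c \<in> carrier C \<and> a \<in> carrier A \<and> b \<in> carrier B}"

definition tensor_group ::
    "('c, 'z) ring_scheme \<Rightarrow> ('c \<Rightarrow> 'a \<Rightarrow> 'a) \<Rightarrow> ('a, 'x) ring_scheme \<Rightarrow>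
     ('c \<Rightarrow> 'b \<Rightarrow> 'b) \<Rightarrow> ('b, 'y) ring_scheme \<Rightarrow> ('a \<times> 'b \<Rightarrow>\<^sub>0 int) set monoid"
  where "tensor_group C \<alpha> A \<beta> B =
    free_Abelian_group (carrier A \<times> carrier B) Mod
      generate (free_Abelian_group (carrier A \<times> carrier B)) (tensor_rels C \<alpha> A \<beta> B)"

text \<open>For \<open>C\<close>-algebras \<open>A\<close>, \<open>B\<close>, the free abelian group on \<open>A \<times> B\<close> is the monoid ring of the
  multiplicative monoid \<open>A \<times> B\<close>.  The relations are stable under multiplication by
  elements of \<open>A \<times> B\<close>, so the ideal they generate is the subgroup they generate.\<close>

definition pair_monoid_ring ::
    "('a, 'x) ring_scheme \<Rightarrow> ('b, 'y) ring_scheme \<Rightarrow> ('a \<times> 'b \<Rightarrow>\<^sub>0 int) ring"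
  where "pair_monoid_ring A B =
    \<lparr>carrier = {f. Poly_Mapping.keys f \<subseteq> carrier A \<times> carrier B},
     mult = (\<lambda>f g. frag_extend (\<lambda>(a, b).
               frag_extend (\<lambda>(a', b'). frag_of (a \<otimes>\<^bsub>A\<^esub> a', b \<otimes>\<^bsub>B\<^esub> b')) g) f),
     one = frag_of (\<one>\<^bsub>A\<^esub>, \<one>\<^bsub>B\<^esub>), ring.zero = 0, add = (+)\<rparr>"

definition tensor_ideal ::
    "('c, 'z) ring_scheme \<Rightarrow> ('c \<Rightarrow> 'a) \<Rightarrow> ('a, 'x) ring_scheme \<Rightarrow>
     ('c \<Rightarrow> 'b) \<Rightarrow> ('b, 'y) ring_scheme \<Rightarrow> ('a \<times> 'b \<Rightarrow>\<^sub>0 int) set"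
  where "tensor_ideal C f A g B = genideal (pair_monoid_ring A B)
    (tensor_rels C (\<lambda>c a. f c \<otimes>\<^bsub>A\<^esub> a) A (\<lambda>c b. g c \<otimes>\<^bsub>B\<^esub> b) B)"

definition tensor_ring ::
    "('c, 'z) ring_scheme \<Rightarrow> ('c \<Rightarrow> 'a) \<Rightarrow> ('a, 'x) ring_scheme \<Rightarrow>
     ('c \<Rightarrow> 'b) \<Rightarrow> ('b, 'y) ring_scheme \<Rightarrow> ('a \<times> 'b \<Rightarrow>\<^sub>0 int) set ring"
  where "tensor_ring C f A g B = pair_monoid_ring A B Quot tensor_ideal C f A g B"

definition pure_tensor ::
    "('c, 'z) ring_scheme \<Rightarrow> ('c \<Rightarrow> 'a) \<Rightarrow> ('a, 'x) ring_scheme \<Rightarrow>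
     ('c \<Rightarrow> 'b) \<Rightarrow> ('b, 'y) ring_scheme \<Rightarrow> 'a \<Rightarrow> 'b \<Rightarrow> ('a \<times> 'b \<Rightarrow>\<^sub>0 int) set"
  where "pure_tensor C f A g B a b =
    tensor_ideal C f A g B +>\<^bsub>pair_monoid_ring A B\<^esub> frag_of (a, b)"


section \<open>Power series\<close>

definition fps_ring :: "('a, 'x) ring_scheme \<Rightarrow> (nat \<Rightarrow> 'a) ring"
  where "fps_ring A =
    \<lparr>carrier = UNIV \<rightarrow> carrier A,
     mult = (\<lambda>f g n. \<Oplus>\<^bsub>A\<^esub>i\<in>{..n}. f i \<otimes>\<^bsub>A\<^esub> g (n - i)),
     one = (\<lambda>n. if n = 0 then \<one>\<^bsub>A\<^esub> else \<zero>\<^bsub>A\<^esub>),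
     ring.zero = (\<lambda>n. \<zero>\<^bsub>A\<^esub>),
     add = (\<lambda>f g n. f n \<oplus>\<^bsub>A\<^esub> g n)\<rparr>"

definition fps_const :: "('a, 'x) ring_scheme \<Rightarrow> 'a \<Rightarrow> nat \<Rightarrow> 'a"
  where "fps_const A a = (\<lambda>n. if n = 0 then a else \<zero>\<^bsub>A\<^esub>)"

definition fps_var :: "('a, 'x) ring_scheme \<Rightarrow> nat \<Rightarrow> 'a"
  where "fps_var A = (\<lambda>n. if n = 1 then \<one>\<^bsub>A\<^esub> else \<zero>\<^bsub>A\<^esub>)"


section \<open>Witt vectors\<close>

text \<open>Integral polynomials in the variables \<open>X\<^sub>i\<close>, written \<open>(False, i)\<close>, and \<open>Y\<^sub>i\<close>,
  written \<open>(True, i)\<close>.\<close>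

type_synonym witt_poly = "(bool \<times> nat \<Rightarrow>\<^sub>0 nat) \<Rightarrow>\<^sub>0 int"

definition witt_var :: "bool \<Rightarrow> nat \<Rightarrow> witt_poly"
  where "witt_var v i = Poly_Mapping.single (Poly_Mapping.single (v, i) 1) 1"

definition ghost :: "nat \<Rightarrow> (nat \<Rightarrow> witt_poly) \<Rightarrow> nat \<Rightarrow> witt_poly"
  where "ghost p S n = (\<Sum>i\<le>n. of_nat p ^ i * S i ^ (p ^ (n - i)))"

text \<open>The unique families of integral polynomials making the ghost components additive,
  respectively multiplicative; existence is Witt's theorem.\<close>

definition witt_add_poly :: "nat \<Rightarrow> nat \<Rightarrow> witt_poly"
  where "witt_add_poly p =
    (THE S. \<forall>n. ghost p S n = ghost p (witt_var False) n + ghost p (witt_var True) n)"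

definition witt_mult_poly :: "nat \<Rightarrow> nat \<Rightarrow> witt_poly"
  where "witt_mult_poly p =
    (THE S. \<forall>n. ghost p S n = ghost p (witt_var False) n * ghost p (witt_var True) n)"

definition witt_poly_eval ::
    "('a, 'x) ring_scheme \<Rightarrow> witt_poly \<Rightarrow> (nat \<Rightarrow> 'a) \<Rightarrow> (nat \<Rightarrow> 'a) \<Rightarrow> 'a"
  where "witt_poly_eval A P x y =
    (\<Oplus>\<^bsub>A\<^esub>m\<in>Poly_Mapping.keys P. [Poly_Mapping.lookup P m] \<cdot>\<^bsub>A\<^esub>
      (\<Otimes>\<^bsub>A\<^esub>v\<in>Poly_Mapping.keys m.
        (if fst v then y (snd v) else x (snd v)) [^]\<^bsub>A\<^esub> Poly_Mapping.lookup m v))"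

definition witt_ring :: "nat \<Rightarrow> ('a, 'x) ring_scheme \<Rightarrow> (nat \<Rightarrow> 'a) ring"
  where "witt_ring p A =
    \<lparr>carrier = UNIV \<rightarrow> carrier A,
     mult = (\<lambda>x y n. witt_poly_eval A (witt_mult_poly p n) x y),
     one = (\<lambda>n. if n = 0 then \<one>\<^bsub>A\<^esub> else \<zero>\<^bsub>A\<^esub>),
     ring.zero = (\<lambda>n. \<zero>\<^bsub>A\<^esub>),
     add = (\<lambda>x y n. witt_poly_eval A (witt_add_poly p n) x y)\<rparr>"

text \<open>The Frobenius of the Witt vectors of a ring of characteristic \<open>p\<close>.\<close>

definition witt_frob :: "nat \<Rightarrow> ('a, 'x) ring_scheme \<Rightarrow> (nat \<Rightarrow> 'a) \<Rightarrow> nat \<Rightarrow> 'a"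
  where "witt_frob p A x = (\<lambda>n. x n [^]\<^bsub>A\<^esub> p)"


section \<open>Finite extensions of the \<open>p\<close>-adic numbers\<close>

definition Zp :: "nat \<Rightarrow> (nat \<Rightarrow> int) ring"
  where "Zp p =
    \<lparr>carrier = {x. \<forall>n. x n \<in> {0..<int p ^ n} \<and> x (Suc n) mod int p ^ n = x n},
     mult = (\<lambda>x y n. (x n * y n) mod int p ^ n),
     one = (\<lambda>n. 1 mod int p ^ n),
     ring.zero = (\<lambda>n. 0),
     add = (\<lambda>x y n. (x n + y n) mod int p ^ n)\<rparr>"

text \<open>The copy of \<open>\<rat>\<^sub>p = Frac \<int>\<^sub>p\<close> inside a field \<open>K\<close> containing \<open>\<int>\<^sub>p\<close> through \<open>\<iota>\<close>.\<close>

definition Qp_in :: "nat \<Rightarrow> 'k ring \<Rightarrow> ((nat \<Rightarrow> int) \<Rightarrow> 'k) \<Rightarrow> 'k set"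
  where "Qp_in p K \<iota> = {\<iota> x \<otimes>\<^bsub>K\<^esub> inv\<^bsub>K\<^esub> \<iota> y | x y.
    x \<in> carrier (Zp p) \<and> y \<in> carrier (Zp p) \<and> y \<noteq> \<zero>\<^bsub>Zp p\<^esub>}"

definition finite_extension_Qp :: "nat \<Rightarrow> 'k ring \<Rightarrow> ((nat \<Rightarrow> int) \<Rightarrow> 'k) \<Rightarrow> bool"
  where "finite_extension_Qp p K \<iota> \<longleftrightarrow> field K \<and> \<iota> \<in> ring_hom (Zp p) K \<and>
    inj_on \<iota> (carrier (Zp p)) \<and> ring.finite_dimension K (Qp_in p K \<iota>) (carrier K)"

definition monic_root ::
    "('a, 'x) ring_scheme \<Rightarrow> ('b, 'y) ring_scheme \<Rightarrow> ('a \<Rightarrow> 'b) \<Rightarrow> 'b \<Rightarrow> (nat \<Rightarrow> 'a) \<Rightarrow> bool"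
  where "monic_root A B f x P \<longleftrightarrow> P \<in> carrier (UP A) \<and>
    coeff (UP A) P (deg A P) = \<one>\<^bsub>A\<^esub> \<and> eval A B f x P = \<zero>\<^bsub>B\<^esub>"

definition integer_ring :: "nat \<Rightarrow> 'k ring \<Rightarrow> ((nat \<Rightarrow> int) \<Rightarrow> 'k) \<Rightarrow> 'k ring"
  where "integer_ring p K \<iota> = K\<lparr>carrier := {x \<in> carrier K. \<exists>P. monic_root (Zp p) K \<iota> x P}\<rparr>"

text \<open>The maximal ideal of a local ring.\<close>

definition nonunits :: "('a, 'x) ring_scheme \<Rightarrow> 'a set"
  where "nonunits A = carrier A - Units A"

definition uniformizer :: "nat \<Rightarrow> 'k ring \<Rightarrow> ((nat \<Rightarrow> int) \<Rightarrow> 'k) \<Rightarrow> 'k \<Rightarrow> bool"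
  where "uniformizer p K \<iota> \<pi> \<longleftrightarrow> \<pi> \<in> carrier (integer_ring p K \<iota>) \<and>
    cgenideal (integer_ring p K \<iota>) \<pi> = nonunits (integer_ring p K \<iota>)"

definition residue_field :: "nat \<Rightarrow> 'k ring \<Rightarrow> ((nat \<Rightarrow> int) \<Rightarrow> 'k) \<Rightarrow> 'k set ring"
  where "residue_field p K \<iota> = integer_ring p K \<iota> Quot nonunits (integer_ring p K \<iota>)"

definition Wk :: "nat \<Rightarrow> 'k ring \<Rightarrow> ((nat \<Rightarrow> int) \<Rightarrow> 'k) \<Rightarrow> (nat \<Rightarrow> 'k set) ring"
  where "Wk p K \<iota> = witt_ring p (residue_field p K \<iota>)"

text \<open>The embedding of \<open>W(\<kappa>)\<close> into the ring of integers is the unique ring homomorphism that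
  induces the identity of the residue field \<open>\<kappa>\<close>.\<close>

definition Wk_embedding ::
    "nat \<Rightarrow> 'k ring \<Rightarrow> ((nat \<Rightarrow> int) \<Rightarrow> 'k) \<Rightarrow> ((nat \<Rightarrow> 'k set) \<Rightarrow> 'k) \<Rightarrow> bool"
  where "Wk_embedding p K \<iota> e \<longleftrightarrow> e \<in> ring_hom (Wk p K \<iota>) (integer_ring p K \<iota>) \<and>
    (\<forall>w\<in>carrier (Wk p K \<iota>).
      nonunits (integer_ring p K \<iota>) +>\<^bsub>integer_ring p K \<iota>\<^esub> e w = w 0)"

text \<open>The minimal polynomial of \<open>\<pi>\<close> over \<open>W(\<kappa>)\<close>: the monic polynomial of least degree
  with root \<open>\<pi>\<close>.  Elements of \<open>UP A\<close> are coefficient functions, hence also elements of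
  \<open>fps_ring A\<close>.\<close>

definition minimal_poly_Wk ::
    "nat \<Rightarrow> 'k ring \<Rightarrow> ((nat \<Rightarrow> int) \<Rightarrow> 'k) \<Rightarrow> ((nat \<Rightarrow> 'k set) \<Rightarrow> 'k) \<Rightarrow> 'k \<Rightarrow>
     (nat \<Rightarrow> nat \<Rightarrow> 'k set) \<Rightarrow> bool"
  where "minimal_poly_Wk p K \<iota> e \<pi> E \<longleftrightarrow> monic_root (Wk p K \<iota>) K e \<pi> E \<and>
    (\<forall>Q. monic_root (Wk p K \<iota>) K e \<pi> Q \<longrightarrow> deg (Wk p K \<iota>) E \<le> deg (Wk p K \<iota>) Q)"


section \<open>Breuil--Kisin modules\<close>

definition BK_ring :: "nat \<Rightarrow> 'k ring \<Rightarrow> ((nat \<Rightarrow> int) \<Rightarrow> 'k) \<Rightarrow> (nat \<Rightarrow> nat \<Rightarrow> 'k set) ring"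
  where "BK_ring p K \<iota> = fps_ring (Wk p K \<iota>)"

text \<open>\<open>\<Sum> a\<^sub>n u\<^sup>n \<mapsto> \<Sum> F(a\<^sub>n) u\<^bsup>pn\<^esup>\<close>, with \<open>F\<close> the Frobenius of \<open>W(\<kappa>)\<close>; this is the only
  ring endomorphism extending \<open>F\<close> with \<open>u \<mapsto> u\<^sup>p\<close>.\<close>

definition BK_frob ::
    "nat \<Rightarrow> 'k ring \<Rightarrow> ((nat \<Rightarrow> int) \<Rightarrow> 'k) \<Rightarrow> (nat \<Rightarrow> nat \<Rightarrow> 'k set) \<Rightarrow> nat \<Rightarrow> nat \<Rightarrow> 'k set"
  where "BK_frob p K \<iota> a = (\<lambda>n. if p dvd n
    then witt_frob p (residue_field p K \<iota>) (a (n div p)) else \<zero>\<^bsub>Wk p K \<iota>\<^esub>)"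

text \<open>\<open>\<phi>\<^sup>*M = S \<otimes>\<^bsub>\<phi>,S\<^esub> M\<close>, where \<open>S\<close> acts on the first factor by \<open>c \<cdot> s = s \<phi>(c)\<close>.\<close>

definition frob_pullback ::
    "('s, 'x) ring_scheme \<Rightarrow> ('s \<Rightarrow> 's) \<Rightarrow> ('s, 'm) module \<Rightarrow> ('s \<times> 'm \<Rightarrow>\<^sub>0 int) set monoid"
  where "frob_pullback S \<phi> M = tensor_group S (\<lambda>c s. s \<otimes>\<^bsub>S\<^esub> \<phi> c) S (smult M) M"

text \<open>The map \<open>1 \<otimes> f\<close> on \<open>\<phi>\<^sup>*M\<close> sending the class of \<open>s \<otimes> x\<close> to \<open>s f(x)\<close>.\<close>

definition linearization ::
    "('s, 'm) module \<Rightarrow> ('m \<Rightarrow> 'm) \<Rightarrow> ('s \<times> 'm \<Rightarrow>\<^sub>0 int) set \<Rightarrow> 'm"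
  where "linearization M f T = the_elem
    ((\<lambda>t. \<Oplus>\<^bsub>M\<^esub>z\<in>Poly_Mapping.keys t.
        [Poly_Mapping.lookup t z] \<cdot>\<^bsub>M\<^esub> (fst z \<odot>\<^bsub>M\<^esub> f (snd z))) ` T)"

text \<open>The last condition says that \<open>E\<^sup>h\<close> kills the cokernel of the linearization.\<close>

definition BK_module ::
    "('s, 'x) ring_scheme \<Rightarrow> ('s \<Rightarrow> 's) \<Rightarrow> 's \<Rightarrow> nat \<Rightarrow> ('s, 'm) module \<Rightarrow> ('m \<Rightarrow> 'm) \<Rightarrow> bool"
  where "BK_module S \<phi> E h M f \<longleftrightarrow> fin_free_module S M \<and> f \<in> carrier M \<rightarrow> carrier M \<and>
    (\<forall>x\<in>carrier M. \<forall>y\<in>carrier M. f (x \<oplus>\<^bsub>M\<^esub> y) = f x \<oplus>\<^bsub>M\<^esub> f y) \<and>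
    (\<forall>s\<in>carrier S. \<forall>x\<in>carrier M. f (s \<odot>\<^bsub>M\<^esub> x) = \<phi> s \<odot>\<^bsub>M\<^esub> f x) \<and>
    (\<forall>x\<in>carrier M. (E [^]\<^bsub>S\<^esub> h) \<odot>\<^bsub>M\<^esub> x \<in>
      linearization M f ` carrier (frob_pullback S \<phi> M))"

text \<open>An action \<open>\<rho>\<close> of a \<open>\<int>\<^sub>p\<close>-algebra \<open>R\<close> by endomorphisms of the Breuil--Kisin module \<open>(M, f)\<close>;
  \<open>a\<close> and \<open>b\<close> are the structure maps of \<open>R\<close> and of \<open>S\<close> over \<open>\<int>\<^sub>p\<close>.\<close>

definition coefficient_action ::
    "nat \<Rightarrow> ('r, 'x) ring_scheme \<Rightarrow> ((nat \<Rightarrow> int) \<Rightarrow> 'r) \<Rightarrow> ('s, 'y) ring_scheme \<Rightarrow>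
     ((nat \<Rightarrow> int) \<Rightarrow> 's) \<Rightarrow> ('s, 'm) module \<Rightarrow> ('m \<Rightarrow> 'm) \<Rightarrow> ('r \<Rightarrow> 'm \<Rightarrow> 'm) \<Rightarrow> bool"
  where "coefficient_action p R a S b M f \<rho> \<longleftrightarrow> module R (with_action M \<rho>) \<and>
    (\<forall>r\<in>carrier R. \<forall>s\<in>carrier S. \<forall>x\<in>carrier M. \<rho> r (s \<odot>\<^bsub>M\<^esub> x) = s \<odot>\<^bsub>M\<^esub> \<rho> r x) \<and>
    (\<forall>c\<in>carrier (Zp p). \<forall>x\<in>carrier M. \<rho> (a c) x = b c \<odot>\<^bsub>M\<^esub> x) \<and>
    (\<forall>r\<in>carrier R. \<forall>x\<in>carrier M. f (\<rho> r x) = \<rho> r (f x))"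

text \<open>\<open>S\<^sub>R = (R \<otimes>\<^bsub>\<int>\<^sub>p\<^esub> W(\<kappa>))[[u]]\<close>, where \<open>a\<close> and \<open>j\<close> are the structure maps of the
  \<open>\<int>\<^sub>p\<close>-algebras \<open>R\<close> and \<open>W(\<kappa>)\<close>.\<close>

definition BK_coeff_ring ::
    "nat \<Rightarrow> 'k ring \<Rightarrow> ((nat \<Rightarrow> int) \<Rightarrow> 'k) \<Rightarrow> ((nat \<Rightarrow> int) \<Rightarrow> nat \<Rightarrow> 'k set) \<Rightarrow>
     'r ring \<Rightarrow> ((nat \<Rightarrow> int) \<Rightarrow> 'r) \<Rightarrow> (nat \<Rightarrow> ('r \<times> (nat \<Rightarrow> 'k set) \<Rightarrow>\<^sub>0 int) set) ring"
  where "BK_coeff_ring p K \<iota> j R a = fps_ring (tensor_ring (Zp p) a R j (Wk p K \<iota>))"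

text \<open>The \<open>S\<^sub>R\<close>-module structure \<open>\<sigma>\<close> on \<open>M\<close> extending the given actions of \<open>S\<close> and \<open>R\<close>.
  As \<open>M\<close> is \<open>u\<close>-adically complete and separated, there is exactly one: modulo \<open>u\<^sup>n M\<close>, a power
  series acts through its first \<open>n\<close> coefficients.\<close>

definition BK_coeff_structure ::
    "nat \<Rightarrow> 'k ring \<Rightarrow> ((nat \<Rightarrow> int) \<Rightarrow> 'k) \<Rightarrow> ((nat \<Rightarrow> int) \<Rightarrow> nat \<Rightarrow> 'k set) \<Rightarrow>
     'r ring \<Rightarrow> ((nat \<Rightarrow> int) \<Rightarrow> 'r) \<Rightarrow> (nat \<Rightarrow> nat \<Rightarrow> 'k set, 'm) module \<Rightarrow> ('r \<Rightarrow> 'm \<Rightarrow> 'm) \<Rightarrow>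
     ((nat \<Rightarrow> ('r \<times> (nat \<Rightarrow> 'k set) \<Rightarrow>\<^sub>0 int) set) \<Rightarrow> 'm \<Rightarrow> 'm) \<Rightarrow> bool"
  where "BK_coeff_structure p K \<iota> j R a M \<rho> \<sigma> \<longleftrightarrow>
    module (BK_coeff_ring p K \<iota> j R a) (with_action M \<sigma>) \<and>
    (\<forall>s\<in>carrier (BK_ring p K \<iota>). \<forall>x\<in>carrier M.
      \<sigma> (\<lambda>n. pure_tensor (Zp p) a R j (Wk p K \<iota>) \<one>\<^bsub>R\<^esub> (s n)) x = s \<odot>\<^bsub>M\<^esub> x) \<and>
    (\<forall>r\<in>carrier R. \<forall>x\<in>carrier M.
      \<sigma> (fps_const (tensor_ring (Zp p) a R j (Wk p K \<iota>))
           (pure_tensor (Zp p) a R j (Wk p K \<iota>) r \<one>\<^bsub>Wk p K \<iota>\<^esub>)) x = \<rho> r x)"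


section \<open>The \<open>u\<close>-adic topology\<close>

definition mult_image :: "('s, 'm) module \<Rightarrow> 's \<Rightarrow> 'm set"
  where "mult_image M s = (\<lambda>x. s \<odot>\<^bsub>M\<^esub> x) ` carrier M"

definition adically_complete :: "('s, 'x) ring_scheme \<Rightarrow> ('s, 'm) module \<Rightarrow> 's \<Rightarrow> bool"
  where "adically_complete S M u \<longleftrightarrow>
    (\<forall>x\<in>UNIV \<rightarrow> carrier M. (\<forall>n. x (Suc n) \<ominus>\<^bsub>M\<^esub> x n \<in> mult_image M (u [^]\<^bsub>S\<^esub> (n::nat))) \<longrightarrow>
      (\<exists>y\<in>carrier M. \<forall>n. y \<ominus>\<^bsub>M\<^esub> x n \<in> mult_image M (u [^]\<^bsub>S\<^esub> n)))"

definition adically_separated :: "('s, 'x) ring_scheme \<Rightarrow> ('s, 'm) module \<Rightarrow> 's \<Rightarrow> bool"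
  where "adically_separated S M u \<longleftrightarrow> (\<Inter>n::nat. mult_image M (u [^]\<^bsub>S\<^esub> n)) = {\<zero>\<^bsub>M\<^esub>}"

definition torsion_free :: "('s, 'm) module \<Rightarrow> 's \<Rightarrow> bool"
  where "torsion_free M u \<longleftrightarrow> (\<forall>x\<in>carrier M. u \<odot>\<^bsub>M\<^esub> x = \<zero>\<^bsub>M\<^esub> \<longrightarrow> x = \<zero>\<^bsub>M\<^esub>)"

end

theory Submission
  imports Defs "HOL-Algebra.Multiplicative_Group" "HOL-Algebra.Polynomial_Divisibility"
begin

text \<open>Write \<open>A = R \<otimes> W(\<kappa>)\<close> and let \<open>q\<close> be the order of \<open>\<kappa>\<close>.  The Teichmueller representatives of the
  nonzero elements of \<open>\<kappa>\<close> form a group of order \<open>q - 1\<close>, a unit of \<open>\<int>\<^sub>p\<close>, and they span \<open>W(\<kappa>)\<close> over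
  \<open>\<int>\<^sub>p\<close>.  As in Maschke's theorem, averaging over this group turns a dual basis of the projective
  \<open>R\<close>-module \<open>M/uM\<close> into one over \<open>A\<close>.  Because \<open>M\<close> is \<open>u\<close>-torsion free and \<open>u\<close>-adically separated, an
  \<open>A\<close>-dual basis of \<open>M/uM\<close> lifts to an \<open>A[[u]]\<close>-dual basis of \<open>M\<close> by expanding elements of \<open>M\<close> in
  powers of \<open>u\<close>.\<close>

section \<open>The p-adic integers\<close>

text \<open>The averaging rests on two facts about \<kappa> that its definition does not supply: it
  is finite, and \<open>q - 1\<close> is prime to \<open>p\<close>. Finiteness has to be extracted
  from \<open>finite_dimension\<close>: every residue class is a root of one of finitely many
  nonzero polynomials, the reductions of integral relations of bounded length. Before that, the
  elements with a monic equation must be shown to form a ring. Since \<open>p\<close> and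
  \<open>q\<close> both vanish in \<kappa>, \<open>p\<close> divides \<open>q\<close>; this yields
  the inverse of \<open>q - 1\<close> in the p-adic integers and also p-th roots in \<kappa>. The
  roots turn a Witt vector with first coordinate 0 into a multiple of \<open>p\<close>, so every
  Witt vector has an expansion in Teichmueller digits, and having only \<open>q\<close> possible
  digits it collapses to \<open>q\<close> coefficients in the p-adic integers. Linearity over
  \<open>A\<close> can then be tested on \<open>R\<close> and on the digits alone. All functionals
  live on \<open>M\<close> itself and vanish on \<open>uM\<close>; the quotient appears once, over
  \<open>R\<close>, and no module structure over \<open>A\<close> has to be put on it.\<close>

lemma Zp_simps:
  "\<one>\<^bsub>Zp p\<^esub> = (\<lambda>n. 1 mod int p ^ n)" "\<zero>\<^bsub>Zp p\<^esub> = (\<lambda>n. 0)"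
  "x \<oplus>\<^bsub>Zp p\<^esub> y = (\<lambda>n. (x n + y n) mod int p ^ n)"
  "x \<otimes>\<^bsub>Zp p\<^esub> y = (\<lambda>n. (x n * y n) mod int p ^ n)"
  by (simp_all add: Zp_def)

lemma Zp_carrier_iff:
  "x \<in> carrier (Zp p) \<longleftrightarrow> (\<forall>n. x n \<in> {0..<int p ^ n} \<and> x (Suc n) mod int p ^ n = x n)"
  by (simp add: Zp_def)

lemma Zp_nth_mod: "x \<in> carrier (Zp p) \<Longrightarrow> x n mod int p ^ n = x n"
  by (simp add: Zp_carrier_iff)

lemma Zp_coherent:
  assumes "x \<in> carrier (Zp p)"
  shows "x (n + k) mod int p ^ n = x n"
proof (induction k)
  case (Suc k)
  have "x (n + Suc k) mod int p ^ n = x (Suc (n + k)) mod int p ^ (n + k) mod int p ^ n"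
    by (simp add: mod_mod_cancel le_imp_power_dvd)
  then show ?case using assms Suc by (simp add: Zp_carrier_iff)
qed (use assms Zp_nth_mod in simp)

lemma Zp_carrierI:
  assumes "p > 0" "\<And>n. x (Suc n) mod int p ^ n = x n mod int p ^ n"
  shows "(\<lambda>n. x n mod int p ^ n) \<in> carrier (Zp p)"
  using assms by (auto simp: Zp_carrier_iff mod_mod_cancel)

lemma Zp_Suc_mod: "x \<in> carrier (Zp p) \<Longrightarrow> x (Suc n) mod int p ^ n = x n"
  by (simp add: Zp_carrier_iff)

lemma cring_Zp:
  assumes p: "p > 0"
  shows "cring (Zp p)"
proof (rule cringI)
  have add: "x \<oplus>\<^bsub>Zp p\<^esub> y \<in> carrier (Zp p)" if "x \<in> carrier (Zp p)" "y \<in> carrier (Zp p)" for x y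
    unfolding Zp_simps
    by (rule Zp_carrierI [OF p]) (metis Zp_Suc_mod mod_add_eq that)
  have mult: "x \<otimes>\<^bsub>Zp p\<^esub> y \<in> carrier (Zp p)" if "x \<in> carrier (Zp p)" "y \<in> carrier (Zp p)" for x y
    unfolding Zp_simps
    by (rule Zp_carrierI [OF p]) (metis Zp_Suc_mod mod_mult_eq that)
  have one: "\<one>\<^bsub>Zp p\<^esub> \<in> carrier (Zp p)"
    unfolding Zp_simps by (rule Zp_carrierI [OF p]) simp
  have zero: "\<zero>\<^bsub>Zp p\<^esub> \<in> carrier (Zp p)"
    using p by (simp add: Zp_simps Zp_carrier_iff)
  show "abelian_group (Zp p)"
  proof (rule abelian_groupI)
    fix x assume x: "x \<in> carrier (Zp p)"
    show "\<zero>\<^bsub>Zp p\<^esub> \<oplus>\<^bsub>Zp p\<^esub> x = x"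
      using x by (simp add: Zp_simps Zp_nth_mod)
    have "(\<lambda>n. (- x n) mod int p ^ n) \<in> carrier (Zp p)"
      by (rule Zp_carrierI [OF p]) (metis Zp_Suc_mod mod_minus_eq x)
    then show "\<exists>y\<in>carrier (Zp p). y \<oplus>\<^bsub>Zp p\<^esub> x = \<zero>\<^bsub>Zp p\<^esub>"
      by (rule bexI [rotated]) (simp add: Zp_simps mod_simps)
  qed (simp_all add: add zero, simp_all add: Zp_simps mod_simps add_ac)
  show "Group.comm_monoid (Zp p)"
    by (rule comm_monoidI) (simp_all add: mult one, simp_all add: Zp_simps mod_simps mult_ac Zp_nth_mod)
qed (simp add: Zp_simps mod_simps algebra_simps)

lemma Zp_of_nat_mult:
  assumes "x \<in> carrier (Zp p)" "p > 0"
  shows "[k] \<cdot>\<^bsub>Zp p\<^esub> x = (\<lambda>n. (int k * x n) mod int p ^ n)"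
proof -
  interpret cring "Zp p" by (rule cring_Zp) fact
  show ?thesis
  proof (induction k)
    case 0
    then show ?case by (simp add: Zp_simps)
  next
    case (Suc k)
    then show ?case by (simp add: Zp_simps mod_simps algebra_simps)
  qed
qed

text \<open>The quotient is a shift: \<open>x (n + k)\<close> is known modulo
  \<open>p ^ (n + k)\<close>, so dividing it by \<open>p ^ n\<close> leaves a value modulo
  \<open>p ^ k\<close>. The explicit coordinates are exported because \<open>Zp_factor\<close> must
  see that \<open>y 1\<close> is nonzero.\<close>

lemma Zp_divisible:
  assumes p: "p > 0" and x: "x \<in> carrier (Zp p)" and 0: "x n = 0"
  obtains y where "y \<in> carrier (Zp p)" "x = [(p ^ n)] \<cdot>\<^bsub>Zp p\<^esub> y" "\<And>k. x (n + k) = int p ^ n * y k"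
proof -
  have d: "int p ^ n dvd x (n + k)" for k
    using Zp_coherent [OF x, of n k] 0 by auto
  define y where "y k = x (n + k) div int p ^ n" for k
  have xy: "x (n + k) = int p ^ n * y k" for k
    using d [of k] by (simp add: y_def)
  have "y k \<in> {0..<int p ^ k}" for k
  proof -
    have "0 \<le> int p ^ n * y k" "int p ^ n * y k < int p ^ n * int p ^ k"
      using x xy [of k] unfolding Zp_carrier_iff by (metis atLeastLessThan_iff power_add)+
    moreover have "int p ^ n > 0" using p by simp
    ultimately show ?thesis by (auto simp: zero_le_mult_iff)
  qed
  moreover have "y (Suc k) mod int p ^ k = y k" for k
  proof -
    have "int p ^ n * (y (Suc k) mod int p ^ k) = (int p ^ n * y (Suc k)) mod (int p ^ n * int p ^ k)"
      by (rule mult_mod_right)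
    also have "\<dots> = x (Suc (n + k)) mod int p ^ (n + k)"
      using xy [of "Suc k"] by (simp add: power_add)
    also have "\<dots> = int p ^ n * y k"
      using Zp_Suc_mod [OF x] xy by simp
    finally show ?thesis using p by simp
  qed
  ultimately have y: "y \<in> carrier (Zp p)" by (simp add: Zp_carrier_iff)
  have "x k = (int p ^ n * y k) mod int p ^ k" for k
  proof -
    have "(int p ^ n * y k) mod int p ^ k = x (k + n) mod int p ^ k"
      using xy [of k] by (simp add: add.commute)
    then show ?thesis using Zp_coherent [OF x] by simp
  qed
  then have "x = [(p ^ n)] \<cdot>\<^bsub>Zp p\<^esub> y"
    using Zp_of_nat_mult [OF y p, of "p ^ n"] by (auto simp: fun_eq_iff)
  with y xy that show ?thesis by blast
qed

lemma Zp_unit: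
  assumes p: "Factorial_Ring.prime p" and x: "x \<in> carrier (Zp p)" and 1: "x 1 \<noteq> 0"
  obtains y where "y \<in> carrier (Zp p)" "x \<otimes>\<^bsub>Zp p\<^esub> y = \<one>\<^bsub>Zp p\<^esub>"
proof -
  have p0: "p > 0" using p prime_gt_0_nat by blast
  have "coprime (x n) (int p ^ n)" for n
  proof (cases n)
    case (Suc m)
    have "x n mod int p = x 1" using Zp_coherent [OF x, of 1 m] Suc by simp
    then have "\<not> int p dvd x n" using 1 by auto
    then show ?thesis
      using p by (intro coprime_power_right_iff [THEN iffD2] disjI1)
        (metis coprime_commute prime_imp_coprime prime_nat_int_transfer)
  qed simp
  then have "\<exists>u. (x n * u) mod int p ^ n = 1 mod int p ^ n" for n
  proof -
    obtain u v where "u * x n + v * int p ^ n = gcd (x n) (int p ^ n)"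
      using bezout_int by blast
    then have "x n * u = 1 + (- v) * int p ^ n"
      using \<open>coprime (x n) (int p ^ n)\<close> by (simp add: algebra_simps)
    then have "(x n * u) mod int p ^ n = 1 mod int p ^ n" by (simp only: mod_mult_self1)
    then show ?thesis by blast
  qed
  then obtain u where u: "\<And>n. (x n * u n) mod int p ^ n = 1 mod int p ^ n" by metis
  let ?y = "\<lambda>n. u n mod int p ^ n"
  \<comment> \<open>The Bezout coefficients are chosen separately at each level. They cohere because
    \<open>u (Suc n)\<close> also inverts \<open>x n\<close> modulo \<open>p ^ n\<close>, and
    inverses are unique.\<close>
  have "u (Suc n) mod int p ^ n = u n mod int p ^ n" for n
  proof -
    let ?q = "int p ^ n"
    have a: "(x n * u (Suc n)) mod ?q = 1 mod ?q"
    proof -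
      have "(x n * u (Suc n)) mod ?q = (x (Suc n) * u (Suc n)) mod ?q"
        using Zp_Suc_mod [OF x, of n] by (metis mod_mult_left_eq)
      also have "\<dots> = (x (Suc n) * u (Suc n)) mod int p ^ Suc n mod ?q"
        by (simp add: mod_mod_cancel)
      also have "\<dots> = 1 mod ?q"
        unfolding u by (simp add: mod_mod_cancel)
      finally show ?thesis .
    qed
    have "u (Suc n) mod ?q = (u (Suc n) * (x n * u n)) mod ?q"
      using u [of n] by (metis mod_mult_right_eq mult.right_neutral)
    also have "\<dots> = (u n * (x n * u (Suc n))) mod ?q"
      by (simp add: mult_ac)
    also have "\<dots> = u n mod ?q"
      using a by (metis mod_mult_right_eq mult.right_neutral)
    finally show ?thesis .
  qed
  then have "?y \<in> carrier (Zp p)" by (intro Zp_carrierI [OF p0])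
  moreover have "x \<otimes>\<^bsub>Zp p\<^esub> ?y = \<one>\<^bsub>Zp p\<^esub>"
    using u by (simp add: Zp_simps mod_simps)
  ultimately show ?thesis using that by blast
qed

text \<open>The exponent is one less than the first index with a nonzero coordinate; index 0 carries
  no information, being taken modulo 1.\<close>

lemma Zp_factor:
  assumes p: "Factorial_Ring.prime p" and x: "x \<in> carrier (Zp p)" "x \<noteq> \<zero>\<^bsub>Zp p\<^esub>"
  obtains n y z where "y \<in> carrier (Zp p)" "z \<in> carrier (Zp p)" "y \<otimes>\<^bsub>Zp p\<^esub> z = \<one>\<^bsub>Zp p\<^esub>"
    "x = [(p ^ n)] \<cdot>\<^bsub>Zp p\<^esub> y"
proof -
  have p0: "p > 0" using p prime_gt_0_nat by blast
  obtain k where "x k \<noteq> 0" using x(2) by (auto simp: Zp_simps)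
  define m where "m = (LEAST k. x k \<noteq> 0)"
  have m: "x m \<noteq> 0" "\<And>k. k < m \<Longrightarrow> x k = 0"
    unfolding m_def using LeastI [of "\<lambda>k. x k \<noteq> 0"] \<open>x k \<noteq> 0\<close> not_less_Least by blast+
  moreover have "x 0 = 0" using x(1) unfolding Zp_carrier_iff by (metis atLeastLessThan_iff order_antisym power_0 zless_imp_add1_zle add_le_cancel_right add_0)
  ultimately obtain n where n: "m = Suc n" by (metis not0_implies_Suc)
  with m have "x n = 0" by simp
  then obtain y where y: "y \<in> carrier (Zp p)" "x = [(p ^ n)] \<cdot>\<^bsub>Zp p\<^esub> y" "x (n + 1) = int p ^ n * y 1"
    using Zp_divisible [OF p0 x(1)] by metis
  then have "y 1 \<noteq> 0" using m n by auto
  then obtain z where "z \<in> carrier (Zp p)" "y \<otimes>\<^bsub>Zp p\<^esub> z = \<one>\<^bsub>Zp p\<^esub>"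
    using Zp_unit [OF p y(1)] by blast
  with y that show ?thesis by blast
qed

text \<open>After the unit parts are cancelled only two powers of \<open>p\<close> are compared.
  This valuation ring property later allows a linear relation to be scaled to integral coefficients,
  one of them equal to 1.\<close>

lemma Zp_total_divisibility:
  assumes p: "Factorial_Ring.prime p" and x: "x \<in> carrier (Zp p)" and y: "y \<in> carrier (Zp p)"
  shows "\<exists>z\<in>carrier (Zp p). x = z \<otimes>\<^bsub>Zp p\<^esub> y \<or> y = z \<otimes>\<^bsub>Zp p\<^esub> x"
proof -
  interpret cring "Zp p" by (rule cring_Zp) (use p prime_gt_0_nat in blast)
  have *: "\<exists>z\<in>carrier (Zp p). [(p ^ n)] \<cdot>\<^bsub>Zp p\<^esub> v = z \<otimes>\<^bsub>Zp p\<^esub> ([(p ^ m)] \<cdot>\<^bsub>Zp p\<^esub> v')"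
    if "m \<le> n" "v \<in> carrier (Zp p)" "v' \<in> carrier (Zp p)" "w \<in> carrier (Zp p)" "v' \<otimes>\<^bsub>Zp p\<^esub> w = \<one>\<^bsub>Zp p\<^esub>" for n m v v' w
  proof
    have "[(p ^ n)] \<cdot>\<^bsub>Zp p\<^esub> v = [(p ^ m)] \<cdot>\<^bsub>Zp p\<^esub> ([(p ^ (n - m))] \<cdot>\<^bsub>Zp p\<^esub> v)"
      using that by (simp add: add.nat_pow_pow flip: power_add)
    also have "[(p ^ (n - m))] \<cdot>\<^bsub>Zp p\<^esub> v = ([(p ^ (n - m))] \<cdot>\<^bsub>Zp p\<^esub> v \<otimes>\<^bsub>Zp p\<^esub> w) \<otimes>\<^bsub>Zp p\<^esub> v'"
      using that by (simp add: m_assoc m_comm [of w])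
    finally show "[(p ^ n)] \<cdot>\<^bsub>Zp p\<^esub> v = ([(p ^ (n - m))] \<cdot>\<^bsub>Zp p\<^esub> v \<otimes>\<^bsub>Zp p\<^esub> w) \<otimes>\<^bsub>Zp p\<^esub> ([(p ^ m)] \<cdot>\<^bsub>Zp p\<^esub> v')"
      using that by (simp add: add_pow_rdistr)
  qed (use that in simp)
  show ?thesis
  proof (cases "x = \<zero>\<^bsub>Zp p\<^esub> \<or> y = \<zero>\<^bsub>Zp p\<^esub>")
    case True
    then show ?thesis using x y by (metis l_null zero_closed)
  next
    case False
    obtain n v w where "v \<in> carrier (Zp p)" "w \<in> carrier (Zp p)" "v \<otimes>\<^bsub>Zp p\<^esub> w = \<one>\<^bsub>Zp p\<^esub>" "x = [(p ^ n)] \<cdot>\<^bsub>Zp p\<^esub> v"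
      using Zp_factor [OF p x] False by metis
    moreover obtain m v' w' where "v' \<in> carrier (Zp p)" "w' \<in> carrier (Zp p)" "v' \<otimes>\<^bsub>Zp p\<^esub> w' = \<one>\<^bsub>Zp p\<^esub>" "y = [(p ^ m)] \<cdot>\<^bsub>Zp p\<^esub> v'"
      using Zp_factor [OF p y] False by metis
    ultimately show ?thesis using * nle_le by metis
  qed
qed

section \<open>Integral closure\<close>

text \<open>Values at \<open>z\<close> of polynomials of degree at most \<open>n\<close>, in Horner
  form, so that inductions peel off a constant term and one factor \<open>z\<close>.\<close>

primrec (in ring) poly_span :: "'a set \<Rightarrow> 'a \<Rightarrow> nat \<Rightarrow> 'a set"
  where
    "poly_span A z 0 = A"
  | "poly_span A z (Suc n) = {a \<oplus> z \<otimes> d | a d. a \<in> A \<and> d \<in> poly_span A z n}"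

text \<open>A monic equation of positive degree solved for its leading power; the signs are absorbed
  into the coefficients.\<close>

definition (in ring) integral_over :: "'a set \<Rightarrow> 'a \<Rightarrow> bool"
  where "integral_over A z \<longleftrightarrow> z \<in> carrier R \<and> (\<exists>n. z [^] Suc n \<in> poly_span A z n)"

text \<open>Sums are built term by term and may repeat a generator; \<open>lin_span_insert\<close>
  collects the repetitions when a generator is to be eliminated.\<close>

inductive_set (in ring) lin_span :: "'a set \<Rightarrow> 'a set \<Rightarrow> 'a set" for A V
  where
    zero: "\<zero> \<in> lin_span A V"
  | step: "a \<in> A \<Longrightarrow> v \<in> V \<Longrightarrow> s \<in> lin_span A V \<Longrightarrow> a \<otimes> v \<oplus> s \<in> lin_span A V"

section \<open>Linear spans and an elimination form of Nakayama's lemma\<close>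

context cring
begin

lemma lin_span_closed:
  assumes "A \<subseteq> carrier R" "V \<subseteq> carrier R" "s \<in> lin_span A V"
  shows "s \<in> carrier R"
  using assms(3) by induction (use assms in auto)

lemma lin_span_add:
  assumes "A \<subseteq> carrier R" "V \<subseteq> carrier R" "s \<in> lin_span A V" "s' \<in> lin_span A V"
  shows "s \<oplus> s' \<in> lin_span A V"
  using assms(3)
proof induction
  case zero
  then show ?case using assms lin_span_closed by auto
next
  case (step a v s)
  have "a \<otimes> v \<oplus> s \<oplus> s' = a \<otimes> v \<oplus> (s \<oplus> s')"
    using step assms lin_span_closed by (intro a_assoc) auto
  then show ?case using lin_span.step step by simp
qed

text \<open>Lets stability of a span under a product be checked one factor at a time, on
  generators.\<close>

lemma lin_span_map:
  assumes A: "subring A R" and V: "V \<subseteq> carrier R" and z: "z \<in> carrier R"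
    and map: "\<And>v. v \<in> V \<Longrightarrow> z \<otimes> v \<in> lin_span A W" and W: "W \<subseteq> carrier R"
    and mult: "\<And>a s. a \<in> A \<Longrightarrow> s \<in> lin_span A W \<Longrightarrow> a \<otimes> s \<in> lin_span A W"
    and s: "s \<in> lin_span A V"
  shows "z \<otimes> s \<in> lin_span A W"
  using s
proof induction
  case zero
  then show ?case using z by (simp add: lin_span.zero)
next
  case (step a v s)
  have "s \<in> carrier R" "a \<in> carrier R" "v \<in> carrier R"
    using step subringE(1)[OF A] V lin_span_closed by auto
  then have "z \<otimes> (a \<otimes> v \<oplus> s) = a \<otimes> (z \<otimes> v) \<oplus> z \<otimes> s"
    using z by (simp add: r_distr m_lcomm)
  then show ?case
    using lin_span_add [OF subringE(1)[OF A] W] mult map step by simp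
qed

lemma lin_span_smult:
  assumes A: "subring A R" and V: "V \<subseteq> carrier R" and c: "c \<in> A" and s: "s \<in> lin_span A V"
  shows "c \<otimes> s \<in> lin_span A V"
  using s
proof induction
  case zero
  then show ?case using subringE(1)[OF A] c by (auto simp: lin_span.zero)
next
  case (step a v s)
  have "s \<in> carrier R" "a \<in> carrier R" "v \<in> carrier R" "c \<in> carrier R"
    using step c subringE(1)[OF A] V lin_span_closed by auto
  then have "c \<otimes> (a \<otimes> v \<oplus> s) = (c \<otimes> a) \<otimes> v \<oplus> c \<otimes> s"
    by (simp add: r_distr m_assoc)
  then show ?case
    using lin_span.step [of "c \<otimes> a"] subringE(6)[OF A] c step by simp
qed

lemma lin_span_base:
  assumes "subring A R" "V \<subseteq> carrier R" "v \<in> V"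
  shows "v \<in> lin_span A V"
  using lin_span.step [OF subringE(3)[OF assms(1)] assms(3) lin_span.zero] assms by auto

lemma lin_span_mono: "s \<in> lin_span A V \<Longrightarrow> A \<subseteq> B \<Longrightarrow> s \<in> lin_span B V"
  by (induction rule: lin_span.induct) (auto intro: lin_span.intros)

lemma lin_span_insert:
  assumes A: "subring A R" and V: "insert w V \<subseteq> carrier R" and s: "s \<in> lin_span A (insert w V)"
  shows "\<exists>a\<in>A. \<exists>s'\<in>lin_span A V. s = a \<otimes> w \<oplus> s'"
  using s
proof induction
  case zero
  then show ?case
    using V subringE(2)[OF A] lin_span.zero by (intro bexI [of _ \<zero>]) auto
next
  case (step a v s)
  then obtain a' s' where s': "a' \<in> A" "s' \<in> lin_span A V" "s = a' \<otimes> w \<oplus> s'" by blast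
  have cl: "a \<in> carrier R" "a' \<in> carrier R" "w \<in> carrier R" "v \<in> carrier R" "s' \<in> carrier R"
    using step s' subringE(1)[OF A] V lin_span_closed [of A V] by auto
  show ?case
  proof (cases "v = w")
    case True
    then have "a \<otimes> v \<oplus> s = (a \<oplus> a') \<otimes> w \<oplus> s'"
      using cl s' by (simp add: l_distr a_assoc)
    then show ?thesis using s' step subringE(7)[OF A] by blast
  next
    case False
    then have "a \<otimes> v \<oplus> s = a' \<otimes> w \<oplus> (a \<otimes> v \<oplus> s')"
      using cl s' by (simp add: a_lcomm)
    then show ?thesis using False s' step lin_span.step by blast
  qed
qed

lemma lin_span_annihilate:
  assumes "A \<subseteq> carrier R" "V \<subseteq> carrier R" "c \<in> carrier R" "\<And>v. v \<in> V \<Longrightarrow> c \<otimes> v = \<zero>"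
    and s: "s \<in> lin_span A V"
  shows "c \<otimes> s = \<zero>"
  using s
proof induction
  case (step a v s)
  have "s \<in> carrier R" "a \<in> carrier R" "v \<in> carrier R"
    using step assms lin_span_closed by auto
  then have "c \<otimes> (a \<otimes> v \<oplus> s) = a \<otimes> (c \<otimes> v) \<oplus> c \<otimes> s"
    using assms(3) by (simp add: r_distr m_lcomm)
  then show ?case using step assms \<open>a \<in> carrier R\<close> by simp
qed (use assms in simp)

text \<open>One eliminates one generator \<open>w = t (a w + s)\<close> at a time: the other
  generators stay in \<open>t\<close> times their own span because \<open>1 - t a\<close> is \<open>1\<close> modulo \<open>t\<close>.\<close>

lemma nakayama:
  assumes A: "subring A R" and t: "t \<in> A" and V: "finite V" "V \<subseteq> carrier R"
    and gen: "\<And>v. v \<in> V \<Longrightarrow> \<exists>s\<in>lin_span A V. v = t \<otimes> s"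
  shows "\<exists>c\<in>A. \<forall>v\<in>V. (\<one> \<oplus> t \<otimes> c) \<otimes> v = \<zero>"
  using V gen
proof (induction V rule: finite_induct)
  case empty
  then show ?case using subringE(2)[OF A] by auto
next
  case (insert w V)
  note sub = subringE(1)[OF A] and tc = subsetD [OF subringE(1)[OF A] t]
  have w: "w \<in> carrier R" and V: "V \<subseteq> carrier R" using insert by auto
  have gen: "\<exists>a\<in>A. \<exists>s\<in>lin_span A V. v = t \<otimes> (a \<otimes> w \<oplus> s)" if v: "v \<in> insert w V" for v
    using insert.prems(2) [OF v] lin_span_insert [OF A insert.prems(1)] by metis
  obtain a s where a: "a \<in> A" "s \<in> lin_span A V" and weq: "w = t \<otimes> (a \<otimes> w \<oplus> s)"
    using gen by blast
  have ac: "a \<in> carrier R" "s \<in> carrier R" using a sub lin_span_closed [OF sub V] by auto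
  \<comment> \<open>With this \<open>b\<close>, the relation \<open>w = t (a w + s)\<close> reads
    \<open>b w = t s\<close>, so \<open>b w\<close> lies in the span of the remaining
    generators.\<close>
  define b where "b = \<one> \<ominus> t \<otimes> a"
  have bA: "b \<in> A" unfolding b_def a_minus_def
    using subringE(3,5,6,7)[OF A] a t by simp
  then have bc: "b \<in> carrier R" using sub by auto
  have bw: "b \<otimes> w = t \<otimes> s"
  proof -
    have "b \<otimes> w = w \<ominus> t \<otimes> (a \<otimes> w)"
      using tc ac w by (simp add: b_def a_minus_def l_distr l_minus m_assoc)
    also have "\<dots> = t \<otimes> (a \<otimes> w \<oplus> s) \<ominus> t \<otimes> (a \<otimes> w)" using weq by simp
    also have "\<dots> = t \<otimes> s" using tc ac w by algebra
    finally show ?thesis .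
  qed
  have "\<exists>s\<in>lin_span A V. v = t \<otimes> s" if v: "v \<in> V" for v
  proof -
    obtain a' s' where a': "a' \<in> A" "s' \<in> lin_span A V" and veq: "v = t \<otimes> (a' \<otimes> w \<oplus> s')"
      using gen v by blast
    have ac': "a' \<in> carrier R" "s' \<in> carrier R" "v \<in> carrier R"
      using a' sub lin_span_closed [OF sub V] V v by auto
    \<comment> \<open>Write \<open>v = t a v + b v\<close> and expand only the second
      \<open>v\<close>: the \<open>w\<close> inside it is now multiplied by \<open>b\<close>, and
      \<open>b w = t s\<close> removes it.\<close>
    let ?r = "a \<otimes> v \<oplus> (b \<otimes> s' \<oplus> (a' \<otimes> t) \<otimes> s)"
    have "v = t \<otimes> (a \<otimes> v) \<oplus> b \<otimes> v"
      using tc ac ac' by (simp add: b_def) algebra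
    also have "b \<otimes> v = t \<otimes> (a' \<otimes> (b \<otimes> w) \<oplus> b \<otimes> s')"
      unfolding veq using tc ac' w bc by algebra
    finally have "v = t \<otimes> ?r"
      unfolding bw using tc ac ac' bc by algebra
    moreover have "?r \<in> lin_span A V"
      by (intro lin_span.step lin_span_add [OF sub V] lin_span_smult [OF A V])
        (use a a' v bA t subringE(6)[OF A] in auto)
    ultimately show ?thesis by blast
  qed
  from insert.IH [OF V this] obtain c where c: "c \<in> A" "\<And>v. v \<in> V \<Longrightarrow> (\<one> \<oplus> t \<otimes> c) \<otimes> v = \<zero>"
    by blast
  have cc: "c \<in> carrier R" using c sub by auto
  \<comment> \<open>Chosen so that \<open>1 + t d = (1 + t c) (1 - t a)\<close>. This product kills
    \<open>V\<close> through its first factor, and \<open>w\<close> because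
    \<open>(1 - t a) w = t s\<close> with \<open>s\<close> in the span of \<open>V\<close>.\<close>
  define d where "d = c \<ominus> a \<ominus> t \<otimes> c \<otimes> a"
  have dA: "d \<in> A" unfolding d_def a_minus_def
    using subringE(5,6,7)[OF A] a c t by simp
  have d: "\<one> \<oplus> t \<otimes> d = (\<one> \<oplus> t \<otimes> c) \<otimes> b"
    using tc cc ac by (simp add: d_def b_def) algebra
  have "(\<one> \<oplus> t \<otimes> c) \<otimes> s = \<zero>"
    by (rule lin_span_annihilate [OF sub V _ c(2) a(2)]) (use tc cc in auto)
  then have "(\<one> \<oplus> t \<otimes> d) \<otimes> w = \<zero>"
    unfolding d m_assoc [OF a_closed [OF one_closed m_closed [OF tc cc]] bc w] bw
    using tc cc ac by (simp add: m_lcomm [of _ t])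
  moreover have "(\<one> \<oplus> t \<otimes> d) \<otimes> v = \<zero>" if v: "v \<in> V" for v
  proof -
    have "(\<one> \<oplus> t \<otimes> d) \<otimes> v = b \<otimes> ((\<one> \<oplus> t \<otimes> c) \<otimes> v)"
      unfolding d using tc cc bc v V by (simp add: m_ac subset_iff)
    then show ?thesis using c v bc by simp
  qed
  ultimately show ?case using dA by blast
qed

section \<open>Arithmetic of polynomial values in Horner form\<close>

context
  fixes A z assumes A: "subring A R" and z: "z \<in> carrier R"
begin

lemma poly_span_closed: "d \<in> poly_span A z n \<Longrightarrow> d \<in> carrier R"
  using subringE(1)[OF A] z by (induction n arbitrary: d) auto

lemma poly_span_SucI: "a \<in> A \<Longrightarrow> d \<in> poly_span A z n \<Longrightarrow> a \<oplus> z \<otimes> d \<in> poly_span A z (Suc n)"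
  by auto

lemma poly_span_base: "a \<in> A \<Longrightarrow> a \<in> poly_span A z n"
proof (induction n arbitrary: a)
  case (Suc n)
  have "a = a \<oplus> z \<otimes> \<zero>" using subringE(1)[OF A] Suc z by auto
  then show ?case using Suc subringE(2)[OF A] by auto
qed simp

lemma poly_span_Suc: "d \<in> poly_span A z n \<Longrightarrow> d \<in> poly_span A z (Suc n)"
proof (induction n arbitrary: d)
  case 0
  then show ?case using poly_span_base [of d "Suc 0"] by simp
next
  case (Suc n)
  then show ?case by fastforce
qed

lemma poly_span_mono: "n \<le> m \<Longrightarrow> d \<in> poly_span A z n \<Longrightarrow> d \<in> poly_span A z m"
  by (induction rule: dec_induct) (auto intro: poly_span_Suc simp del: poly_span.simps)

lemma poly_span_add:
  "d \<in> poly_span A z n \<Longrightarrow> d' \<in> poly_span A z n \<Longrightarrow> d \<oplus> d' \<in> poly_span A z n"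
proof (induction n arbitrary: d d')
  case 0
  then show ?case using subringE(7)[OF A] by simp
next
  case (Suc n)
  then obtain a e a' e' where d: "d = a \<oplus> z \<otimes> e" "a \<in> A" "e \<in> poly_span A z n"
    "d' = a' \<oplus> z \<otimes> e'" "a' \<in> A" "e' \<in> poly_span A z n" by auto
  have "d \<oplus> d' = (a \<oplus> a') \<oplus> z \<otimes> (e \<oplus> e')"
    using d poly_span_closed z subringE(1)[OF A] by (simp add: r_distr a_ac subset_iff)
  then show ?case using d Suc.IH subringE(7)[OF A] poly_span_SucI by simp
qed

lemma poly_span_smult: "a \<in> A \<Longrightarrow> d \<in> poly_span A z n \<Longrightarrow> a \<otimes> d \<in> poly_span A z n"
proof (induction n arbitrary: d)
  case 0
  then show ?case using subringE(6)[OF A] by simp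
next
  case (Suc n)
  then obtain b e where d: "d = b \<oplus> z \<otimes> e" "b \<in> A" "e \<in> poly_span A z n" by auto
  have "a \<otimes> d = a \<otimes> b \<oplus> z \<otimes> (a \<otimes> e)"
    using d poly_span_closed z subringE(1)[OF A] Suc.prems by (simp add: r_distr m_ac subset_iff)
  then show ?case using d Suc subringE(6)[OF A] poly_span_SucI by simp
qed

lemma poly_span_mult_var: "d \<in> poly_span A z n \<Longrightarrow> z \<otimes> d \<in> poly_span A z (Suc n)"
  using poly_span_SucI [OF subringE(2)[OF A], of d n] poly_span_closed [of d n] z by simp

lemma poly_span_pow_mult: "d \<in> poly_span A z n \<Longrightarrow> z [^] k \<otimes> d \<in> poly_span A z (n + k)"
proof (induction k)
  case 0
  then show ?case using poly_span_closed by simp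
next
  case (Suc k)
  have "z [^] Suc k \<otimes> d = z \<otimes> (z [^] k \<otimes> d)"
    using z poly_span_closed [OF Suc.prems] by (simp add: m_ac)
  then show ?case using poly_span_mult_var [OF Suc.IH [OF Suc.prems]] by simp
qed

lemma poly_span_mult:
  "d \<in> poly_span A z n \<Longrightarrow> d' \<in> poly_span A z m \<Longrightarrow> d \<otimes> d' \<in> poly_span A z (n + m)"
proof (induction n arbitrary: d)
  case 0
  then show ?case using poly_span_smult by simp
next
  case (Suc n)
  then obtain a e where d: "d = a \<oplus> z \<otimes> e" "a \<in> A" "e \<in> poly_span A z n" by auto
  have "d \<otimes> d' = a \<otimes> d' \<oplus> z \<otimes> (e \<otimes> d')"
    using d poly_span_closed z subringE(1)[OF A] Suc.prems poly_span_closed [OF Suc.prems(2)]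
    by (simp add: l_distr m_assoc subset_iff)
  moreover have "a \<otimes> d' \<in> poly_span A z (Suc n + m)"
    by (rule poly_span_mono [OF _ poly_span_smult [OF d(2) Suc.prems(2)]]) simp
  moreover have "z \<otimes> (e \<otimes> d') \<in> poly_span A z (Suc n + m)"
    using poly_span_mult_var [OF Suc.IH [OF d(3) Suc.prems(2)]] by simp
  ultimately show ?case using poly_span_add by metis
qed

end

end

context cring
begin

text \<open>With its converse below, the link between the Horner form and the coefficient sums
  computed by \<open>UnivPoly.eval\<close>.\<close>

lemma finsum_poly_span:
  assumes A: "subring A R" and z: "z \<in> carrier R" and f: "f \<in> UNIV \<rightarrow> A"
  shows "(\<Oplus>i\<in>{..n}. f i \<otimes> z [^] i) \<in> poly_span A z n"
proof (induction n)
  case 0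
  have "f 0 \<in> A" using f by auto
  then show ?case using subringE(1)[OF A] by auto
next
  case (Suc n)
  have f': "f i \<in> carrier R" "f i \<in> A" for i using f subringE(1)[OF A] by auto
  have "z [^] Suc n \<otimes> f (Suc n) \<in> poly_span A z (0 + Suc n)"
    by (rule poly_span_pow_mult [OF A z]) (simp add: f')
  then have "f (Suc n) \<otimes> z [^] Suc n \<in> poly_span A z (Suc n)"
    using f' z by (simp only: m_comm nat_pow_closed add_0)
  moreover have "(\<Oplus>i\<in>{..Suc n}. f i \<otimes> z [^] i) = f (Suc n) \<otimes> z [^] Suc n \<oplus> (\<Oplus>i\<in>{..n}. f i \<otimes> z [^] i)"
    using f' z by (subst finsum_Suc) auto
  ultimately show ?case
    using poly_span_add [OF A z _ poly_span_Suc [OF A z Suc]] by metis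
qed

lemma poly_span_finsum:
  assumes A: "subring A R" and z: "z \<in> carrier R" and d: "d \<in> poly_span A z n"
  shows "\<exists>f\<in>UNIV \<rightarrow> A. d = (\<Oplus>i\<in>{..n}. f i \<otimes> z [^] i)"
  using d
proof (induction n arbitrary: d)
  case 0
  then show ?case
    using subringE(1)[OF A] by (intro bexI [of _ "\<lambda>_. d"]) auto
next
  case (Suc n)
  then obtain a e where d: "d = a \<oplus> z \<otimes> e" "a \<in> A" "e \<in> poly_span A z n" by auto
  from Suc.IH [OF d(3)] obtain f where f: "f \<in> UNIV \<rightarrow> A" "e = (\<Oplus>i\<in>{..n}. f i \<otimes> z [^] i)" by blast
  have f': "f i \<in> carrier R" for i using f subringE(1)[OF A] by auto
  have a': "a \<in> carrier R" using d subringE(1)[OF A] by auto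
  let ?f = "case_nat a f"
  have c: "(\<lambda>i. ?f i \<otimes> z [^] i) \<in> {..Suc n} \<rightarrow> carrier R"
    using a' f' z by (auto split: nat.split)
  have "(\<Oplus>i\<in>{..Suc n}. ?f i \<otimes> z [^] i) = (\<Oplus>i\<in>{..n}. f i \<otimes> z [^] Suc i) \<oplus> a"
    using finsum_Suc2 [OF c] a' by simp
  also have "(\<Oplus>i\<in>{..n}. f i \<otimes> z [^] Suc i) = (\<Oplus>i\<in>{..n}. z \<otimes> (f i \<otimes> z [^] i))"
    using f' z by (intro finsum_cong') (auto simp: m_ac)
  also have "\<dots> = z \<otimes> e"
    using f' z by (simp add: f(2) finsum_rdistr Pi_def)
  also have "z \<otimes> e \<oplus> a = d"
    using d a' z poly_span_closed [OF A z] by (simp add: a_comm)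
  finally have "d = (\<Oplus>i\<in>{..Suc n}. ?f i \<otimes> z [^] i)" by simp
  moreover have "?f \<in> UNIV \<rightarrow> A" using f d by (auto simp: Pi_iff split: nat.split)
  ultimately show ?case by blast
qed

text \<open>Only the monomials with \<open>i = n\<close> need the equation of \<open>x\<close>; all
  others are shifted to the next monomial.\<close>

lemma monomial_span_step:
  assumes A: "subring A R" and x: "x \<in> carrier R" "x [^] Suc n \<in> poly_span A x n" and y: "y \<in> carrier R"
    and v: "v \<in> (\<lambda>(i, j). x [^] i \<otimes> y [^] j) ` ({..n} \<times> {..m::nat})" (is "v \<in> ?V")
  shows "x \<otimes> v \<in> lin_span A ?V"
proof -
  have V: "?V \<subseteq> carrier R" using x y by auto
  note sub = subringE(1)[OF A]
  \<comment> \<open>The prefix \<open>x [^] i\<close> is general so that unfolding the Horner form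
    of \<open>d\<close> can move a factor \<open>x\<close> into it; \<open>i + k \<le> n\<close>
    keeps the exponents in range.\<close>
  have *: "x [^] i \<otimes> d \<otimes> y [^] j \<in> lin_span A ?V" if "d \<in> poly_span A x k" "i + k \<le> n" "j \<le> m" for d i j k
    using that
  proof (induction k arbitrary: d i)
    case 0
    then have "x [^] i \<otimes> d \<otimes> y [^] j = d \<otimes> (x [^] i \<otimes> y [^] j)"
      using x y sub by (auto simp: m_ac)
    moreover have "x [^] i \<otimes> y [^] j \<in> ?V" using 0 by auto
    ultimately show ?case
      using lin_span_smult [OF A V _ lin_span_base [OF A V]] 0 by auto
  next
    case (Suc k)
    then obtain a e where d: "d = a \<oplus> x \<otimes> e" "a \<in> A" "e \<in> poly_span A x k" by auto
    have "a \<in> carrier R" "e \<in> carrier R" using d sub poly_span_closed [OF A x(1)] by auto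
    then have "x [^] i \<otimes> d \<otimes> y [^] j = a \<otimes> (x [^] i \<otimes> y [^] j) \<oplus> x [^] Suc i \<otimes> e \<otimes> y [^] j"
      using x y by (simp add: d r_distr l_distr m_ac)
    moreover have "x [^] i \<otimes> y [^] j \<in> ?V" using Suc by auto
    ultimately show ?case
      using lin_span.step [OF d(2)] Suc.IH [OF d(3), of "Suc i"] Suc.prems by auto
  qed
  obtain i j where ij: "v = x [^] i \<otimes> y [^] j" "i \<le> n" "j \<le> m" using v by auto
  have xv: "x \<otimes> v = x [^] Suc i \<otimes> y [^] j" using ij x y by (simp add: m_ac)
  show ?thesis
  proof (cases "i = n")
    case True
    then show ?thesis using * [OF x(2), of 0 j] ij x y xv by simp
  next
    case False
    then have "Suc i \<in> {..n}" "j \<in> {..m}" using ij by auto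
    then have "x \<otimes> v \<in> ?V" unfolding xv by (intro image_eqI [of _ _ "(Suc i, j)"]) auto
    then show ?thesis by (rule lin_span_base [OF A V])
  qed
qed

end

section \<open>Integrality from a stable finitely generated span\<close>

context field
begin

text \<open>In place of a determinant, \<open>nakayama\<close> is applied over \<open>A[1/z]\<close>
  with \<open>t = 1/z\<close>: stability under \<open>z\<close> puts \<open>V\<close> into
  \<open>t\<close> times its span, so some \<open>1 + t c\<close> annihilates
  \<open>\<one> \<in> V\<close>. Clearing denominators in \<open>1 + t c = 0\<close> leaves a monic
  equation for \<open>z\<close>.\<close>

lemma integral_overI:
  assumes A: "subring A R" and z: "z \<in> carrier R" and V: "finite V" "V \<subseteq> carrier R" "\<one> \<in> V"
    and zV: "\<And>v. v \<in> V \<Longrightarrow> z \<otimes> v \<in> lin_span A V"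
  shows "integral_over A z"
proof (cases "z = \<zero>")
  case True
  then have "z [^] Suc 0 \<in> poly_span A z 0" using subringE(2)[OF A] by simp
  then show ?thesis using z unfolding integral_over_def by blast
next
  case False
  define t where "t = inv z"
  have t: "t \<in> carrier R" "z \<otimes> t = \<one>" "t \<otimes> z = \<one>"
    using False z by (simp_all add: t_def field_Units)
  \<comment> \<open>This is \<open>A[1/z]\<close>: the elements that become polynomials in
    \<open>z\<close> of degree at most \<open>n\<close> after multiplication by
    \<open>z [^] n\<close>, for some \<open>n\<close>.\<close>
  define C where "C = {c \<in> carrier R. \<exists>n::nat. z [^] n \<otimes> c \<in> poly_span A z n}"
  note sub = subringE(1)[OF A]
  have C: "subring C R"
  proof (rule subringI)
    show "C \<subseteq> carrier R" by (auto simp: C_def)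
    have "z [^] (0::nat) \<otimes> \<one> \<in> poly_span A z 0" using subringE(3)[OF A] by simp
    then show "\<one> \<in> C" unfolding C_def by blast
    fix c c' assume "c \<in> C" "c' \<in> C"
    then obtain n m :: nat where c: "c \<in> carrier R" "z [^] n \<otimes> c \<in> poly_span A z n"
      "c' \<in> carrier R" "z [^] m \<otimes> c' \<in> poly_span A z m" by (auto simp: C_def)
    have "z [^] n \<otimes> (\<ominus> c) = (\<ominus> \<one>) \<otimes> (z [^] n \<otimes> c)"
      using c z by (simp add: r_minus l_minus)
    then have "z [^] n \<otimes> (\<ominus> c) \<in> poly_span A z n"
      using poly_span_smult [OF A z _ c(2)] subringE(3,5)[OF A] by metis
    then show "\<ominus> c \<in> C" using c by (auto simp: C_def)
    have "z [^] (n + m) \<otimes> (c \<otimes> c') = (z [^] n \<otimes> c) \<otimes> (z [^] m \<otimes> c')"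
      using c z by (simp add: m_ac flip: nat_pow_mult)
    then have "z [^] (n + m) \<otimes> (c \<otimes> c') \<in> poly_span A z (n + m)"
      using poly_span_mult [OF A z c(2,4)] by simp
    then show "c \<otimes> c' \<in> C" using c unfolding C_def by blast
    have "z [^] (n + m) \<otimes> (c \<oplus> c') = z [^] m \<otimes> (z [^] n \<otimes> c) \<oplus> z [^] n \<otimes> (z [^] m \<otimes> c')"
      using c z by (simp add: r_distr m_ac flip: nat_pow_mult)
    then have "z [^] (n + m) \<otimes> (c \<oplus> c') \<in> poly_span A z (n + m)"
      using poly_span_pow_mult [OF A z c(2), of m] poly_span_pow_mult [OF A z c(4), of n]
        poly_span_add [OF A z] by (simp add: add.commute)
    then show "c \<oplus> c' \<in> C" using c unfolding C_def by blast
  qed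
  have "z [^] (1::nat) \<otimes> t \<in> poly_span A z 1"
    using t z poly_span_base [OF A z subringE(3)[OF A]] by (simp del: poly_span.simps)
  then have tC: "t \<in> C" using t unfolding C_def by blast
  have "z [^] (0::nat) \<otimes> a \<in> poly_span A z 0" if "a \<in> A" for a
    using that sub by auto
  then have AC: "A \<subseteq> C" using sub unfolding C_def by blast
  have "\<exists>s\<in>lin_span C V. v = t \<otimes> s" if v: "v \<in> V" for v
  proof
    show "v = t \<otimes> (z \<otimes> v)" using v V t z by (auto simp flip: m_assoc)
    show "z \<otimes> v \<in> lin_span C V" using zV [OF v] AC by (rule lin_span_mono)
  qed
  from nakayama [OF C tC V(1,2) this] obtain c where c: "c \<in> C" "(\<one> \<oplus> t \<otimes> c) \<otimes> \<one> = \<zero>"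
    using V(3) by blast
  then obtain n :: nat where n: "c \<in> carrier R" "z [^] n \<otimes> c \<in> poly_span A z n" by (auto simp: C_def)
  have "\<one> \<oplus> t \<otimes> c = \<zero>" using c n t by simp
  then have "z [^] Suc n \<otimes> (\<one> \<oplus> t \<otimes> c) = \<zero>" using z by simp
  moreover have "z [^] Suc n \<otimes> (\<one> \<oplus> t \<otimes> c) = z [^] Suc n \<oplus> z [^] n \<otimes> c"
  proof -
    have "z \<otimes> (t \<otimes> c) = c" using t z n by (simp flip: m_assoc)
    then have "z [^] Suc n \<otimes> (t \<otimes> c) = z [^] n \<otimes> c" using t z n by (simp add: m_assoc)
    then show ?thesis using t z n by (simp add: r_distr)
  qed
  ultimately have "z [^] Suc n = \<ominus> (z [^] n \<otimes> c)"
    using z n by (simp add: minus_equality [symmetric] a_comm)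
  also have "\<dots> = (\<ominus> \<one>) \<otimes> (z [^] n \<otimes> c)" using z n by (simp add: l_minus)
  also have "\<dots> \<in> poly_span A z n"
    using poly_span_smult [OF A z _ n(2)] subringE(3,5)[OF A] by metis
  finally show ?thesis using z unfolding integral_over_def by blast
qed

text \<open>The monomials in \<open>x\<close> and \<open>y\<close> below the degrees of their two
  equations contain 1, and their span is stable under both elements, hence under negative, product
  and sum.\<close>

lemma subring_integral_over:
  assumes A: "subring A R"
  shows "subring {z. integral_over A z} R"
proof (rule subringI)
  show "{z. integral_over A z} \<subseteq> carrier R" by (auto simp: integral_over_def)
  have "\<one> [^] Suc 0 \<in> poly_span A \<one> 0" using subringE(3)[OF A] by simp
  then show "\<one> \<in> {z. integral_over A z}" unfolding integral_over_def by blast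
  fix x y assume "x \<in> {z. integral_over A z}" "y \<in> {z. integral_over A z}"
  then obtain n m where x: "x \<in> carrier R" "x [^] Suc n \<in> poly_span A x n"
    and y: "y \<in> carrier R" "y [^] Suc m \<in> poly_span A y m"
    by (auto simp: integral_over_def)
  let ?V = "(\<lambda>(i, j). x [^] i \<otimes> y [^] j) ` ({..n} \<times> {..m})"
  have V: "finite ?V" "?V \<subseteq> carrier R" using x y by auto
  have "(\<lambda>(i, j). x [^] i \<otimes> y [^] j) (0::nat, 0::nat) \<in> ?V" by (rule imageI) simp
  then have 1: "\<one> \<in> ?V" by simp
  have xV: "x \<otimes> v \<in> lin_span A ?V" if "v \<in> ?V" for v
    using monomial_span_step [OF A x y(1) that] .
  have sw: "(\<lambda>(i, j). y [^] i \<otimes> x [^] j) ` ({..m} \<times> {..n}) = ?V"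
    using x y by (auto simp: m_comm image_iff) 
  have yV: "y \<otimes> v \<in> lin_span A ?V" if "v \<in> ?V" for v
    using monomial_span_step [OF A y x(1), of v n] that unfolding sw by blast
  note smult = lin_span_smult [OF A V(2)]
  have m1: "\<ominus> \<one> \<in> A" using subringE(3,5)[OF A] by simp
  have xm: "(\<ominus> x) \<otimes> v = (\<ominus> \<one>) \<otimes> (x \<otimes> v)" if "v \<in> ?V" for v
    using that V x by (auto simp: l_minus)
  have "integral_over A (\<ominus> x)"
    by (rule integral_overI [OF A _ V 1]) (use x xm smult [OF m1] xV in auto)
  then show "\<ominus> x \<in> {z. integral_over A z}" by simp
  have xym: "(x \<otimes> y) \<otimes> v = x \<otimes> (y \<otimes> v)" if "v \<in> ?V" for v
    using that V x y by (auto simp: m_assoc)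
  have "integral_over A (x \<otimes> y)"
    by (rule integral_overI [OF A _ V 1], use x y in simp)
      (simp only: xym, rule lin_span_map [OF A V(2) x(1) xV V(2) smult yV])
  then show "x \<otimes> y \<in> {z. integral_over A z}" by simp
  have xya: "(x \<oplus> y) \<otimes> v = x \<otimes> v \<oplus> y \<otimes> v" if "v \<in> ?V" for v
    using that V x y by (auto simp: l_distr)
  have "integral_over A (x \<oplus> y)"
    by (rule integral_overI [OF A _ V 1], use x y in simp)
      (simp only: xya, rule lin_span_add [OF subringE(1)[OF A] V(2) xV yV])
  then show "x \<oplus> y \<in> {z. integral_over A z}" by simp
qed

end

section \<open>Finite extensions of the p-adic numbers\<close>

lemma UP_simps: "carrier (UP R) = up R" "f \<in> up R \<Longrightarrow> UnivPoly.coeff (UP R) f n = f n"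
  by (simp_all add: UP_def)

section \<open>The ring of integers as an integral closure\<close>

locale finite_ext = field K for K :: "'k ring" (structure) +
  fixes p :: nat and \<iota> :: "(nat \<Rightarrow> int) \<Rightarrow> 'k"
  assumes p: "Factorial_Ring.prime p" and fin_ext: "finite_extension_Qp p K \<iota>"
begin

lemma p_pos: "p > 0" using p prime_gt_0_nat by blast

sublocale Zp: cring "Zp p" by (rule cring_Zp [OF p_pos])

lemma iota_hom: "\<iota> \<in> ring_hom (Zp p) K"
  using fin_ext by (simp add: finite_extension_Qp_def)

sublocale iota: ring_hom_cring "Zp p" K \<iota>
  by (intro ring_hom_cringI Zp.cring_axioms cring_axioms iota_hom)

lemma iota_inj: "inj_on \<iota> (carrier (Zp p))"
  using fin_ext by (simp add: finite_extension_Qp_def)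

abbreviation "A \<equiv> \<iota> ` carrier (Zp p)"

lemma subring_A: "subring A K"
proof (rule subringI)
  show "A \<subseteq> carrier K" by auto
  show "\<one> \<in> A" using iota.hom_one Zp.one_closed by (metis imageI)
  fix x y assume "x \<in> A" "y \<in> A"
  then obtain a b where ab: "a \<in> carrier (Zp p)" "b \<in> carrier (Zp p)" "x = \<iota> a" "y = \<iota> b" by blast
  show "\<ominus> x \<in> A" using ab iota.hom_a_inv Zp.a_inv_closed by (metis imageI)
  show "x \<otimes> y \<in> A" using ab iota.hom_mult Zp.m_closed by (metis imageI)
  show "x \<oplus> y \<in> A" using ab iota.hom_add Zp.a_closed by (metis imageI)
qed

lemma Zp_one_not_zero: "\<one>\<^bsub>Zp p\<^esub> \<noteq> \<zero>\<^bsub>Zp p\<^esub>"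
  using p prime_gt_1_nat by (auto simp: Zp_simps fun_eq_iff intro!: exI [of _ 1])

text \<open>The two notions differ in degree 0, which \<open>integral_over\<close> does not admit;
  there a monic polynomial is the constant 1 and has no root in a field.\<close>

lemma monic_root_iff_integral:
  assumes x: "x \<in> carrier K"
  shows "(\<exists>P. monic_root (Zp p) K \<iota> x P) \<longleftrightarrow> integral_over A x"
proof
  interpret U: UP_pre_univ_prop "Zp p" K \<iota> "UP (Zp p)"
    by (unfold_locales) (simp_all add: iota_hom)
  assume "\<exists>P. monic_root (Zp p) K \<iota> x P"
  then obtain P where P: "P \<in> carrier (UP (Zp p))"
    "UnivPoly.coeff (UP (Zp p)) P (deg (Zp p) P) = \<one>\<^bsub>Zp p\<^esub>"
    "UnivPoly.eval (Zp p) K \<iota> x P = \<zero>"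
    by (auto simp: monic_root_def)
  let ?c = "\<lambda>i. \<iota> (UnivPoly.coeff (UP (Zp p)) P i)"
  have c: "?c i \<in> A" "?c i \<in> carrier K" for i using P(1) U.coeff_closed by auto
  have e: "(\<Oplus>i\<in>{..deg (Zp p) P}. ?c i \<otimes> x [^] i) = \<zero>"
    using P by (simp add: UnivPoly.eval_def)
  have l: "?c (deg (Zp p) P) = \<one>" using P(2) by simp
  show "integral_over A x"
  proof (cases "deg (Zp p) P")
    case 0
    then have "\<one> = \<zero>" using e l x by simp
    then show ?thesis by simp
  next
    case (Suc n)
    let ?s = "\<Oplus>i\<in>{..n}. ?c i \<otimes> x [^] i"
    have s: "?s \<in> carrier K" using c x by auto
    have "x [^] Suc n \<oplus> ?s = \<zero>"
      using e l c x unfolding Suc by (subst (asm) finsum_Suc) auto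
    then have "x [^] Suc n = \<ominus> ?s"
      using s x by (metis minus_equality nat_pow_closed)
    also have "\<dots> = (\<ominus> \<one>) \<otimes> ?s" using s by (simp add: l_minus)
    also have "\<dots> \<in> poly_span A x n"
      by (rule poly_span_smult [OF subring_A x _ finsum_poly_span [OF subring_A x]])
        (use c subringE(3,5)[OF subring_A] in auto)
    finally show ?thesis using x unfolding integral_over_def by blast
  qed
next
  interpret U: UP_pre_univ_prop "Zp p" K \<iota> "UP (Zp p)"
    by (unfold_locales) (simp_all add: iota_hom)
  assume "integral_over A x"
  then obtain n where n: "x [^] Suc n \<in> poly_span A x n" by (auto simp: integral_over_def)
  from poly_span_finsum [OF subring_A x n] obtain f where
    f: "f \<in> UNIV \<rightarrow> A" "x [^] Suc n = (\<Oplus>i\<in>{..n}. f i \<otimes> x [^] i)" by blast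
  have "\<forall>i. \<exists>a\<in>carrier (Zp p). f i = \<iota> a" using f(1) by (auto simp: Pi_iff image_iff)
  then obtain a where a: "\<And>i. a i \<in> carrier (Zp p)" "\<And>i. f i = \<iota> (a i)" by metis
  \<comment> \<open>Elements of \<open>UP\<close> are coefficient functions, so the polynomial is
    written down directly; the lower coefficients are negated to bring the relation to one
    side.\<close>
  define P where "P i = (if i \<le> n then \<ominus>\<^bsub>Zp p\<^esub> a i else if i = Suc n then \<one>\<^bsub>Zp p\<^esub> else \<zero>\<^bsub>Zp p\<^esub>)" for i
  have P: "P \<in> carrier (UP (Zp p))"
  proof -
    have "bound \<zero>\<^bsub>Zp p\<^esub> (Suc n) P" by (rule bound.intro) (simp add: P_def)
    then have "P \<in> up (Zp p)" by (intro mem_upI) (auto simp: P_def a(1))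
    then show ?thesis by (simp only: UP_simps)
  qed
  have cP: "UnivPoly.coeff (UP (Zp p)) P i = P i" for i
    using P by (simp only: UP_simps)
  have dP: "deg (Zp p) P = Suc n"
  proof (rule antisym)
    show "deg (Zp p) P \<le> Suc n"
      by (rule U.deg_aboveI [OF _ P]) (simp add: cP P_def)
    show "Suc n \<le> deg (Zp p) P"
      by (rule U.deg_belowI [OF _ P]) (simp add: cP P_def Zp_one_not_zero)
  qed
  have "UnivPoly.eval (Zp p) K \<iota> x P = (\<Oplus>i\<in>{..Suc n}. \<iota> (P i) \<otimes> x [^] i)"
    using P by (simp add: UnivPoly.eval_def dP cP)
  also have "\<dots> = x [^] Suc n \<oplus> (\<Oplus>i\<in>{..n}. \<iota> (P i) \<otimes> x [^] i)"
    using a x by (subst finsum_Suc) (auto simp: P_def)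
  also have "(\<Oplus>i\<in>{..n}. \<iota> (P i) \<otimes> x [^] i) = (\<Oplus>i\<in>{..n}. (\<ominus> \<one>) \<otimes> (f i \<otimes> x [^] i))"
    using a x by (intro finsum_cong') (auto simp: P_def l_minus)
  also have "\<dots> = (\<ominus> \<one>) \<otimes> x [^] Suc n"
    unfolding f(2) using a x by (subst finsum_rdistr) auto
  also have "x [^] Suc n \<oplus> (\<ominus> \<one>) \<otimes> x [^] Suc n = \<zero>"
    using x by (simp add: l_minus r_neg)
  finally have "monic_root (Zp p) K \<iota> x P"
    using P by (simp add: monic_root_def dP cP) (simp add: P_def)
  then show "\<exists>P. monic_root (Zp p) K \<iota> x P" by blast
qed

abbreviation "O_K \<equiv> integer_ring p K \<iota>"

lemma O_eq: "O_K = K\<lparr>carrier := {x. integral_over A x}\<rparr>"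
proof -
  have "{x \<in> carrier K. \<exists>P. monic_root (Zp p) K \<iota> x P} = {x. integral_over A x}"
    using monic_root_iff_integral by (auto simp: integral_over_def)
  then show ?thesis by (simp add: integer_ring_def)
qed

lemma subring_O: "subring (carrier O_K) K"
  using subring_integral_over [OF subring_A] by (simp add: O_eq)

lemma O_simps: "\<one>\<^bsub>O_K\<^esub> = \<one>" "\<zero>\<^bsub>O_K\<^esub> = \<zero>" "x \<oplus>\<^bsub>O_K\<^esub> y = x \<oplus> y" "x \<otimes>\<^bsub>O_K\<^esub> y = x \<otimes> y"
  by (simp_all add: O_eq)

sublocale OK: cring O_K
  using subcring_iff [OF subringE(1)[OF subring_O]] subcringI' [OF subring_O] by (simp add: O_eq)

lemma A_subset_O: "A \<subseteq> carrier O_K"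
proof
  fix a assume "a \<in> A"
  moreover have "a \<in> carrier K" using \<open>a \<in> A\<close> by auto
  ultimately have "a [^] Suc 0 \<in> poly_span A a 0" by simp
  then have "integral_over A a" using \<open>a \<in> carrier K\<close> unfolding integral_over_def by blast
  then show "a \<in> carrier O_K" by (simp add: O_eq)
qed

section \<open>Fractions of p-adic integers inside \<open>K\<close>\<close>

lemma iota_eq_zero_iff: "z \<in> carrier (Zp p) \<Longrightarrow> \<iota> z = \<zero> \<longleftrightarrow> z = \<zero>\<^bsub>Zp p\<^esub>"
  using inj_onD [OF iota_inj, of z "\<zero>\<^bsub>Zp p\<^esub>"] by auto

lemma frac_mem: "x \<in> carrier (Zp p) \<Longrightarrow> y \<in> carrier (Zp p) \<Longrightarrow> \<iota> y \<noteq> \<zero> \<Longrightarrow> \<iota> x \<otimes> inv \<iota> y \<in> Qp_in p K \<iota>"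
  by (auto simp: Qp_in_def iota_eq_zero_iff)

lemma frac_cases:
  assumes "k \<in> Qp_in p K \<iota>"
  obtains x y where "x \<in> carrier (Zp p)" "y \<in> carrier (Zp p)" "\<iota> y \<noteq> \<zero>" "k = \<iota> x \<otimes> inv \<iota> y"
  using assms by (auto simp: Qp_in_def iota_eq_zero_iff)

lemma inv_closed_nonzero [simp]: "x \<in> carrier K \<Longrightarrow> x \<noteq> \<zero> \<Longrightarrow> inv x \<in> carrier K"
  by (simp add: field_Units)

lemma eq_frac_iff:
  assumes "x \<in> carrier K" "y \<in> carrier K" "y \<noteq> \<zero>" "k \<in> carrier K"
  shows "k = x \<otimes> inv y \<longleftrightarrow> k \<otimes> y = x"
proof -
  have "inv y \<in> carrier K" "inv y \<otimes> y = \<one>" "y \<otimes> inv y = \<one>" using assms by (simp_all add: field_Units)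
  then show ?thesis using assms by (auto simp: m_assoc)
qed

text \<open>The dimension theory used for \<open>finite_dimension\<close> works over a subfield.
  Identities between fractions are proved after multiplication by a common denominator.\<close>

lemma subfield_Qp: "subfield (Qp_in p K \<iota>) K"
proof (rule subfieldI')
  show "subring (Qp_in p K \<iota>) K"
  proof (rule subringI)
    show "Qp_in p K \<iota> \<subseteq> carrier K"
      by (auto elim!: frac_cases)
    have "\<one> = \<iota> \<one>\<^bsub>Zp p\<^esub> \<otimes> inv \<iota> \<one>\<^bsub>Zp p\<^esub>" by simp
    then show "\<one> \<in> Qp_in p K \<iota>"
      using frac_mem [OF Zp.one_closed Zp.one_closed] by simp
    fix k l assume "k \<in> Qp_in p K \<iota>" "l \<in> Qp_in p K \<iota>"
    then obtain x y x' y' where k: "x \<in> carrier (Zp p)" "y \<in> carrier (Zp p)" "\<iota> y \<noteq> \<zero>" "k = \<iota> x \<otimes> inv \<iota> y"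
      and l: "x' \<in> carrier (Zp p)" "y' \<in> carrier (Zp p)" "\<iota> y' \<noteq> \<zero>" "l = \<iota> x' \<otimes> inv \<iota> y'"
      by (metis frac_cases)
    have c: "k \<in> carrier K" "l \<in> carrier K" using k l by auto
    have ky: "k \<otimes> \<iota> y = \<iota> x" "l \<otimes> \<iota> y' = \<iota> x'"
      using k l c by (simp_all flip: eq_frac_iff)
    have yy: "\<iota> (y \<otimes>\<^bsub>Zp p\<^esub> y') \<noteq> \<zero>" using k l integral by auto
    have "\<ominus> k = \<iota> (\<ominus>\<^bsub>Zp p\<^esub> x) \<otimes> inv \<iota> y" using k by (simp add: l_minus)
    then show "\<ominus> k \<in> Qp_in p K \<iota>" using frac_mem [OF Zp.a_inv_closed] k by metis
    have "k \<otimes> l = \<iota> (x \<otimes>\<^bsub>Zp p\<^esub> x') \<otimes> inv \<iota> (y \<otimes>\<^bsub>Zp p\<^esub> y')"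
    proof (subst eq_frac_iff)
      have "k \<otimes> l \<otimes> \<iota> (y \<otimes>\<^bsub>Zp p\<^esub> y') = (k \<otimes> \<iota> y) \<otimes> (l \<otimes> \<iota> y')"
        using k(1-3) l(1-3) c by (simp add: m_ac)
      then show "k \<otimes> l \<otimes> \<iota> (y \<otimes>\<^bsub>Zp p\<^esub> y') = \<iota> (x \<otimes>\<^bsub>Zp p\<^esub> x')"
        unfolding ky using k l by simp
    qed (use k l c yy in auto)
    then show "k \<otimes> l \<in> Qp_in p K \<iota>"
      using frac_mem [OF _ _ yy] k(1,2) l(1,2) by (metis Zp.m_closed)
    have "k \<oplus> l = \<iota> (x \<otimes>\<^bsub>Zp p\<^esub> y' \<oplus>\<^bsub>Zp p\<^esub> x' \<otimes>\<^bsub>Zp p\<^esub> y) \<otimes> inv \<iota> (y \<otimes>\<^bsub>Zp p\<^esub> y')"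
    proof (subst eq_frac_iff)
      have "(k \<oplus> l) \<otimes> \<iota> (y \<otimes>\<^bsub>Zp p\<^esub> y') = (k \<otimes> \<iota> y) \<otimes> \<iota> y' \<oplus> (l \<otimes> \<iota> y') \<otimes> \<iota> y"
        using k(1-3) l(1-3) c by (simp add: l_distr r_distr m_ac)
      then show "(k \<oplus> l) \<otimes> \<iota> (y \<otimes>\<^bsub>Zp p\<^esub> y') = \<iota> (x \<otimes>\<^bsub>Zp p\<^esub> y' \<oplus>\<^bsub>Zp p\<^esub> x' \<otimes>\<^bsub>Zp p\<^esub> y)"
        unfolding ky using k l by simp
    qed (use k l c yy in auto)
    then show "k \<oplus> l \<in> Qp_in p K \<iota>"
      using frac_mem [OF _ _ yy] k(1,2) l(1,2) by (metis Zp.m_closed Zp.a_closed)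
  qed
next
  fix k assume "k \<in> Qp_in p K \<iota> - {\<zero>}"
  then have "k \<in> Qp_in p K \<iota>" and k0: "k \<noteq> \<zero>" by auto
  from this(1) obtain x y where k: "x \<in> carrier (Zp p)" "y \<in> carrier (Zp p)" "\<iota> y \<noteq> \<zero>" "k = \<iota> x \<otimes> inv \<iota> y"
    by (rule frac_cases)
  have c: "k \<in> carrier K" using k by auto
  then have ky: "k \<otimes> \<iota> y = \<iota> x" using k by (simp flip: eq_frac_iff)
  then have x0: "\<iota> x \<noteq> \<zero>" using k k0 c integral by auto
  have i: "inv k \<in> carrier K" "inv k \<otimes> k = \<one>" using c k0 by (simp_all add: field_Units)
  have "inv k = \<iota> y \<otimes> inv \<iota> x"
  proof (subst eq_frac_iff)
    show "inv k \<otimes> \<iota> x = \<iota> y"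
      unfolding ky [symmetric] using i c k(1,2) by (simp flip: m_assoc)
  qed (use k c i x0 in auto)
  then show "inv k \<in> Qp_in p K \<iota>" using frac_mem k x0 by simp
qed

text \<open>Multiplication by the product of the two denominators carries the question back to
  \<open>Zp_total_divisibility\<close>.\<close>

lemma Qp_total_divisibility:
  assumes "k \<in> Qp_in p K \<iota>" "l \<in> Qp_in p K \<iota>"
  shows "\<exists>a\<in>A. k = a \<otimes> l \<or> l = a \<otimes> k"
proof -
  obtain x y x' y' where k: "x \<in> carrier (Zp p)" "y \<in> carrier (Zp p)" "\<iota> y \<noteq> \<zero>" "k = \<iota> x \<otimes> inv \<iota> y"
    and l: "x' \<in> carrier (Zp p)" "y' \<in> carrier (Zp p)" "\<iota> y' \<noteq> \<zero>" "l = \<iota> x' \<otimes> inv \<iota> y'"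
    using assms by (metis frac_cases)
  have c: "k \<in> carrier K" "l \<in> carrier K" using k l by auto
  have ky: "k \<otimes> \<iota> y = \<iota> x" "l \<otimes> \<iota> y' = \<iota> x'"
    using k l c by (simp_all flip: eq_frac_iff)
  define s where "s = \<iota> y \<otimes> \<iota> y'"
  have s: "s \<in> carrier K" "s \<noteq> \<zero>" using k l integral by (auto simp: s_def)
  have ks: "k \<otimes> s = \<iota> (x \<otimes>\<^bsub>Zp p\<^esub> y')" "l \<otimes> s = \<iota> (x' \<otimes>\<^bsub>Zp p\<^esub> y)"
  proof -
    have "k \<otimes> s = (k \<otimes> \<iota> y) \<otimes> \<iota> y'" "l \<otimes> s = (l \<otimes> \<iota> y') \<otimes> \<iota> y"
      using k(1-3) l(1-3) c by (simp_all add: s_def m_ac)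
    then show "k \<otimes> s = \<iota> (x \<otimes>\<^bsub>Zp p\<^esub> y')" "l \<otimes> s = \<iota> (x' \<otimes>\<^bsub>Zp p\<^esub> y)"
      unfolding ky using k(1-3) l(1-3) by simp_all
  qed
  obtain z where z: "z \<in> carrier (Zp p)" "x \<otimes>\<^bsub>Zp p\<^esub> y' = z \<otimes>\<^bsub>Zp p\<^esub> (x' \<otimes>\<^bsub>Zp p\<^esub> y) \<or>
    x' \<otimes>\<^bsub>Zp p\<^esub> y = z \<otimes>\<^bsub>Zp p\<^esub> (x \<otimes>\<^bsub>Zp p\<^esub> y')"
    using Zp_total_divisibility [OF p] k l by (metis Zp.m_closed)
  have "k \<otimes> s = (\<iota> z \<otimes> l) \<otimes> s \<or> l \<otimes> s = (\<iota> z \<otimes> k) \<otimes> s"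
    using z(2)
  proof
    assume "x \<otimes>\<^bsub>Zp p\<^esub> y' = z \<otimes>\<^bsub>Zp p\<^esub> (x' \<otimes>\<^bsub>Zp p\<^esub> y)"
    then have "k \<otimes> s = \<iota> z \<otimes> (l \<otimes> s)" unfolding ks using z(1) k(1-3) l(1-3) by simp
    then show ?thesis using z(1) c s by (simp add: m_assoc)
  next
    assume "x' \<otimes>\<^bsub>Zp p\<^esub> y = z \<otimes>\<^bsub>Zp p\<^esub> (x \<otimes>\<^bsub>Zp p\<^esub> y')"
    then have "l \<otimes> s = \<iota> z \<otimes> (k \<otimes> s)" unfolding ks using z(1) k(1-3) l(1-3) by simp
    then show ?thesis using z(1) c s by (simp add: m_assoc)
  qed
  then have "k = \<iota> z \<otimes> l \<or> l = \<iota> z \<otimes> k"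
    using m_rcancel [OF s(2,1)] c z(1) by (metis iota.hom_closed m_closed)
  then show ?thesis using z(1) by blast
qed

text \<open>The divisor is an element of least valuation: a new element is either divisible by the
  current candidate or replaces it.\<close>

lemma Qp_common_divisor:
  assumes "finite S" "S \<noteq> {}" "S \<subseteq> Qp_in p K \<iota>"
  shows "\<exists>m\<in>S. \<forall>k\<in>S. \<exists>a\<in>A. k = a \<otimes> m"
  using assms
proof (induction S rule: finite_ne_induct)
  case (singleton k)
  moreover have "k \<in> carrier K" using singleton subfieldE(3)[OF subfield_Qp] by auto
  ultimately show ?case using subringE(3)[OF subring_A] by (metis l_one singletonD singletonI)
next
  case (insert k S)
  then obtain m where m: "m \<in> S" "\<forall>k\<in>S. \<exists>a\<in>A. k = a \<otimes> m" by auto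
  have c: "k \<in> carrier K" "m \<in> carrier K" using m insert subfieldE(3)[OF subfield_Qp] by auto
  obtain a where a: "a \<in> A" "k = a \<otimes> m \<or> m = a \<otimes> k"
    using Qp_total_divisibility [of k m] insert m by blast
  show ?case
    using a(2)
  proof
    assume "k = a \<otimes> m"
    then show ?thesis using a(1) m by (intro bexI [of _ m]) auto
  next
    assume mk: "m = a \<otimes> k"
    have "\<exists>b\<in>A. l = b \<otimes> k" if l: "l \<in> S" for l
    proof -
      obtain b where b: "b \<in> A" "l = b \<otimes> m" using bspec [OF m(2) l] by blast
      then have "b \<in> carrier K" "a \<in> carrier K" using a(1) subringE(1)[OF subring_A] by auto
      then have "l = (b \<otimes> a) \<otimes> k" unfolding b(2) mk using c by (simp add: m_assoc)
      then show ?thesis using subringE(6)[OF subring_A b(1) a(1)] by blast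
    qed
    moreover have "k = \<one> \<otimes> k" using c by simp
    ultimately show ?thesis using subringE(3)[OF subring_A] by (intro bexI [of _ k]) auto
  qed
qed

end

section \<open>Integral relations of bounded length\<close>

context finite_ext begin

text \<open>\<open>eval\<close> reads coefficients from the highest power down, whence the reversed
  list of exponents.\<close>

lemma combine_powers:
  assumes "x \<in> carrier K" "set Ks \<subseteq> carrier K"
  shows "combine Ks (map (\<lambda>i. x [^] i) (rev [0..<length Ks])) = eval Ks x"
  using assms by (induction Ks) simp_all

text \<open>A linear dependence among the powers of \<open>x\<close> is rescaled so that its coefficients are integral
  and one of them is \<open>1\<close>; it then survives reduction modulo the maximal ideal.\<close>

lemma bounded_integral_relation:
  "\<exists>n. \<forall>x\<in>carrier K. \<exists>Ks. length Ks = n \<and> set Ks \<subseteq> A \<and> \<one> \<in> set Ks \<and> eval Ks x = \<zero>"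
proof -
  obtain n where n: "dimension n (Qp_in p K \<iota>) (carrier K)"
    using fin_ext by (auto simp: finite_extension_Qp_def finite_dimension_def)
  have "\<exists>Ks. length Ks = Suc n \<and> set Ks \<subseteq> A \<and> \<one> \<in> set Ks \<and> eval Ks x = \<zero>" if x: "x \<in> carrier K" for x
  proof -
    let ?Us = "map (\<lambda>i. x [^] i) (rev [0..<Suc n])"
    have Us: "set ?Us \<subseteq> carrier K" using x by auto
    \<comment> \<open>In dimension \<open>n\<close> any \<open>n + 1\<close> powers are dependent,
      which makes the length of the relation independent of \<open>x\<close>.\<close>
    have "\<not> independent (Qp_in p K \<iota>) ?Us"
      using independent_length_le_dimension [OF subfield_Qp n _ Us] by auto
    then obtain Ks where Ks: "length Ks = length ?Us" "combine Ks ?Us = \<zero>"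
      "set Ks \<subseteq> Qp_in p K \<iota>" "set Ks \<noteq> {\<zero>}"
      using dependent_imp_non_trivial_combine [OF subfield_Qp Us] by metis
    have len: "length Ks = Suc n" using Ks by simp
    then have "set Ks \<noteq> {}" by auto
    then obtain m where m: "m \<in> set Ks" "\<forall>k\<in>set Ks. \<exists>a\<in>A. k = a \<otimes> m"
      using Qp_common_divisor [OF _ _ Ks(3)] by auto
    have KsK: "set Ks \<subseteq> carrier K" using Ks(3) subfieldE(3)[OF subfield_Qp] by auto
    have mc: "m \<in> carrier K" using m KsK by auto
    have m0: "m \<noteq> \<zero>"
    proof
      assume "m = \<zero>"
      then have "k = \<zero>" if "k \<in> set Ks" for k
        using bspec [OF m(2) that] by auto
      then have "set Ks \<subseteq> {\<zero>}" by auto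
      then have "set Ks = {\<zero>}" using \<open>set Ks \<noteq> {}\<close> subset_singletonD by metis
      then show False using Ks(4) by blast
    qed
    have im: "inv m \<in> carrier K" "inv m \<otimes> m = \<one>" using mc m0 by (simp_all add: field_Units)
    have "inv m \<otimes> k \<in> A" if k: "k \<in> set Ks" for k
    proof -
      obtain a where "a \<in> A" "k = a \<otimes> m" using bspec [OF m(2) k] by blast
      then have "inv m \<otimes> k = a" using im mc by (auto simp: m_lcomm)
      then show ?thesis using \<open>a \<in> A\<close> by simp
    qed
    then have "set (map ((\<otimes>) (inv m)) Ks) \<subseteq> A" by auto
    moreover have "\<one> \<in> set (map ((\<otimes>) (inv m)) Ks)"
      using m im by (auto simp: image_iff intro!: bexI [of _ m])
    moreover have "combine (map ((\<otimes>) (inv m)) Ks) ?Us = \<zero>"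
      using combine_r_distr [OF KsK Us im(1)] Ks(2) im by simp
    moreover have "set (map ((\<otimes>) (inv m)) Ks) \<subseteq> carrier K" using KsK im by auto
    note combine_powers [OF x this]
    ultimately show ?thesis using len by (intro exI [of _ "map ((\<otimes>) (inv m)) Ks"]) (simp del: upt_Suc)
  qed
  then show ?thesis by blast
qed

lemma iota_nat: "\<iota> ([n] \<cdot>\<^bsub>Zp p\<^esub> \<one>\<^bsub>Zp p\<^esub>) = [n] \<cdot> \<one>" for n :: nat
  by (induction n) simp_all

text \<open>If \<open>y = 1/p\<close> satisfied a monic equation of degree \<open>n + 1\<close>,
  multiplying it by \<open>p ^ n\<close> would turn the leading term into \<open>y\<close> and the
  rest into a p-adic integer. Then \<open>p\<close> would be invertible among the p-adic integers,
  which fails modulo \<open>p\<close>.\<close>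

lemma p_nonunit: "[p] \<cdot> \<one> \<in> nonunits O_K"
proof -
  let ?p = "[p] \<cdot> \<one>"
  have pA: "?p = \<iota> ([p] \<cdot>\<^bsub>Zp p\<^esub> \<one>\<^bsub>Zp p\<^esub>)"
    by (simp add: iota_nat)
  then have pA': "?p \<in> A" by simp
  have "?p \<notin> Units O_K"
  proof
    assume "?p \<in> Units O_K"
    then obtain y where y: "y \<in> carrier O_K" "?p \<otimes> y = \<one>" by (auto simp: Units_def O_simps)
    then obtain n where n: "y \<in> carrier K" "y [^] Suc n \<in> poly_span A y n"
      by (auto simp: O_eq integral_over_def)
    \<comment> \<open>Each Horner step pairs one factor \<open>p\<close> with one factor
      \<open>y\<close>, and their product is 1.\<close>
    have *: "?p [^] k \<otimes> d \<in> A" if "d \<in> poly_span A y k" for d k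
      using that
    proof (induction k arbitrary: d)
      case (Suc k)
      then obtain a e where d: "d = a \<oplus> y \<otimes> e" "a \<in> A" "e \<in> poly_span A y k" by auto
      have c: "a \<in> carrier K" "e \<in> carrier K" using d poly_span_closed [OF subring_A n(1)] by auto
      have "?p [^] Suc k \<otimes> d = ?p [^] Suc k \<otimes> a \<oplus> ?p [^] k \<otimes> (?p \<otimes> y) \<otimes> e"
        unfolding d using c n by (simp add: r_distr m_assoc)
      also have "\<dots> = ?p [^] Suc k \<otimes> a \<oplus> ?p [^] k \<otimes> e" using y c by simp
      finally show ?case
        using Suc.IH [OF d(3)] d(2) pA' subringE(6,7)[OF subring_A]
          subringE(3)[OF subring_A] monoid.nat_pow_closed [OF ring.axioms(2) [OF subring_is_ring [OF subring_A]], of ?p "Suc k"]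
        by (simp flip: nat_pow_consistent)
    next
      case 0
      then have d: "d \<in> A" by simp
      then have "d \<in> carrier K" using subringE(1)[OF subring_A] by blast
      then have "?p [^] (0::nat) \<otimes> d = d" by simp
      then show ?case using d by (simp only:)
    qed
    have "?p [^] n \<otimes> y [^] Suc n \<in> A" by (rule * [OF n(2)])
    moreover have "?p [^] n \<otimes> y [^] Suc n = y"
    proof -
      have "?p [^] n \<otimes> y [^] n = (?p \<otimes> y) [^] n" using n by (simp add: nat_pow_distrib)
      then have "?p [^] n \<otimes> y [^] n \<otimes> y = y" using n y by simp
      then show ?thesis using n(1) m_assoc [of "?p [^] n" "y [^] n" y] by simp
    qed
    ultimately obtain z where z: "z \<in> carrier (Zp p)" "y = \<iota> z" by auto
    then have "\<iota> ([p] \<cdot>\<^bsub>Zp p\<^esub> \<one>\<^bsub>Zp p\<^esub> \<otimes>\<^bsub>Zp p\<^esub> z) = \<iota> \<one>\<^bsub>Zp p\<^esub>" using y(2) pA by simp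
    then have "[p] \<cdot>\<^bsub>Zp p\<^esub> \<one>\<^bsub>Zp p\<^esub> \<otimes>\<^bsub>Zp p\<^esub> z = \<one>\<^bsub>Zp p\<^esub>"
      using inj_onD [OF iota_inj] z by simp
    then have "[p] \<cdot>\<^bsub>Zp p\<^esub> z = \<one>\<^bsub>Zp p\<^esub>" using z by (simp add: Zp.add_pow_ldistr)
    then have "((int p * z 1) mod int p ^ 1) = 1 mod int p ^ 1"
      unfolding Zp_of_nat_mult [OF z(1) p_pos] Zp_simps by metis
    then show False using p prime_gt_1_nat by simp
  qed
  then show ?thesis using pA' A_subset_O by (auto simp: nonunits_def)
qed

end

lemma FactRing_simps:
  "carrier (R Quot I) = a_rcosets\<^bsub>R\<^esub> I" "\<zero>\<^bsub>R Quot I\<^esub> = I" "x \<oplus>\<^bsub>R Quot I\<^esub> y = x <+>\<^bsub>R\<^esub> y"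
  by (simp_all add: FactRing_def)

section \<open>The residue field and its finiteness\<close>

locale finite_ext_unif = finite_ext +
  fixes \<pi> assumes unif: "uniformizer p K \<iota> \<pi>"
begin

abbreviation "mm \<equiv> nonunits O_K"
abbreviation "\<kappa> \<equiv> residue_field p K \<iota>"

text \<open>That the nonunits form an ideal is taken from \<open>unif\<close>, which identifies them
  with a principal ideal.\<close>

sublocale mm: ideal mm O_K
  using unif OK.cgenideal_ideal by (metis uniformizer_def)

lemma residue_eq: "\<kappa> = O_K Quot mm" by (simp add: residue_field_def)

sublocale k: cring \<kappa>
  unfolding residue_eq by (rule mm.quotient_is_cring [OF OK.cring_axioms])

lemma residue_hom: "(+>\<^bsub>O_K\<^esub>) mm \<in> ring_hom O_K \<kappa>"
  unfolding residue_eq by (rule mm.rcos_ring_hom)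

sublocale res: ring_hom_cring O_K \<kappa> "(+>\<^bsub>O_K\<^esub>) mm"
  by (intro ring_hom_cringI OK.cring_axioms k.cring_axioms residue_hom)

lemma residue_eq_zero_iff: "x \<in> carrier O_K \<Longrightarrow> mm +>\<^bsub>O_K\<^esub> x = \<zero>\<^bsub>\<kappa>\<^esub> \<longleftrightarrow> x \<in> mm"
  unfolding residue_eq FactRing_simps using mm.a_rcos_const mm.rcos_const_imp_mem by blast

lemma residue_cases:
  assumes "c \<in> carrier \<kappa>"
  obtains x where "x \<in> carrier O_K" "c = mm +>\<^bsub>O_K\<^esub> x"
proof -
  have "c \<in> a_rcosets\<^bsub>O_K\<^esub> mm" using assms unfolding residue_eq FactRing_simps .
  then show ?thesis using that unfolding A_RCOSETS_def' by blast
qed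

sublocale k: field \<kappa>
proof (rule k.cring_fieldI2)
  have "\<one>\<^bsub>O_K\<^esub> \<notin> mm" by (simp add: nonunits_def)
  then have "mm +>\<^bsub>O_K\<^esub> \<one>\<^bsub>O_K\<^esub> \<noteq> \<zero>\<^bsub>\<kappa>\<^esub>" by (subst residue_eq_zero_iff) simp_all
  then show "\<zero>\<^bsub>\<kappa>\<^esub> \<noteq> \<one>\<^bsub>\<kappa>\<^esub>" by simp
next
  fix c assume c: "c \<in> carrier \<kappa>" "c \<noteq> \<zero>\<^bsub>\<kappa>\<^esub>"
  from c(1) obtain x where x: "x \<in> carrier O_K" "c = mm +>\<^bsub>O_K\<^esub> x" by (rule residue_cases)
  then have "x \<in> Units O_K" using c residue_eq_zero_iff by (auto simp: nonunits_def)
  then obtain y where y: "y \<in> carrier O_K" "x \<otimes>\<^bsub>O_K\<^esub> y = \<one>\<^bsub>O_K\<^esub>" by (auto simp: Units_def)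
  then have "c \<otimes>\<^bsub>\<kappa>\<^esub> (mm +>\<^bsub>O_K\<^esub> y) = \<one>\<^bsub>\<kappa>\<^esub>"
    using x res.hom_mult [of x y] by simp
  then show "\<exists>b\<in>carrier \<kappa>. c \<otimes>\<^bsub>\<kappa>\<^esub> b = \<one>\<^bsub>\<kappa>\<^esub>" using y by auto
qed

lemma residue_nat: "[n] \<cdot> \<one> \<in> carrier O_K" "mm +>\<^bsub>O_K\<^esub> ([n] \<cdot> \<one>) = [n] \<cdot>\<^bsub>\<kappa>\<^esub> \<one>\<^bsub>\<kappa>\<^esub>" for n :: nat
proof (induction n)
  case 0
  show "[(0::nat)] \<cdot> \<one> \<in> carrier O_K" "mm +>\<^bsub>O_K\<^esub> ([(0::nat)] \<cdot> \<one>) = [(0::nat)] \<cdot>\<^bsub>\<kappa>\<^esub> \<one>\<^bsub>\<kappa>\<^esub>"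
    using OK.zero_closed res.hom_zero by (simp_all add: O_simps)
next
  case (Suc n)
  have 1: "\<one> \<in> carrier O_K" "mm +>\<^bsub>O_K\<^esub> \<one> = \<one>\<^bsub>\<kappa>\<^esub>" using OK.one_closed res.hom_one by (simp_all only: O_simps)
  show "[Suc n] \<cdot> \<one> \<in> carrier O_K" "mm +>\<^bsub>O_K\<^esub> ([Suc n] \<cdot> \<one>) = [Suc n] \<cdot>\<^bsub>\<kappa>\<^esub> \<one>\<^bsub>\<kappa>\<^esub>"
    using Suc 1 OK.a_closed res.hom_add by (simp_all add: O_simps)
qed

lemma residue_char: "[p] \<cdot>\<^bsub>\<kappa>\<^esub> \<one>\<^bsub>\<kappa>\<^esub> = \<zero>\<^bsub>\<kappa>\<^esub>"
  using residue_eq_zero_iff [OF residue_nat(1), of p] p_nonunit unfolding residue_nat(2) by simp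

text \<open>Subtracting the natural number \<open>z 1\<close> from \<open>z\<close> leaves a
  multiple of \<open>p\<close>, which dies in \<kappa>. The purpose is to have finitely many
  coefficients after reduction.\<close>

lemma residue_prime_field: "(\<lambda>a. mm +>\<^bsub>O_K\<^esub> a) ` A \<subseteq> (\<lambda>n. [n] \<cdot>\<^bsub>\<kappa>\<^esub> \<one>\<^bsub>\<kappa>\<^esub>) ` {..<p}"
proof
  fix c assume "c \<in> (\<lambda>a. mm +>\<^bsub>O_K\<^esub> a) ` A"
  then obtain z where z: "z \<in> carrier (Zp p)" "c = mm +>\<^bsub>O_K\<^esub> \<iota> z" by blast
  define n where "n = nat (z 1)"
  have z1: "0 \<le> z 1" "z 1 < int p" using z(1) unfolding Zp_carrier_iff by (metis atLeastLessThan_iff power_one_right)+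
  then have n: "n < p" "int n = z 1" by (auto simp: n_def)
  let ?w = "z \<ominus>\<^bsub>Zp p\<^esub> [n] \<cdot>\<^bsub>Zp p\<^esub> \<one>\<^bsub>Zp p\<^esub>"
  have w: "?w \<in> carrier (Zp p)" using z by simp
  have "?w \<oplus>\<^bsub>Zp p\<^esub> [n] \<cdot>\<^bsub>Zp p\<^esub> \<one>\<^bsub>Zp p\<^esub> = z" using z(1) by (simp add: a_minus_def Zp.a_assoc Zp.l_neg)
  moreover have n1: "([n] \<cdot>\<^bsub>Zp p\<^esub> \<one>\<^bsub>Zp p\<^esub>) (Suc 0) = int n"
    using n p prime_gt_1_nat [of p] by (simp add: Zp_of_nat_mult [OF Zp.one_closed p_pos]) (simp add: Zp_simps)
  ultimately have "(?w \<oplus>\<^bsub>Zp p\<^esub> [n] \<cdot>\<^bsub>Zp p\<^esub> \<one>\<^bsub>Zp p\<^esub>) 1 = z 1" by simp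
  then have "(?w 1 + int n) mod int p = z 1"
    unfolding Zp_simps(3) by (simp add: n1)
  then have "(?w 1 + int n) mod int p = int n mod int p" using n z1 by simp
  then have "?w 1 mod int p = 0" by (simp add: mod_eq_dvd_iff dvd_eq_mod_eq_0)
  then have "?w 1 = 0" using Zp_nth_mod [OF w, of 1] by simp
  then obtain y where y: "y \<in> carrier (Zp p)" "?w = [(p ^ 1)] \<cdot>\<^bsub>Zp p\<^esub> y"
    using Zp_divisible [OF p_pos w] by metis
  have "z = [p] \<cdot>\<^bsub>Zp p\<^esub> \<one>\<^bsub>Zp p\<^esub> \<otimes>\<^bsub>Zp p\<^esub> y \<oplus>\<^bsub>Zp p\<^esub> [n] \<cdot>\<^bsub>Zp p\<^esub> \<one>\<^bsub>Zp p\<^esub>"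
    using \<open>?w \<oplus>\<^bsub>Zp p\<^esub> _ = z\<close> y by (simp add: Zp.add_pow_ldistr)
  then have "\<iota> z = [p] \<cdot> \<one> \<otimes> \<iota> y \<oplus> [n] \<cdot> \<one>"
    using y(1) by (simp only: iota.hom_add iota.hom_mult iota_nat Zp.m_closed Zp.add.nat_pow_closed Zp.one_closed)
  moreover have yO: "\<iota> y \<in> carrier O_K" using y A_subset_O by auto
  ultimately have "c = (mm +>\<^bsub>O_K\<^esub> ([p] \<cdot> \<one>)) \<otimes>\<^bsub>\<kappa>\<^esub> (mm +>\<^bsub>O_K\<^esub> \<iota> y) \<oplus>\<^bsub>\<kappa>\<^esub> (mm +>\<^bsub>O_K\<^esub> ([n] \<cdot> \<one>))"
    using z(2) residue_nat(1) res.hom_add res.hom_mult OK.m_closed by (metis O_simps(3,4))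
  also have "\<dots> = [n] \<cdot>\<^bsub>\<kappa>\<^esub> \<one>\<^bsub>\<kappa>\<^esub>"
    using yO residue_nat by (simp add: residue_char)
  finally show "c \<in> (\<lambda>n. [n] \<cdot>\<^bsub>\<kappa>\<^esub> \<one>\<^bsub>\<kappa>\<^esub>) ` {..<p}" using n by blast
qed

text \<open>The bound on the number of roots concerns polynomials with nonzero leading coefficient;
  \<open>normalize\<close> strips leading zeros and changes no value.\<close>

lemma (in domain) finite_roots_list:
  assumes "set Ks \<subseteq> carrier R" "\<not> set Ks \<subseteq> {\<zero>}"
  shows "finite {x \<in> carrier R. eval Ks x = \<zero>}"
proof -
  have "polynomial (carrier R) (normalize Ks)"
    by (rule normalize_gives_polynomial [OF assms(1)])
  then have "finite {x. is_root (normalize Ks) x}"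
    by (intro finite_number_of_roots) (simp add: univ_poly_carrier)
  moreover have "normalize Ks \<noteq> []"
    using assms(2) by (induction Ks) auto
  ultimately show ?thesis
    using eval_normalize [OF assms(1)] by (simp add: is_root_def conj_ac cong: conj_cong)
qed

text \<open>Every class is a root of the reduction of a relation from
  \<open>bounded_integral_relation\<close>. The reduced coefficients lie in a finite set, so
  finitely many polynomials occur, and none is zero because one coefficient is 1.\<close>

lemma finite_residue_field: "finite (carrier \<kappa>)"
proof -
  obtain n where n: "\<forall>x\<in>carrier K. \<exists>Ks. length Ks = n \<and> set Ks \<subseteq> A \<and> \<one> \<in> set Ks \<and> eval Ks x = \<zero>"
    using bounded_integral_relation by blast
  define S where "S = (\<lambda>a. mm +>\<^bsub>O_K\<^esub> a) ` A"
  have S: "finite S" unfolding S_def by (rule finite_subset [OF residue_prime_field]) simp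
  have SK: "S \<subseteq> carrier \<kappa>" unfolding S_def using A_subset_O by auto
  define L where "L = {Ks. set Ks \<subseteq> S \<and> length Ks = n \<and> \<not> set Ks \<subseteq> {\<zero>\<^bsub>\<kappa>\<^esub>}}"
  have "finite L" unfolding L_def by (rule finite_subset [OF _ finite_lists_length_eq [OF S, of n]]) auto
  moreover have "carrier \<kappa> \<subseteq> (\<Union>Ks\<in>L. {c \<in> carrier \<kappa>. k.eval Ks c = \<zero>\<^bsub>\<kappa>\<^esub>})"
  proof
    fix c assume c: "c \<in> carrier \<kappa>"
    then obtain x where x: "x \<in> carrier O_K" "c = mm +>\<^bsub>O_K\<^esub> x" by (rule residue_cases)
    have xK: "x \<in> carrier K" using x subringE(1)[OF subring_O] by auto
    from bspec [OF n xK] obtain Ks where Ks: "length Ks = n" "set Ks \<subseteq> A" "\<one> \<in> set Ks" "eval Ks x = \<zero>"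
      by blast
    have KsO: "set Ks \<subseteq> carrier O_K" using Ks A_subset_O by auto
    let ?h = "(+>\<^bsub>O_K\<^esub>) mm"
    \<comment> \<open>Reduction commutes with evaluation. Membership in \<open>O_K\<close> is
      carried along because \<open>eval\<close> is computed in \<open>K\<close>.\<close>
    have *: "eval Ks x \<in> carrier O_K \<and> k.eval (map ?h Ks) c = ?h (eval Ks x)" if "set Ks \<subseteq> carrier O_K" for Ks
      using that
    proof (induction Ks)
      case Nil
      then show ?case using OK.zero_closed res.hom_zero by (simp add: O_simps)
    next
      case (Cons a Ks)
      have pw: "x [^] i \<in> carrier O_K \<and> c [^]\<^bsub>\<kappa>\<^esub> i = ?h (x [^] i)" for i :: nat
      proof (induction i)
        case 0
        then show ?case using OK.one_closed res.hom_one by (simp add: O_simps)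
      next
        case (Suc i)
        then show ?case using OK.m_closed [of "x [^] i" x] res.hom_mult [of "x [^] i" x] x by (simp add: O_simps)
      qed
      have a: "a \<in> carrier O_K" using Cons by simp
      show ?case
        using Cons pw [of "length Ks"] OK.m_closed [OF a, of "x [^] length Ks"] res.hom_mult [OF a, of "x [^] length Ks"]
          OK.a_closed [of "a \<otimes> x [^] length Ks" "eval Ks x"] res.hom_add [of "a \<otimes> x [^] length Ks" "eval Ks x"]
        by (simp add: O_simps)
    qed
    have "k.eval (map ?h Ks) c = \<zero>\<^bsub>\<kappa>\<^esub>"
      using * [OF KsO] Ks(4) res.hom_zero by (simp add: O_simps)
    moreover have "map ?h Ks \<in> L"
    proof -
      have "?h \<one> \<in> set (map ?h Ks)" using Ks(3) by simp
      moreover have "?h \<one> \<noteq> \<zero>\<^bsub>\<kappa>\<^esub>" using res.hom_one k.one_not_zero by (simp add: O_simps)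
      ultimately have "\<not> set (map ?h Ks) \<subseteq> {\<zero>\<^bsub>\<kappa>\<^esub>}" by blast
      then show ?thesis using Ks by (auto simp: L_def S_def)
    qed
    ultimately show "c \<in> (\<Union>Ks\<in>L. {c \<in> carrier \<kappa>. k.eval Ks c = \<zero>\<^bsub>\<kappa>\<^esub>})" using c by blast
  qed
  moreover have "finite {c \<in> carrier \<kappa>. k.eval Ks c = \<zero>\<^bsub>\<kappa>\<^esub>}" if "Ks \<in> L" for Ks
    using that SK by (intro k.finite_roots_list) (auto simp: L_def)
  ultimately show ?thesis by (meson finite_UN finite_subset)
qed

end

section \<open>Witt polynomials\<close>

text \<open>In the factorisation of \<open>x ^ q - y ^ q\<close> by \<open>x - y\<close>, each of
  the \<open>q\<close> summands of the cofactor is \<open>y ^ (q - 1)\<close> modulo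
  \<open>p\<close>; their sum is thus \<open>p * y ^ (q - 1)\<close> modulo \<open>p\<close>, that
  is 0, which gains one power of \<open>p\<close>.\<close>

lemma dvd_power_diff:
  fixes x y p :: "'a::comm_ring_1"
  assumes "p ^ Suc k dvd x - y" "p = of_nat q"
  shows "p ^ Suc (Suc k) dvd x ^ q - y ^ q"
proof -
  let ?t = "\<lambda>i. y ^ (q - Suc i) * x ^ i"
  have py: "p dvd x - y" by (rule dvd_trans [OF _ assms(1)]) simp
  have "p dvd (\<Sum>i<q. ?t i - y ^ (q - 1))"
  proof (rule dvd_sum)
    fix i assume "i \<in> {..<q}"
    then have "y ^ (q - 1) = y ^ (q - Suc i) * y ^ i" by (simp flip: power_add)
    then have "?t i - y ^ (q - 1) = y ^ (q - Suc i) * (x ^ i - y ^ i)"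
      by (simp add: right_diff_distrib)
    moreover have "x - y dvd x ^ i - y ^ i"
      unfolding power_diff_sumr2 by (rule dvd_triv_left)
    ultimately show "p dvd ?t i - y ^ (q - 1)"
      using dvd_trans [OF py] by (simp add: dvd_mult)
  qed
  then have "p dvd (\<Sum>i<q. ?t i) - p * y ^ (q - 1)"
    by (simp add: sum_subtractf assms(2))
  then have "p dvd (\<Sum>i<q. ?t i)"
    using dvd_add [OF _ dvd_triv_left [of p "y ^ (q - 1)"]] by fastforce
  then have "p ^ Suc k * p dvd (x - y) * (\<Sum>i<q. ?t i)"
    using assms(1) mult_dvd_mono by blast
  then show ?thesis
    by (simp add: power_diff_sumr2 [of x] mult.commute)
qed

lemma dvd_power_power_diff:
  fixes x y :: "'a::comm_ring_1"
  assumes "of_nat p dvd x - y"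
  shows "of_nat p ^ Suc k dvd x ^ (p ^ k) - y ^ (p ^ k)"
proof (induction k)
  case (Suc k)
  from dvd_power_diff [OF Suc refl] show ?case
    by (simp add: power_mult [symmetric] mult.commute)
qed (use assms in simp)

lemma dvd_binomial_power:
  fixes x y :: "'a::comm_ring_1"
  assumes "Factorial_Ring.prime p"
  shows "of_nat p dvd (x + y) ^ p - (x ^ p + y ^ p)"
proof -
  have p: "p > 0" using assms prime_gt_0_nat by blast
  let ?t = "\<lambda>k. of_nat (p choose k) * x ^ k * y ^ (p - k)"
  have "(x + y) ^ p = (\<Sum>k\<le>p. ?t k)" by (rule binomial_ring)
  also have "{..p} = insert 0 (insert p {0<..<p})" using p by auto
  also have "(\<Sum>k\<in>\<dots>. ?t k) = x ^ p + y ^ p + (\<Sum>k\<in>{0<..<p}. ?t k)"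
    using p by (simp add: add_ac)
  finally have "(x + y) ^ p - (x ^ p + y ^ p) = (\<Sum>k\<in>{0<..<p}. ?t k)" by simp
  also have "of_nat p dvd \<dots>"
  proof (rule dvd_sum)
    fix k assume "k \<in> {0<..<p}"
    then have "p dvd p choose k" using assms by (auto intro: dvd_choose_prime)
    then have "(of_nat p :: 'a) dvd of_nat (p choose k)" by auto
    then show "of_nat p dvd ?t k" by (simp add: mult.assoc)
  qed
  finally show ?thesis .
qed

text \<open>Views a type class ring as a ring record, so that evaluation at polynomial values
  becomes substitution.\<close>

definition type_ring :: "'a::comm_ring_1 ring"
  where "type_ring = \<lparr>carrier = UNIV, mult = (*), one = 1, ring.zero = 0, add = (+)\<rparr>"

lemma type_ring_simps [simp]:
  "carrier type_ring = UNIV" "x \<otimes>\<^bsub>type_ring\<^esub> y = x * y" "\<one>\<^bsub>type_ring\<^esub> = 1"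
  "\<zero>\<^bsub>type_ring\<^esub> = 0" "x \<oplus>\<^bsub>type_ring\<^esub> y = x + y"
  by (simp_all add: type_ring_def)

lemma cring_type_ring: "cring (type_ring :: 'a::comm_ring_1 ring)"
proof (rule cringI)
  show "abelian_group (type_ring :: 'a ring)"
  proof (rule abelian_groupI)
    fix x :: 'a
    show "\<exists>y\<in>carrier type_ring. y \<oplus>\<^bsub>type_ring\<^esub> x = \<zero>\<^bsub>type_ring\<^esub>"
      by (rule bexI [of _ "- x"]) simp_all
  qed (simp_all add: algebra_simps)
  show "Group.comm_monoid (type_ring :: 'a ring)"
    by (rule comm_monoidI) (simp_all add: algebra_simps)
qed (simp add: algebra_simps)

section \<open>Evaluation of integral polynomials in a ring record\<close>

context cring
begin

definition mon_eval :: "('v \<Rightarrow> 'a) \<Rightarrow> ('v \<Rightarrow>\<^sub>0 nat) \<Rightarrow> 'a"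
  where "mon_eval f m = (\<Otimes>v\<in>Poly_Mapping.keys m. f v [^] Poly_Mapping.lookup m v)"

lemma mon_eval_superset:
  assumes "f \<in> UNIV \<rightarrow> carrier R" "finite S" "Poly_Mapping.keys m \<subseteq> S"
  shows "mon_eval f m = (\<Otimes>v\<in>S. f v [^] Poly_Mapping.lookup m v)"
  unfolding mon_eval_def
  by (rule finprod_mono_neutral_cong_left) (use assms in \<open>auto simp: in_keys_iff\<close>)

lemma mon_eval_closed [simp]: "f \<in> UNIV \<rightarrow> carrier R \<Longrightarrow> mon_eval f m \<in> carrier R"
  unfolding mon_eval_def by (rule finprod_closed) auto

lemma mon_eval_add:
  assumes f: "f \<in> UNIV \<rightarrow> carrier R"
  shows "mon_eval f (m + m') = mon_eval f m \<otimes> mon_eval f m'"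
proof -
  let ?S = "Poly_Mapping.keys m \<union> Poly_Mapping.keys m'"
  have "mon_eval f (m + m') = (\<Otimes>v\<in>?S. f v [^] Poly_Mapping.lookup (m + m') v)"
    using f Poly_Mapping.keys_add [of m m'] by (intro mon_eval_superset) auto
  also have "\<dots> = (\<Otimes>v\<in>?S. f v [^] Poly_Mapping.lookup m v \<otimes> f v [^] Poly_Mapping.lookup m' v)"
    using f by (intro finprod_cong') (auto simp: lookup_add nat_pow_mult Pi_iff)
  also have "\<dots> = (\<Otimes>v\<in>?S. f v [^] Poly_Mapping.lookup m v) \<otimes> (\<Otimes>v\<in>?S. f v [^] Poly_Mapping.lookup m' v)"
    using f by (intro finprod_multf) auto
  finally show ?thesis
    using f by (simp add: mon_eval_superset [of f ?S])
qed

text \<open>The evaluation underlying \<open>witt_poly_eval\<close>, freed from the type of the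
  variables so that it can be composed with substitutions.\<close>

definition ipoly_eval :: "('v \<Rightarrow> 'a) \<Rightarrow> (('v \<Rightarrow>\<^sub>0 nat) \<Rightarrow>\<^sub>0 int) \<Rightarrow> 'a"
  where "ipoly_eval f P = (\<Oplus>m\<in>Poly_Mapping.keys P. [Poly_Mapping.lookup P m] \<cdot> mon_eval f m)"

lemma add_int_pow_zero: "[(0::int)] \<cdot> x = \<zero>"
  by (simp add: add_pow_def)

lemma ipoly_eval_superset:
  assumes "f \<in> UNIV \<rightarrow> carrier R" "finite S" "Poly_Mapping.keys P \<subseteq> S"
  shows "ipoly_eval f P = (\<Oplus>m\<in>S. [Poly_Mapping.lookup P m] \<cdot> mon_eval f m)"
  unfolding ipoly_eval_def
  by (rule add.finprod_mono_neutral_cong_left)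
     (use assms in \<open>auto simp: in_keys_iff add_int_pow_zero\<close>)

lemma ipoly_eval_closed [simp]: "f \<in> UNIV \<rightarrow> carrier R \<Longrightarrow> ipoly_eval f P \<in> carrier R"
  unfolding ipoly_eval_def by (rule finsum_closed) auto

lemma ipoly_eval_add:
  assumes f: "f \<in> UNIV \<rightarrow> carrier R"
  shows "ipoly_eval f (P + Q) = ipoly_eval f P \<oplus> ipoly_eval f Q"
proof -
  let ?S = "Poly_Mapping.keys P \<union> Poly_Mapping.keys Q"
  have "ipoly_eval f (P + Q) = (\<Oplus>m\<in>?S. [Poly_Mapping.lookup (P + Q) m] \<cdot> mon_eval f m)"
    using f Poly_Mapping.keys_add [of P Q] by (intro ipoly_eval_superset) auto
  also have "\<dots> = (\<Oplus>m\<in>?S. [Poly_Mapping.lookup P m] \<cdot> mon_eval f m \<oplus> [Poly_Mapping.lookup Q m] \<cdot> mon_eval f m)"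
    using f by (intro add.finprod_cong') (auto simp: lookup_add add.int_pow_mult)
  also have "\<dots> = (\<Oplus>m\<in>?S. [Poly_Mapping.lookup P m] \<cdot> mon_eval f m) \<oplus> (\<Oplus>m\<in>?S. [Poly_Mapping.lookup Q m] \<cdot> mon_eval f m)"
    using f by (intro add.finprod_multf) auto
  finally show ?thesis
    using f by (simp add: ipoly_eval_superset [of f ?S])
qed

lemma ipoly_eval_zero [simp]: "ipoly_eval f 0 = \<zero>"
  by (simp add: ipoly_eval_def)

lemma ipoly_eval_diff:
  assumes f: "f \<in> UNIV \<rightarrow> carrier R"
  shows "ipoly_eval f (P - Q) = ipoly_eval f P \<ominus> ipoly_eval f Q"
proof -
  have "ipoly_eval f P = ipoly_eval f (P - Q) \<oplus> ipoly_eval f Q"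
    using ipoly_eval_add [OF f, of "P - Q" Q] by simp
  then show ?thesis
    using f by (simp add: minus_eq a_assoc r_neg)
qed

lemma ipoly_eval_frag_of:
  assumes f: "f \<in> UNIV \<rightarrow> carrier R"
  shows "ipoly_eval f (frag_of m) = mon_eval f m"
  unfolding ipoly_eval_def keys_single if_not_P [OF one_neq_zero]
  by (subst finsum_insert) (use f in simp_all)

lemma ipoly_eval_mult:
  assumes f: "f \<in> UNIV \<rightarrow> carrier R"
  shows "ipoly_eval f (P * Q) = ipoly_eval f P \<otimes> ipoly_eval f Q"
proof (induction P rule: frag_induction [OF subset_UNIV])
  case (2 m)
  show ?case
  proof (induction Q rule: frag_induction [OF subset_UNIV])
    case (2 m')
    show ?case
      using f by (simp add: mult_single ipoly_eval_frag_of mon_eval_add)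
  next
    case (3 a b)
    then show ?case using f
      by (simp add: right_diff_distrib ipoly_eval_diff r_distr minus_eq r_minus)
  qed (use f in simp)
next
  case (3 a b)
  then show ?case using f
    by (simp add: left_diff_distrib ipoly_eval_diff l_distr minus_eq l_minus)
qed (use f in simp)

lemma ipoly_eval_one:
  assumes f: "f \<in> UNIV \<rightarrow> carrier R"
  shows "ipoly_eval f 1 = \<one>"
  using ipoly_eval_frag_of [OF f, of 0] by (simp add: mon_eval_def)

lemma ipoly_eval_power:
  assumes f: "f \<in> UNIV \<rightarrow> carrier R"
  shows "ipoly_eval f (P ^ n) = ipoly_eval f P [^] n"
  using f by (induction n) (simp_all add: ipoly_eval_one ipoly_eval_mult m_comm)

lemma ipoly_eval_of_nat:
  assumes f: "f \<in> UNIV \<rightarrow> carrier R"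
  shows "ipoly_eval f (of_nat n) = [n] \<cdot> \<one>"
  using f by (induction n) (simp_all add: ipoly_eval_one ipoly_eval_add a_comm)

end

definition ipoly_var :: "'v \<Rightarrow> ('v \<Rightarrow>\<^sub>0 nat) \<Rightarrow>\<^sub>0 int"
  where "ipoly_var v = Poly_Mapping.single (Poly_Mapping.single v 1) 1"

lemma (in cring) ipoly_eval_var:
  assumes f: "f \<in> UNIV \<rightarrow> carrier R"
  shows "ipoly_eval f (ipoly_var v) = f v"
proof -
  have "f v \<in> carrier R" using f by auto
  then show ?thesis
    using ipoly_eval_frag_of [OF f] by (simp add: ipoly_var_def mon_eval_def)
qed

text \<open>The variables generate all integral polynomials as a ring; closure under differences
  gives 0 and matches \<open>frag_induction\<close>.\<close>

lemma ipoly_induct [case_names one var diff mult]: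
  assumes one: "Q 1" and var: "\<And>v. Q (ipoly_var v)"
    and diff: "\<And>a b. Q a \<Longrightarrow> Q b \<Longrightarrow> Q (a - b)"
    and mult: "\<And>a b. Q a \<Longrightarrow> Q b \<Longrightarrow> Q (a * b)"
  shows "Q P"
proof (induction P rule: frag_induction [OF subset_UNIV])
  case 1
  show ?case using diff [OF one one] by simp
next
  case (2 m)
  have *: "Q (frag_of (Poly_Mapping.single v k))" for v and k :: nat
  proof (induction k)
    case 0
    then show ?case using one by simp
  next
    case (Suc k)
    have "frag_of (Poly_Mapping.single v (Suc k)) = ipoly_var v * frag_of (Poly_Mapping.single v k)"
      by (simp add: ipoly_var_def mult_single flip: single_add)
    then show ?case using mult [OF var Suc] by simp
  qed
  show ?case
  proof (induction m rule: update_induct)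
    case const
    then show ?case using one by simp
  next
    case (update m v k)
    have "Poly_Mapping.update v k m = m + Poly_Mapping.single v k"
      using update by (intro poly_mapping_eqI) (auto simp: lookup_update lookup_add lookup_single in_keys_iff when_def)
    then have "frag_of (Poly_Mapping.update v k m) = frag_of m * frag_of (Poly_Mapping.single v k)"
      by (simp add: mult_single)
    then show ?case using mult [OF update.IH *] by simp
  qed
qed (use diff in auto)

definition ipoly_subst :: "('v \<Rightarrow> ('w \<Rightarrow>\<^sub>0 nat) \<Rightarrow>\<^sub>0 int) \<Rightarrow> (('v \<Rightarrow>\<^sub>0 nat) \<Rightarrow>\<^sub>0 int) \<Rightarrow> ('w \<Rightarrow>\<^sub>0 nat) \<Rightarrow>\<^sub>0 int"
  where "ipoly_subst = cring.ipoly_eval type_ring"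

lemma ipoly_subst_var [simp]: "ipoly_subst f (ipoly_var v) = f v"
  unfolding ipoly_subst_def by (rule cring.ipoly_eval_var [OF cring_type_ring]) simp

lemma ipoly_subst_one [simp]: "ipoly_subst f 1 = 1"
  unfolding ipoly_subst_def by (subst cring.ipoly_eval_one [OF cring_type_ring]) simp_all

lemma ipoly_subst_zero [simp]: "ipoly_subst f 0 = 0"
  unfolding ipoly_subst_def by (subst cring.ipoly_eval_zero [OF cring_type_ring]) simp_all

lemma ipoly_subst_add: "ipoly_subst f (a + b) = ipoly_subst f a + ipoly_subst f b"
  unfolding ipoly_subst_def by (subst cring.ipoly_eval_add [OF cring_type_ring]) simp_all

lemma ipoly_subst_diff: "ipoly_subst f (a - b) = ipoly_subst f a - ipoly_subst f b"
  using ipoly_subst_add [of f "a - b" b] by simp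

lemma ipoly_subst_mult: "ipoly_subst f (a * b) = ipoly_subst f a * ipoly_subst f b"
  unfolding ipoly_subst_def by (subst cring.ipoly_eval_mult [OF cring_type_ring]) simp_all

lemma ipoly_subst_power: "ipoly_subst f (a ^ n) = ipoly_subst f a ^ n"
  by (induction n) (simp_all add: ipoly_subst_mult)

lemma ipoly_subst_of_nat [simp]: "ipoly_subst f (of_nat n) = of_nat n"
  by (induction n) (simp_all add: ipoly_subst_add)

lemma ipoly_subst_sum: "ipoly_subst f (sum g A) = (\<Sum>i\<in>A. ipoly_subst f (g i))"
  by (induction A rule: infinite_finite_induct) (simp_all add: ipoly_subst_add)

text \<open>Both sides respect the ring operations and agree on variables. This is how an identity
  of integral polynomials is carried to an arbitrary commutative ring.\<close>

lemma (in cring) ipoly_eval_subst: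
  assumes g: "g \<in> UNIV \<rightarrow> carrier R"
  shows "ipoly_eval g (ipoly_subst f P) = ipoly_eval (\<lambda>v. ipoly_eval g (f v)) P"
proof -
  have h: "(\<lambda>v. ipoly_eval g (f v)) \<in> UNIV \<rightarrow> carrier R" using g by simp
  show ?thesis
    by (induction P rule: ipoly_induct)
       (simp_all add: g h ipoly_eval_one ipoly_eval_var ipoly_subst_diff ipoly_eval_diff
          ipoly_subst_mult ipoly_eval_mult)
qed

lemma lookup_of_nat_mult:
  fixes P :: "('v \<Rightarrow>\<^sub>0 nat) \<Rightarrow>\<^sub>0 int"
  shows "Poly_Mapping.lookup (of_nat k * P) m = int k * Poly_Mapping.lookup P m"
  by (induction k) (simp_all add: distrib_right lookup_add)

text \<open>Absence of torsion is the reason why ghost components determine a family of integral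
  polynomials.\<close>

lemma of_nat_mult_cancel:
  fixes P Q :: "('v \<Rightarrow>\<^sub>0 nat) \<Rightarrow>\<^sub>0 int"
  assumes "k > 0" "of_nat k * P = of_nat k * Q"
  shows "P = Q"
proof (rule poly_mapping_eqI)
  fix m
  have "int k * Poly_Mapping.lookup P m = int k * Poly_Mapping.lookup Q m"
    using assms(2) by (metis lookup_of_nat_mult)
  then show "Poly_Mapping.lookup P m = Poly_Mapping.lookup Q m"
    using assms(1) by simp
qed

section \<open>Ghost components and Dwork's lemma\<close>

lemma witt_var_eq: "witt_var v i = ipoly_var (v, i)"
  by (simp add: witt_var_def ipoly_var_def)

lemma ghost_subst: "ipoly_subst f (ghost p S n) = ghost p (\<lambda>i. ipoly_subst f (S i)) n"
  by (simp add: ghost_def ipoly_subst_sum ipoly_subst_mult ipoly_subst_power flip: of_nat_power)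

lemma ghost_Suc:
  "ghost p S (Suc n) = (\<Sum>i\<le>n. of_nat p ^ i * S i ^ (p ^ Suc (n - i))) + of_nat p ^ Suc n * S (Suc n)"
  by (simp add: ghost_def Suc_diff_le)

lemma ghost_split:
  "ghost p S n = (\<Sum>i<n. of_nat p ^ i * S i ^ (p ^ (n - i))) + of_nat p ^ n * S n"
  by (simp add: ghost_def lessThan_Suc_atMost [symmetric])

text \<open>The ring endomorphism raising every variable to the power \<open>p\<close>: the lift of
  Frobenius on which Dwork's lemma depends.\<close>

definition frob_lift :: "nat \<Rightarrow> (('v \<Rightarrow>\<^sub>0 nat) \<Rightarrow>\<^sub>0 int) \<Rightarrow> ('v \<Rightarrow>\<^sub>0 nat) \<Rightarrow>\<^sub>0 int"
  where "frob_lift p = ipoly_subst (\<lambda>v. ipoly_var v ^ p)"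

text \<open>Modulo \<open>p\<close> both maps are additive and multiplicative, and they agree on
  variables.\<close>

lemma frob_lift_cong:
  assumes "Factorial_Ring.prime p"
  shows "of_nat p dvd P ^ p - frob_lift p P"
proof (induction P rule: ipoly_induct)
  case (diff a b)
  have "(a - b) ^ p - frob_lift p (a - b) =
    (a ^ p - frob_lift p a) - (b ^ p - frob_lift p b) - ((a - b + b) ^ p - ((a - b) ^ p + b ^ p))"
    by (simp add: frob_lift_def ipoly_subst_diff)
  then show ?case
    using diff dvd_binomial_power [OF assms, of "a - b" b] dvd_diff by metis
next
  case (mult a b)
  have "(a * b) ^ p - frob_lift p (a * b) =
    a ^ p * (b ^ p - frob_lift p b) + (a ^ p - frob_lift p a) * frob_lift p b"
    by (simp add: frob_lift_def ipoly_subst_mult power_mult_distrib algebra_simps)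
  then show ?case
    using mult by (simp add: dvd_add dvd_mult dvd_mult2)
qed (simp_all add: frob_lift_def)

text \<open>Termwise: \<open>S i ^ p\<close> and \<open>frob_lift p (S i)\<close> agree modulo
  \<open>p\<close>, hence their powers of exponent \<open>p ^ (n - i)\<close> agree modulo
  \<open>p ^ (n - i + 1)\<close>, and the weight \<open>p ^ i\<close> supplies the rest. The extra
  term of index \<open>Suc n\<close> is divisible outright.\<close>

lemma ghost_frob_lift:
  assumes "Factorial_Ring.prime p"
  shows "of_nat p ^ Suc n dvd ghost p S (Suc n) - frob_lift p (ghost p S n)"
proof -
  have "of_nat p ^ Suc n dvd (\<Sum>i\<le>n. of_nat p ^ i * S i ^ (p ^ Suc (n - i))
      - of_nat p ^ i * frob_lift p (S i) ^ (p ^ (n - i)))"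
  proof (rule dvd_sum)
    fix i assume "i \<in> {..n}"
    then have "of_nat p ^ Suc n = of_nat p ^ i * (of_nat p ^ Suc (n - i) :: witt_poly)"
      unfolding power_add [symmetric] by (intro arg_cong [where f = "(^) (of_nat p)"]) simp
    moreover have "of_nat p ^ Suc (n - i) dvd (S i ^ p) ^ (p ^ (n - i)) - frob_lift p (S i) ^ (p ^ (n - i))"
      by (rule dvd_power_power_diff [OF frob_lift_cong [OF assms]])
    ultimately show "of_nat p ^ Suc n dvd of_nat p ^ i * S i ^ (p ^ Suc (n - i))
      - of_nat p ^ i * frob_lift p (S i) ^ (p ^ (n - i))"
      by (simp add: mult_dvd_mono power_mult flip: right_diff_distrib)
  qed
  moreover have "frob_lift p (ghost p S n) = (\<Sum>i\<le>n. of_nat p ^ i * frob_lift p (S i) ^ (p ^ (n - i)))"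
    by (simp add: frob_lift_def ghost_subst) (simp add: ghost_def)
  ultimately have "of_nat p ^ Suc n dvd (\<Sum>i\<le>n. of_nat p ^ i * S i ^ (p ^ Suc (n - i))) - frob_lift p (ghost p S n)"
    by (simp only: sum_subtractf)
  then have "of_nat p ^ Suc n dvd (\<Sum>i\<le>n. of_nat p ^ i * S i ^ (p ^ Suc (n - i))) - frob_lift p (ghost p S n)
      + of_nat p ^ Suc n * S (Suc n)"
    by (rule dvd_add) simp
  then show ?thesis
    by (simp only: ghost_Suc diff_add_eq)
qed

text \<open>Dwork's lemma. The component \<open>S n\<close> is forced to be a quotient by
  \<open>p ^ n\<close>; comparing \<open>ghost_frob_lift\<close> for the components already found
  with the hypothesis on \<open>g\<close> shows that this division is exact.\<close>

lemma ghost_surj: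
  assumes p: "Factorial_Ring.prime p"
    and g: "\<And>n. of_nat p ^ Suc n dvd g (Suc n) - frob_lift p (g n)"
  shows "\<exists>S. \<forall>n. ghost p S n = g n"
proof -
  let ?P = "\<lambda>f n r. (\<Sum>i<n. of_nat p ^ i * f i ^ (p ^ (n - i))) + of_nat p ^ n * r = g n"
  have "\<exists>f. \<forall>n. ?P f n (f n)"
  proof (rule dependent_wf_choice [where R = "{(x, y). x < y}"])
    show "wf {(x, y :: nat). x < y}" by (rule wf)
  next
    fix f h :: "nat \<Rightarrow> witt_poly" and n r
    assume "\<And>z. (z, n) \<in> {(x, y). x < y} \<Longrightarrow> f z = h z"
    then show "?P f n r = ?P h n r" by simp
  next
    fix f :: "nat \<Rightarrow> witt_poly" and n
    assume IH: "\<And>y. (y, n) \<in> {(x, y). x < y} \<Longrightarrow> ?P f y (f y)"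
    show "\<exists>r. ?P f n r"
    proof (cases n)
      case (Suc m)
      have "ghost p f m = g m"
        using IH [of m] Suc by (simp add: ghost_split)
      then have "of_nat p ^ Suc m dvd ghost p f (Suc m) - frob_lift p (g m)"
        using ghost_frob_lift [OF p, of m f] by simp
      then have "of_nat p ^ Suc m dvd (g (Suc m) - frob_lift p (g m)) - (ghost p f (Suc m) - frob_lift p (g m))
          + of_nat p ^ Suc m * f (Suc m)"
        by (rule dvd_add [OF dvd_diff [OF g] dvd_triv_left])
      then have "of_nat p ^ n dvd g n - (\<Sum>i<n. of_nat p ^ i * f i ^ (p ^ (n - i)))"
        by (simp only: Suc ghost_split) (simp add: algebra_simps)
      then show ?thesis
        by (auto elim!: dvdE simp: algebra_simps)
    qed simp
  qed
  then show ?thesis by (simp add: ghost_split)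
qed

lemma ghost_inj:
  assumes p: "p > 0" and eq: "\<And>n. ghost p S n = ghost p T n"
  shows "S n = T n"
proof (induction n rule: less_induct)
  case (less n)
  then have "of_nat p ^ n * S n = of_nat p ^ n * T n"
    using eq [of n] by (simp add: ghost_split)
  then show ?case
    using of_nat_mult_cancel [of "p ^ n"] p by simp
qed

text \<open>Uniqueness modulo \<open>p\<close>: congruences of the earlier components are sharpened
  by taking powers, then \<open>p ^ n\<close> is cancelled. It serves in characteristic
  \<open>p\<close>, where components matter only modulo \<open>p\<close>.\<close>

lemma ghost_cong_imp_cong:
  assumes p: "p > 0" and eq: "\<And>n. of_nat p ^ Suc n dvd ghost p S n - ghost p T n"
  shows "of_nat p dvd S n - T n"
proof (induction n rule: less_induct)
  case (less n)
  have "of_nat p ^ Suc n dvd (\<Sum>i<n. of_nat p ^ i * S i ^ (p ^ (n - i)) - of_nat p ^ i * T i ^ (p ^ (n - i)))"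
  proof (rule dvd_sum)
    fix i assume i: "i \<in> {..<n}"
    then have "of_nat p ^ Suc n = of_nat p ^ i * (of_nat p ^ Suc (n - i) :: witt_poly)"
      unfolding power_add [symmetric] by (intro arg_cong [where f = "(^) (of_nat p)"]) simp
    moreover have "of_nat p ^ Suc (n - i) dvd S i ^ (p ^ (n - i)) - T i ^ (p ^ (n - i))"
      using i less by (intro dvd_power_power_diff) simp
    ultimately show "of_nat p ^ Suc n dvd of_nat p ^ i * S i ^ (p ^ (n - i)) - of_nat p ^ i * T i ^ (p ^ (n - i))"
      by (simp add: mult_dvd_mono flip: right_diff_distrib)
  qed
  with eq [of n] have "of_nat p ^ Suc n dvd ghost p S n - ghost p T n -
    (\<Sum>i<n. of_nat p ^ i * S i ^ (p ^ (n - i)) - of_nat p ^ i * T i ^ (p ^ (n - i)))"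
    by (rule dvd_diff)
  then have "of_nat p ^ Suc n dvd of_nat p ^ n * (S n - T n)"
    by (simp only: ghost_split sum_subtractf) (simp add: algebra_simps)
  then obtain c where "of_nat p ^ n * (S n - T n) = of_nat p ^ Suc n * c" by (elim dvdE)
  then have "of_nat (p ^ n) * (S n - T n) = of_nat (p ^ n) * (of_nat p * c)"
    by (simp add: mult_ac)
  then have "S n - T n = of_nat p * c"
    by (rule of_nat_mult_cancel [rotated]) (use p in simp)
  then show ?case by simp
qed

text \<open>Existence by \<open>ghost_surj\<close> and uniqueness by \<open>ghost_inj\<close>
  discharge the definite description; the same works for products below.\<close>

lemma ghost_witt_add_poly:
  assumes p: "Factorial_Ring.prime p"
  shows "ghost p (witt_add_poly p) n = ghost p (witt_var False) n + ghost p (witt_var True) n"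
proof -
  let ?g = "\<lambda>n. ghost p (witt_var False) n + ghost p (witt_var True) n"
  have "of_nat p ^ Suc n dvd ?g (Suc n) - frob_lift p (?g n)" for n
  proof -
    have "?g (Suc n) - frob_lift p (?g n) =
      (ghost p (witt_var False) (Suc n) - frob_lift p (ghost p (witt_var False) n)) +
      (ghost p (witt_var True) (Suc n) - frob_lift p (ghost p (witt_var True) n))"
      by (simp add: frob_lift_def ipoly_subst_add)
    then show ?thesis using ghost_frob_lift [OF p] dvd_add by metis
  qed
  from ghost_surj [OF p this] obtain S where S: "\<forall>n. ghost p S n = ?g n" by blast
  have "\<forall>n. ghost p (witt_add_poly p) n = ?g n"
    unfolding witt_add_poly_def
  proof (rule theI [of "\<lambda>S. \<forall>n. ghost p S n = ?g n", OF S])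
    fix T assume "\<forall>n. ghost p T n = ?g n"
    then show "T = S"
      using ghost_inj [of p T S] S prime_gt_0_nat [OF p] by (intro ext) simp
  qed
  then show ?thesis by blast
qed

lemma ghost_witt_mult_poly:
  assumes p: "Factorial_Ring.prime p"
  shows "ghost p (witt_mult_poly p) n = ghost p (witt_var False) n * ghost p (witt_var True) n"
proof -
  let ?g = "\<lambda>n. ghost p (witt_var False) n * ghost p (witt_var True) n"
  have "of_nat p ^ Suc n dvd ?g (Suc n) - frob_lift p (?g n)" for n
  proof -
    let ?a = "ghost p (witt_var False)" and ?b = "ghost p (witt_var True)"
    have "?g (Suc n) - frob_lift p (?g n) =
      ?a (Suc n) * (?b (Suc n) - frob_lift p (?b n)) + (?a (Suc n) - frob_lift p (?a n)) * frob_lift p (?b n)"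
      by (simp add: frob_lift_def ipoly_subst_mult algebra_simps)
    then show ?thesis using ghost_frob_lift [OF p] dvd_add dvd_mult dvd_mult2 by metis
  qed
  from ghost_surj [OF p this] obtain S where S: "\<forall>n. ghost p S n = ?g n" by blast
  have "\<forall>n. ghost p (witt_mult_poly p) n = ?g n"
    unfolding witt_mult_poly_def
  proof (rule theI [of "\<lambda>S. \<forall>n. ghost p S n = ?g n", OF S])
    fix T assume "\<forall>n. ghost p T n = ?g n"
    then show "T = S"
      using ghost_inj [of p T S] S prime_gt_0_nat [OF p] by (intro ext) simp
  qed
  then show ?thesis by blast
qed

definition witt_subst :: "(nat \<Rightarrow> witt_poly) \<Rightarrow> (nat \<Rightarrow> witt_poly) \<Rightarrow> witt_poly \<Rightarrow> witt_poly"
  where "witt_subst f g = ipoly_subst (\<lambda>v. if fst v then g (snd v) else f (snd v))"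

lemma witt_subst_ghost_var [simp]:
  "witt_subst f g (ghost p (witt_var False) n) = ghost p f n"
  "witt_subst f g (ghost p (witt_var True) n) = ghost p g n"
  by (simp_all add: witt_subst_def ghost_subst witt_var_eq)

text \<open>The principle for all Witt vector identities that follow: they are verified on ghost
  components in the universal case and then evaluated.\<close>

lemma witt_subst_add_poly:
  assumes p: "Factorial_Ring.prime p" and eq: "\<And>n. ghost p h n = ghost p f n + ghost p g n"
  shows "witt_subst f g (witt_add_poly p n) = h n"
proof (rule ghost_inj [OF prime_gt_0_nat [OF p]])
  fix n
  have "ghost p (\<lambda>i. witt_subst f g (witt_add_poly p i)) n = witt_subst f g (ghost p (witt_add_poly p) n)"
    by (simp add: witt_subst_def ghost_subst)
  also have "\<dots> = witt_subst f g (ghost p (witt_var False) n) + witt_subst f g (ghost p (witt_var True) n)"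
    unfolding ghost_witt_add_poly [OF p] by (simp add: witt_subst_def ipoly_subst_add)
  finally show "ghost p (\<lambda>i. witt_subst f g (witt_add_poly p i)) n = ghost p h n"
    by (simp add: eq)
qed

lemma witt_subst_mult_poly:
  assumes p: "Factorial_Ring.prime p" and eq: "\<And>n. ghost p h n = ghost p f n * ghost p g n"
  shows "witt_subst f g (witt_mult_poly p n) = h n"
proof (rule ghost_inj [OF prime_gt_0_nat [OF p]])
  fix n
  have "ghost p (\<lambda>i. witt_subst f g (witt_mult_poly p i)) n = witt_subst f g (ghost p (witt_mult_poly p) n)"
    by (simp add: witt_subst_def ghost_subst)
  also have "\<dots> = witt_subst f g (ghost p (witt_var False) n) * witt_subst f g (ghost p (witt_var True) n)"
    unfolding ghost_witt_mult_poly [OF p] by (simp add: witt_subst_def ipoly_subst_mult)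
  finally show "ghost p (\<lambda>i. witt_subst f g (witt_mult_poly p i)) n = ghost p h n"
    by (simp add: eq)
qed

lemma zero_power_power: "p > 0 \<Longrightarrow> (0 :: 'a::semiring_1) ^ (p ^ n) = 0"
  by (rule zero_power) simp

text \<open>The family is the universal Teichmueller representative of \<open>P\<close>; its ghost
  components are multiplicative in \<open>P\<close>, which is what \<open>teichmueller_mult\<close>
  needs.\<close>

lemma ghost_const:
  assumes "p > 0"
  shows "ghost p (\<lambda>n. if n = 0 then P else 0) n = P ^ (p ^ n)"
proof -
  have "ghost p (\<lambda>n. if n = 0 then P else 0) n = (\<Sum>i\<le>n. if i = 0 then P ^ (p ^ n) else 0)"
    unfolding ghost_def using assms by (intro sum.cong) (auto simp: zero_power_power)
  then show ?thesis by simp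
qed

text \<open>The two families have disjoint supports, so in each summand at most one of the powers
  survives.\<close>

lemma ghost_const_add_tail:
  assumes "p > 0"
  shows "ghost p S n = ghost p (\<lambda>n. if n = 0 then S 0 else 0) n + ghost p (\<lambda>n. if n = 0 then 0 else S n) n"
  unfolding ghost_def sum.distrib [symmetric] using assms by (intro sum.cong) (auto simp: zero_power_power)

section \<open>Teichmueller elements and multiplication by p for Witt vectors over a commutative
  ring\<close>

context cring
begin

definition witt_assign :: "(nat \<Rightarrow> 'a) \<Rightarrow> (nat \<Rightarrow> 'a) \<Rightarrow> bool \<times> nat \<Rightarrow> 'a"
  where "witt_assign x y v = (if fst v then y (snd v) else x (snd v))"

lemma witt_poly_eval_eq: "witt_poly_eval R P x y = ipoly_eval (witt_assign x y) P"
  by (simp add: witt_poly_eval_def ipoly_eval_def mon_eval_def witt_assign_def)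

lemma witt_assign_closed:
  "x \<in> UNIV \<rightarrow> carrier R \<Longrightarrow> y \<in> UNIV \<rightarrow> carrier R \<Longrightarrow> witt_assign x y \<in> UNIV \<rightarrow> carrier R"
  by (auto simp: witt_assign_def Pi_iff)

lemma witt_poly_eval_subst:
  assumes x: "x \<in> UNIV \<rightarrow> carrier R" "y \<in> UNIV \<rightarrow> carrier R"
  shows "witt_poly_eval R P (\<lambda>n. witt_poly_eval R (f n) x y) (\<lambda>n. witt_poly_eval R (g n) x y)
    = witt_poly_eval R (witt_subst f g P) x y"
  unfolding witt_poly_eval_eq witt_subst_def ipoly_eval_subst [OF witt_assign_closed [OF x]]
  by (rule arg_cong [where f = "\<lambda>a. ipoly_eval a P"]) (auto simp: witt_assign_def)

lemma witt_ring_closed: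
  assumes x: "x \<in> UNIV \<rightarrow> carrier R" "y \<in> UNIV \<rightarrow> carrier R"
  shows "x \<oplus>\<^bsub>witt_ring p R\<^esub> y \<in> UNIV \<rightarrow> carrier R" "x \<otimes>\<^bsub>witt_ring p R\<^esub> y \<in> UNIV \<rightarrow> carrier R"
  using witt_assign_closed [OF x] by (auto simp: witt_ring_def witt_poly_eval_eq)

lemma witt_poly_eval_var:
  assumes x: "x \<in> UNIV \<rightarrow> carrier R" "y \<in> UNIV \<rightarrow> carrier R"
  shows "witt_poly_eval R (witt_var v n) x y = (if v then y n else x n)"
  by (simp add: witt_poly_eval_eq witt_var_eq ipoly_eval_var [OF witt_assign_closed [OF x]] witt_assign_def)

lemma teichmueller_mult:
  assumes p: "Factorial_Ring.prime p" and c: "c \<in> carrier R" "d \<in> carrier R"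
  shows "fps_const R c \<otimes>\<^bsub>witt_ring p R\<^esub> fps_const R d = fps_const R (c \<otimes> d)"
proof -
  \<comment> \<open>Constant families, so that the universal variables of index 0 evaluate to
    \<open>c\<close> and \<open>d\<close>.\<close>
  define x y where "x = (\<lambda>n::nat. c)" and "y = (\<lambda>n::nat. d)"
  have xy: "x \<in> UNIV \<rightarrow> carrier R" "y \<in> UNIV \<rightarrow> carrier R" using c by (auto simp: x_def y_def)
  note va = witt_assign_closed [OF xy]
  let ?c = "\<lambda>P n. if n = (0::nat) then P else 0 :: witt_poly"
  have e: "fps_const R (witt_poly_eval R P x y) = (\<lambda>n. witt_poly_eval R (?c P n) x y)" for P
    by (auto simp: fps_const_def witt_poly_eval_eq)
  have p0: "p > 0" using p prime_gt_0_nat by blast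
  have "witt_subst (?c (witt_var False 0)) (?c (witt_var True 0)) (witt_mult_poly p n)
      = ?c (witt_var False 0 * witt_var True 0) n" for n
    by (rule witt_subst_mult_poly [OF p]) (simp only: ghost_const [OF p0] power_mult_distrib)
  then have "fps_const R (witt_poly_eval R (witt_var False 0) x y) \<otimes>\<^bsub>witt_ring p R\<^esub> fps_const R (witt_poly_eval R (witt_var True 0) x y)
    = fps_const R (witt_poly_eval R (witt_var False 0 * witt_var True 0) x y)"
    unfolding e by (simp add: witt_ring_def witt_poly_eval_subst [OF xy])
  then show ?thesis
    using witt_poly_eval_var [OF xy] va
    by (simp add: witt_poly_eval_eq ipoly_eval_mult) (simp add: x_def y_def)
qed

lemma teichmueller_add_tail:
  assumes p: "Factorial_Ring.prime p" and x: "x \<in> UNIV \<rightarrow> carrier R"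
  shows "fps_const R (x 0) \<oplus>\<^bsub>witt_ring p R\<^esub> (\<lambda>n. if n = 0 then \<zero> else x n) = x"
proof -
  have p0: "p > 0" using p prime_gt_0_nat by blast
  let ?c = "\<lambda>n. if n = (0::nat) then witt_var False 0 else 0"
  let ?t = "\<lambda>n. if n = (0::nat) then 0 else witt_var False n"
  have e: "fps_const R (x 0) = (\<lambda>n. witt_poly_eval R (?c n) x x)"
    "(\<lambda>n. if n = 0 then \<zero> else x n) = (\<lambda>n. witt_poly_eval R (?t n) x x)"
    using witt_poly_eval_var [OF x x] by (auto simp: fps_const_def witt_poly_eval_eq)
  have "witt_subst ?c ?t (witt_add_poly p n) = witt_var False n" for n
    by (rule witt_subst_add_poly [OF p ghost_const_add_tail [OF p0]])
  then show ?thesis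
    unfolding e by (simp add: witt_ring_def witt_poly_eval_subst [OF x x] witt_poly_eval_var [OF x x])
qed

text \<open>Adding \<open>x\<close> up \<open>p\<close> times composes Frobenius and Verschiebung: over the integers
  \<open>p w\<^sub>n(x)\<close> and the \<open>n\<close>-th ghost component of \<open>(0, x\<^sub>0\<^sup>p, x\<^sub>1\<^sup>p, \<dots>)\<close> differ by \<open>p\<^bsup>n+1\<^esup> x\<^sub>n\<close>.\<close>

lemma witt_p_times:
  assumes p: "Factorial_Ring.prime p" and char: "[p] \<cdot> \<one> = \<zero>" and x: "x \<in> UNIV \<rightarrow> carrier R"
  shows "((\<lambda>z. z \<oplus>\<^bsub>witt_ring p R\<^esub> x) ^^ p) (\<lambda>n. \<zero>) = (\<lambda>n. if n = 0 then \<zero> else x (n - 1) [^] p)"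
proof -
  have p0: "p > 0" using p prime_gt_0_nat by blast
  note va = witt_assign_closed [OF x x]
  \<comment> \<open>The universal \<open>k\<close>-fold Witt vector sum of the variables
    \<open>witt_var False\<close>, starting from the zero vector.\<close>
  define N where "N k = ((\<lambda>S n. witt_subst S (witt_var False) (witt_add_poly p n)) ^^ k) (\<lambda>n. 0)" for k
  have gN: "ghost p (N k) n = of_nat k * ghost p (witt_var False) n" for k n
  proof (induction k arbitrary: n)
    case 0
    have "ghost p (\<lambda>n. 0) n = 0" using p0 by (simp add: ghost_def zero_power_power)
    then show ?case by (simp add: N_def)
  next
    case (Suc k)
    have "ghost p (N (Suc k)) n = witt_subst (N k) (witt_var False) (ghost p (witt_add_poly p) n)"
      by (simp add: N_def witt_subst_def ghost_subst)
    also have "\<dots> = ghost p (N k) n + ghost p (witt_var False) n"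
      unfolding ghost_witt_add_poly [OF p]
      using witt_subst_ghost_var [of "N k" "witt_var False"] by (simp add: witt_subst_def ipoly_subst_add)
    finally show ?case using Suc by (simp add: algebra_simps)
  qed
  have eN: "((\<lambda>z. z \<oplus>\<^bsub>witt_ring p R\<^esub> x) ^^ k) (\<lambda>n. \<zero>) = (\<lambda>n. witt_poly_eval R (N k n) x x)" for k
  proof (induction k)
    case 0
    then show ?case by (simp add: N_def witt_poly_eval_eq)
  next
    case (Suc k)
    have "(\<lambda>n. witt_poly_eval R (N (Suc k) n) x x) =
      (\<lambda>n. witt_poly_eval R (witt_add_poly p n) (\<lambda>n. witt_poly_eval R (N k n) x x)
        (\<lambda>n. witt_poly_eval R (witt_var False n) x x))"
      by (simp add: N_def witt_poly_eval_subst [OF x x])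
    then show ?case
      using Suc by (simp add: witt_ring_def witt_poly_eval_var [OF x x])
  qed
  \<comment> \<open>The universal vector \<open>(0, X0^p, X1^p, ...)\<close>, Frobenius followed by
    the shift.\<close>
  define T where "T n = (if n = 0 then 0 else witt_var False (n - 1) ^ p)" for n :: nat
  have "of_nat p ^ Suc n dvd ghost p (N p) n - ghost p T n" for n
  proof -
    have "ghost p T n = (\<Sum>i<n. of_nat p ^ Suc i * witt_var False i ^ (p ^ (n - i)))"
    proof (cases n)
      case (Suc m)
      have "ghost p T n = (\<Sum>i\<le>m. of_nat p ^ Suc i * T (Suc i) ^ (p ^ (n - Suc i)))"
        using p0 unfolding Suc ghost_def by (subst sum.atMost_Suc_shift) (simp add: T_def del: power_Suc add: zero_power_power)
      also have "\<dots> = (\<Sum>i<n. of_nat p ^ Suc i * witt_var False i ^ (p ^ (n - i)))"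
        unfolding Suc lessThan_Suc_atMost
        by (intro sum.cong) (auto simp: T_def Suc_diff_le simp flip: power_mult)
      finally show ?thesis .
    qed (use p0 in \<open>simp add: ghost_def T_def\<close>)
    then have "ghost p (N p) n - ghost p T n = of_nat p ^ Suc n * witt_var False n"
      by (simp add: gN ghost_split [of p "witt_var False"] distrib_left sum_distrib_left mult.assoc)
    then show ?thesis by simp
  qed
  then have d: "of_nat p dvd N p n - T n" for n
    by (rule ghost_cong_imp_cong [OF p0])
  \<comment> \<open>The two families agree modulo \<open>p\<close> only; \<open>char\<close> removes
    the multiple of \<open>p\<close> after evaluation.\<close>
  have "witt_poly_eval R (N p n) x x = witt_poly_eval R (T n) x x" for n
  proof -
    obtain c where "N p n - T n = of_nat p * c" using d [of n] by (elim dvdE)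
    then have "N p n = T n + of_nat p * c" by (simp add: algebra_simps)
    then show ?thesis
      using va by (simp add: witt_poly_eval_eq ipoly_eval_add ipoly_eval_mult ipoly_eval_of_nat char)
  qed
  then show ?thesis
    using va unfolding eN by (auto simp: T_def witt_poly_eval_eq ipoly_eval_power witt_var_eq
        ipoly_eval_var witt_assign_def)
qed

end

section \<open>Teichmueller representatives\<close>

lemma fps_ring_simps:
  "carrier (fps_ring A) = UNIV \<rightarrow> carrier A" "\<zero>\<^bsub>fps_ring A\<^esub> = (\<lambda>n. \<zero>\<^bsub>A\<^esub>)"
  "\<one>\<^bsub>fps_ring A\<^esub> = fps_const A \<one>\<^bsub>A\<^esub>" "f \<oplus>\<^bsub>fps_ring A\<^esub> g = (\<lambda>n. f n \<oplus>\<^bsub>A\<^esub> g n)"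
  "f \<otimes>\<^bsub>fps_ring A\<^esub> g = (\<lambda>n. \<Oplus>\<^bsub>A\<^esub>i\<in>{..n}. f i \<otimes>\<^bsub>A\<^esub> g (n - i))"
  by (simp_all add: fps_ring_def fps_const_def)

text \<open>Without closure under multiplication the finite sums in the product of power series could be
  junk values.\<close>

lemma cring_of_fps_ring:
  assumes "cring (fps_ring A)"
    and closed: "\<And>x y. x \<in> carrier A \<Longrightarrow> y \<in> carrier A \<Longrightarrow> x \<otimes>\<^bsub>A\<^esub> y \<in> carrier A"
    and one: "\<one>\<^bsub>A\<^esub> \<in> carrier A"
  shows "cring A"
proof -
  interpret F: cring "fps_ring A" by fact
  let ?c = "fps_const A"
  have zero: "\<zero>\<^bsub>A\<^esub> \<in> carrier A"
    using F.zero_closed by (auto simp: fps_ring_simps)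
  then have c: "?c x \<in> carrier (fps_ring A)" if "x \<in> carrier A" for x
    using that by (auto simp: fps_ring_simps fps_const_def)
  have c0 [simp]: "?c x 0 = x" for x by (simp add: fps_const_def)
  have "abelian_group A"
  proof (rule abelian_groupI)
    fix x y z assume xyz: "x \<in> carrier A" "y \<in> carrier A" "z \<in> carrier A"
    show "x \<oplus>\<^bsub>A\<^esub> y \<in> carrier A"
      using F.a_closed [OF c c] xyz by (force simp: fps_ring_simps Pi_iff dest: spec [of _ 0])
    show "x \<oplus>\<^bsub>A\<^esub> y \<oplus>\<^bsub>A\<^esub> z = x \<oplus>\<^bsub>A\<^esub> (y \<oplus>\<^bsub>A\<^esub> z)"
      using fun_cong [OF F.a_assoc [OF c c c], of x y z 0] xyz by (simp add: fps_ring_simps)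
    show "x \<oplus>\<^bsub>A\<^esub> y = y \<oplus>\<^bsub>A\<^esub> x"
      using fun_cong [OF F.a_comm [OF c c], of x y 0] xyz by (simp add: fps_ring_simps)
    show "\<zero>\<^bsub>A\<^esub> \<oplus>\<^bsub>A\<^esub> x = x"
      using fun_cong [OF F.l_zero [OF c], of x 0] xyz by (simp add: fps_ring_simps)
    have "\<ominus>\<^bsub>fps_ring A\<^esub> ?c x \<in> carrier (fps_ring A)" using F.a_inv_closed [OF c] xyz by simp
    then show "\<exists>y\<in>carrier A. y \<oplus>\<^bsub>A\<^esub> x = \<zero>\<^bsub>A\<^esub>"
      using fun_cong [OF F.l_neg [OF c], of x 0] xyz
      by (intro bexI [of _ "(\<ominus>\<^bsub>fps_ring A\<^esub> ?c x) 0"]) (auto simp: fps_ring_simps)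
  qed (rule zero)
  then interpret A: abelian_group A .
  have m: "(f \<otimes>\<^bsub>fps_ring A\<^esub> g) 0 = f 0 \<otimes>\<^bsub>A\<^esub> g 0"
    if "f 0 \<in> carrier A" "g 0 \<in> carrier A" for f g
    using closed [OF that] by (simp add: fps_ring_simps)
  have mc: "?c x \<otimes>\<^bsub>fps_ring A\<^esub> ?c y \<in> carrier (fps_ring A)" if "x \<in> carrier A" "y \<in> carrier A" for x y
    using c that by simp
  show ?thesis
  proof (rule cringI)
    show "Group.comm_monoid A"
    proof (rule comm_monoidI)
      fix x y z assume xyz: "x \<in> carrier A" "y \<in> carrier A" "z \<in> carrier A"
      show "x \<otimes>\<^bsub>A\<^esub> y \<otimes>\<^bsub>A\<^esub> z = x \<otimes>\<^bsub>A\<^esub> (y \<otimes>\<^bsub>A\<^esub> z)"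
        using fun_cong [OF F.m_assoc [OF c c c], of x y z 0] xyz by (simp add: m closed)
      show "x \<otimes>\<^bsub>A\<^esub> y = y \<otimes>\<^bsub>A\<^esub> x"
        using fun_cong [OF F.m_comm [OF c c], of x y 0] xyz by (simp add: m)
      show "\<one>\<^bsub>A\<^esub> \<otimes>\<^bsub>A\<^esub> x = x"
        using fun_cong [OF F.l_one [OF c], of x 0] xyz one by (simp add: fps_ring_simps(3) m)
    qed (use closed one in auto)
    fix x y z assume xyz: "x \<in> carrier A" "y \<in> carrier A" "z \<in> carrier A"
    show "(x \<oplus>\<^bsub>A\<^esub> y) \<otimes>\<^bsub>A\<^esub> z = x \<otimes>\<^bsub>A\<^esub> z \<oplus>\<^bsub>A\<^esub> y \<otimes>\<^bsub>A\<^esub> z"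
      using fun_cong [OF F.l_distr [OF c c c], of x y z 0] xyz
        m [of "?c x \<oplus>\<^bsub>fps_ring A\<^esub> ?c y" "?c z"] by (simp add: fps_ring_simps(4) m)
  qed (rule \<open>abelian_group A\<close>)
qed

section \<open>Arithmetic of the order of the residue field\<close>

context finite_ext_unif
begin

text \<open>Both \<open>p\<close> and the order of the additive group kill 1 in \<kappa>; were they
  coprime, Bezout would give \<open>1 = 0\<close>.\<close>

lemma p_dvd_card_residue_field: "p dvd card (carrier \<kappa>)"
proof (rule ccontr)
  let ?q = "card (carrier \<kappa>)"
  assume "\<not> p dvd ?q"
  then have "gcd p ?q = 1" using p prime_imp_coprime coprime_iff_gcd_eq_1 by blast
  then obtain x y where xy: "p * x = ?q * y + 1"
    using bezout_nat [of p ?q] p_pos by auto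
  have q: "[?q] \<cdot>\<^bsub>\<kappa>\<^esub> \<one>\<^bsub>\<kappa>\<^esub> = \<zero>\<^bsub>\<kappa>\<^esub>"
    using k.add.pow_order_eq_1 [OF k.one_closed] by (simp add: order_def)
  have z: "[(n * m)] \<cdot>\<^bsub>\<kappa>\<^esub> \<one>\<^bsub>\<kappa>\<^esub> = \<zero>\<^bsub>\<kappa>\<^esub>" if "[n] \<cdot>\<^bsub>\<kappa>\<^esub> \<one>\<^bsub>\<kappa>\<^esub> = \<zero>\<^bsub>\<kappa>\<^esub>" for n m :: nat
    using that k.add.nat_pow_pow [OF k.one_closed, of m n] by simp
  have "[(?q * y + 1)] \<cdot>\<^bsub>\<kappa>\<^esub> \<one>\<^bsub>\<kappa>\<^esub> = \<one>\<^bsub>\<kappa>\<^esub>"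
    using z [OF q, of y] by simp
  then show False using z [OF residue_char, of x] k.one_not_zero unfolding xy by simp
qed

lemma card_residue_field_gt_1: "card (carrier \<kappa>) > 1"
proof -
  have "card {\<zero>\<^bsub>\<kappa>\<^esub>, \<one>\<^bsub>\<kappa>\<^esub>} \<le> card (carrier \<kappa>)"
    by (rule card_mono [OF finite_residue_field]) auto
  then show ?thesis using k.one_not_zero by (simp add: eq_commute)
qed

lemma coprime_p_card_units: "coprime p (card (carrier \<kappa>) - 1)"
proof -
  obtain r where r: "card (carrier \<kappa>) = p * r" using p_dvd_card_residue_field by auto
  have "\<not> p dvd p * r - 1"
  proof
    assume "p dvd p * r - 1"
    then have "p dvd p * r - (p * r - 1)" by (rule dvd_diff_nat [OF dvd_triv_left])
    moreover have "p * r - (p * r - 1) = 1" using r card_residue_field_gt_1 by simp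
    ultimately have "p dvd 1" by auto
    then show False using p prime_gt_1_nat by auto
  qed
  then show ?thesis using r p by (simp add: prime_imp_coprime)
qed

text \<open>Perfectness of \<kappa>: \<open>p\<close> is invertible modulo the order of the unit
  group, so a suitable power of \<open>x\<close> is a root. It permits division by \<open>p\<close>
  in \<open>W_decompose\<close>.\<close>

lemma residue_p_root:
  assumes x: "x \<in> carrier \<kappa>"
  shows "\<exists>y\<in>carrier \<kappa>. y [^]\<^bsub>\<kappa>\<^esub> p = x"
proof (cases "x = \<zero>\<^bsub>\<kappa>\<^esub>")
  case True
  then show ?thesis using p_pos k.nat_pow_zero by (intro bexI [of _ x]) auto
next
  case False
  let ?n = "card (carrier \<kappa>) - 1"
  obtain t s where ts: "p * t = ?n * s + 1"
    using bezout_nat [of p ?n] p_pos coprime_p_card_units by (auto simp: coprime_iff_gcd_eq_1)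
  have "x \<in> Units \<kappa>" "card (Units \<kappa>) = ?n" "finite (Units \<kappa>)"
    using x False finite_residue_field by (simp_all add: k.field_Units card_Diff_singleton)
  then have 1: "x [^]\<^bsub>\<kappa>\<^esub> ?n = \<one>\<^bsub>\<kappa>\<^esub>"
    using k.units_power_order_eq_one by metis
  have "(x [^]\<^bsub>\<kappa>\<^esub> t) [^]\<^bsub>\<kappa>\<^esub> p = x [^]\<^bsub>\<kappa>\<^esub> (?n * s + 1)"
    using x ts by (simp add: k.nat_pow_pow mult.commute)
  also have "\<dots> = (x [^]\<^bsub>\<kappa>\<^esub> ?n) [^]\<^bsub>\<kappa>\<^esub> s \<otimes>\<^bsub>\<kappa>\<^esub> x"
    using x by (simp add: k.nat_pow_pow)
  finally show ?thesis using 1 x by (intro bexI [of _ "x [^]\<^bsub>\<kappa>\<^esub> t"]) simp_all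
qed

text \<open>The origin of the averaging constant: \<open>q - 1\<close> is nonzero modulo
  \<open>p\<close>, so \<open>Zp_unit\<close> inverts it.\<close>

lemma Zp_inverse_card_units:
  obtains y where "y \<in> carrier (Zp p)" "[(card (carrier \<kappa>) - 1)] \<cdot>\<^bsub>Zp p\<^esub> y = \<one>\<^bsub>Zp p\<^esub>"
proof -
  let ?n = "card (carrier \<kappa>) - 1"
  let ?x = "[?n] \<cdot>\<^bsub>Zp p\<^esub> \<one>\<^bsub>Zp p\<^esub>"
  have "?x 1 = int ?n mod int p"
    using Zp_of_nat_mult [OF Zp.one_closed p_pos, of ?n] p prime_gt_1_nat [of p] by (simp add: Zp_simps)
  moreover have "\<not> p dvd ?n"
    using coprime_p_card_units p by (metis coprime_common_divisor_nat dvd_refl not_prime_1)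
  ultimately have "?x 1 \<noteq> 0" by (metis int_dvd_int_iff dvd_eq_mod_eq_0)
  then obtain y where "y \<in> carrier (Zp p)" "?x \<otimes>\<^bsub>Zp p\<^esub> y = \<one>\<^bsub>Zp p\<^esub>"
    using Zp_unit [OF p _ ] by (metis Zp.add.nat_pow_closed Zp.one_closed)
  then show ?thesis using that by (simp add: Zp.add_pow_ldistr)
qed

end

text \<open>The ring axioms of the Witt vectors are an assumption here; the final proof obtains them
  from the power series ring that acts on the given module.\<close>

locale witt_cring = finite_ext_unif +
  fixes j :: "(nat \<Rightarrow> int) \<Rightarrow> nat \<Rightarrow> 'a set"
  assumes W_cring: "cring (Wk p K \<iota>)" and j_hom: "j \<in> ring_hom (Zp p) (Wk p K \<iota>)"
begin

abbreviation "W \<equiv> Wk p K \<iota>"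
abbreviation "teich \<equiv> fps_const \<kappa>"

sublocale W: cring W by (rule W_cring)

sublocale j: ring_hom_cring "Zp p" W j
  by (intro ring_hom_cringI Zp.cring_axioms W.cring_axioms j_hom)

lemma W_eq: "W = witt_ring p \<kappa>" by (simp add: Wk_def)

lemma W_simps: "carrier W = UNIV \<rightarrow> carrier \<kappa>" "\<zero>\<^bsub>W\<^esub> = (\<lambda>n. \<zero>\<^bsub>\<kappa>\<^esub>)" "\<one>\<^bsub>W\<^esub> = teich \<one>\<^bsub>\<kappa>\<^esub>"
  by (simp_all add: Wk_def witt_ring_def fps_const_def)

lemma teich_closed: "c \<in> carrier \<kappa> \<Longrightarrow> teich c \<in> carrier W"
  by (auto simp: W_simps fps_const_def)

lemma teich_zero: "teich \<zero>\<^bsub>\<kappa>\<^esub> = \<zero>\<^bsub>W\<^esub>"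
  by (auto simp: W_simps fps_const_def)

lemma teich_mult: "c \<in> carrier \<kappa> \<Longrightarrow> d \<in> carrier \<kappa> \<Longrightarrow> teich c \<otimes>\<^bsub>W\<^esub> teich d = teich (c \<otimes>\<^bsub>\<kappa>\<^esub> d)"
  unfolding W_eq by (rule k.teichmueller_mult [OF p])

text \<open>Turns the iterated addition of \<open>witt_p_times\<close> into a multiple, now that the
  Witt vectors are known to form a ring.\<close>

lemma W_p_times:
  assumes w: "w \<in> carrier W"
  shows "[p] \<cdot>\<^bsub>W\<^esub> w = (\<lambda>n. if n = 0 then \<zero>\<^bsub>\<kappa>\<^esub> else w (n - 1) [^]\<^bsub>\<kappa>\<^esub> p)"
proof -
  have "[k] \<cdot>\<^bsub>W\<^esub> w = ((\<lambda>z. z \<oplus>\<^bsub>W\<^esub> w) ^^ k) \<zero>\<^bsub>W\<^esub>" for k :: nat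
    by (induction k) simp_all
  then show ?thesis
    using k.witt_p_times [OF p residue_char, of w] w by (simp add: W_simps W_eq [symmetric])
qed

text \<open>Each factor \<open>p\<close> shifts by one place. So an element divisible by all powers
  of \<open>p\<close> is 0, the separatedness that concludes \<open>W_span_teich\<close>.\<close>

lemma W_p_power_times:
  assumes "w \<in> carrier W" "i < n"
  shows "([(p ^ n)] \<cdot>\<^bsub>W\<^esub> w) i = \<zero>\<^bsub>\<kappa>\<^esub>"
  using assms
proof (induction n arbitrary: i)
  case (Suc n)
  have "[(p ^ Suc n)] \<cdot>\<^bsub>W\<^esub> w = [p] \<cdot>\<^bsub>W\<^esub> ([(p ^ n)] \<cdot>\<^bsub>W\<^esub> w)"
    using Suc.prems by (simp add: W.add.nat_pow_pow mult.commute)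
  then show ?case
    using Suc p_pos by (auto simp: W_p_times k.nat_pow_zero)
qed simp

text \<open>By \<open>W_p_times\<close>, the tail with first coordinate 0 is \<open>p\<close> times
  the vector of p-th roots of the later coordinates.\<close>

lemma W_decompose:
  assumes w: "w \<in> carrier W"
  shows "\<exists>c\<in>carrier \<kappa>. \<exists>w'\<in>carrier W. w = teich c \<oplus>\<^bsub>W\<^esub> [p] \<cdot>\<^bsub>W\<^esub> w'"
proof -
  have wc: "w n \<in> carrier \<kappa>" for n using w by (auto simp: W_simps)
  have "\<forall>n. \<exists>y\<in>carrier \<kappa>. y [^]\<^bsub>\<kappa>\<^esub> p = w (Suc n)" using residue_p_root wc by blast
  then obtain w' where w': "\<And>n. w' n \<in> carrier \<kappa>" "\<And>n. w' n [^]\<^bsub>\<kappa>\<^esub> p = w (Suc n)" by metis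
  have w'W: "w' \<in> carrier W" using w' by (simp add: W_simps)
  have "[p] \<cdot>\<^bsub>W\<^esub> w' = (\<lambda>n. if n = 0 then \<zero>\<^bsub>\<kappa>\<^esub> else w n)"
    unfolding W_p_times [OF w'W] using w' by (auto simp: fun_eq_iff)
  then have "w = teich (w 0) \<oplus>\<^bsub>W\<^esub> [p] \<cdot>\<^bsub>W\<^esub> w'"
    using k.teichmueller_add_tail [OF p, of w] w by (simp add: W_simps W_eq [symmetric])
  then show ?thesis using wc w'W by blast
qed

text \<open>Iterating \<open>W_decompose\<close> gives an expansion in Teichmueller digits. As
  \<kappa> is finite, the powers of \<open>p\<close> can be grouped by digit, and each group has a
  limit in the p-adic integers.\<close>

lemma W_span_teich:
  assumes w: "w \<in> carrier W"
  shows "\<exists>z\<in>UNIV \<rightarrow> carrier (Zp p). w = (\<Oplus>\<^bsub>W\<^esub>b\<in>carrier \<kappa>. j (z b) \<otimes>\<^bsub>W\<^esub> teich b)"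
proof -
  have "\<forall>w. \<exists>c w'. w \<in> carrier W \<longrightarrow> c \<in> carrier \<kappa> \<and> w' \<in> carrier W \<and> w = teich c \<oplus>\<^bsub>W\<^esub> [p] \<cdot>\<^bsub>W\<^esub> w'"
    using W_decompose by blast
  then obtain C D where CD: "\<And>w. w \<in> carrier W \<Longrightarrow>
      C w \<in> carrier \<kappa> \<and> D w \<in> carrier W \<and> w = teich (C w) \<oplus>\<^bsub>W\<^esub> [p] \<cdot>\<^bsub>W\<^esub> D w" by metis
  define v where "v n = (D ^^ n) w" for n
  define c where "c n = C (v n)" for n
  have v: "v n \<in> carrier W" for n
    by (induction n) (use w CD in \<open>auto simp: v_def\<close>)
  have c: "c n \<in> carrier \<kappa>" "v n = teich (c n) \<oplus>\<^bsub>W\<^esub> [p] \<cdot>\<^bsub>W\<^esub> v (Suc n)" for n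
    using CD [OF v [of n]] by (auto simp: c_def v_def)
  \<comment> \<open>The sum of those \<open>p ^ k\<close> with \<open>k < n\<close> whose digit is
    \<open>b\<close>; \<open>z b\<close> below is the limit as \<open>n\<close> grows.\<close>
  define N where "N b n = (\<Sum>k<n. if c k = b then p ^ k else 0)" for b n
  define z where "z b = (\<lambda>n. int (N b n) mod int p ^ n)" for b
  have z: "z b \<in> carrier (Zp p)" for b
    unfolding z_def by (rule Zp_carrierI [OF p_pos]) (simp add: N_def)
  have fin: "finite (carrier \<kappa>)" by (rule finite_residue_field)
  note tc = teich_closed
  have part: "w = (\<Oplus>\<^bsub>W\<^esub>b\<in>carrier \<kappa>. [N b n] \<cdot>\<^bsub>W\<^esub> teich b) \<oplus>\<^bsub>W\<^esub> [(p ^ n)] \<cdot>\<^bsub>W\<^esub> v n" for n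
  proof (induction n)
    case 0
    have "(\<Oplus>\<^bsub>W\<^esub>b\<in>carrier \<kappa>. [N b 0] \<cdot>\<^bsub>W\<^esub> teich b) = \<zero>\<^bsub>W\<^esub>"
      by (intro W.add.finprod_one_eqI) (simp add: N_def)
    then show ?case using w by (simp add: v_def)
  next
    case (Suc n)
    have "(\<Oplus>\<^bsub>W\<^esub>b\<in>carrier \<kappa>. [N b (Suc n)] \<cdot>\<^bsub>W\<^esub> teich b)
      = (\<Oplus>\<^bsub>W\<^esub>b\<in>carrier \<kappa>. [N b n] \<cdot>\<^bsub>W\<^esub> teich b \<oplus>\<^bsub>W\<^esub> (if b = c n then [(p ^ n)] \<cdot>\<^bsub>W\<^esub> teich b else \<zero>\<^bsub>W\<^esub>))"
      by (intro W.finsum_cong') (auto simp: N_def tc W.add.nat_pow_mult)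
    also have "\<dots> = (\<Oplus>\<^bsub>W\<^esub>b\<in>carrier \<kappa>. [N b n] \<cdot>\<^bsub>W\<^esub> teich b) \<oplus>\<^bsub>W\<^esub>
        (\<Oplus>\<^bsub>W\<^esub>b\<in>carrier \<kappa>. if b = c n then [(p ^ n)] \<cdot>\<^bsub>W\<^esub> teich b else \<zero>\<^bsub>W\<^esub>)"
      by (intro W.finsum_addf) (auto simp: tc)
    also have "(\<Oplus>\<^bsub>W\<^esub>b\<in>carrier \<kappa>. if b = c n then [(p ^ n)] \<cdot>\<^bsub>W\<^esub> teich b else \<zero>\<^bsub>W\<^esub>)
        = [(p ^ n)] \<cdot>\<^bsub>W\<^esub> teich (c n)"
      using W.add.finprod_singleton [of "c n" "carrier \<kappa>" "\<lambda>b. [(p ^ n)] \<cdot>\<^bsub>W\<^esub> teich b"] c(1) fin tc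
      by (simp add: eq_commute [of _ "c n"])
    finally have e: "(\<Oplus>\<^bsub>W\<^esub>b\<in>carrier \<kappa>. [N b (Suc n)] \<cdot>\<^bsub>W\<^esub> teich b) =
      (\<Oplus>\<^bsub>W\<^esub>b\<in>carrier \<kappa>. [N b n] \<cdot>\<^bsub>W\<^esub> teich b) \<oplus>\<^bsub>W\<^esub> [(p ^ n)] \<cdot>\<^bsub>W\<^esub> teich (c n)" .
    have "[(p ^ n)] \<cdot>\<^bsub>W\<^esub> v n = [(p ^ n)] \<cdot>\<^bsub>W\<^esub> teich (c n) \<oplus>\<^bsub>W\<^esub> [(p ^ Suc n)] \<cdot>\<^bsub>W\<^esub> v (Suc n)"
      by (subst c(2)) (use v tc c(1) in \<open>simp add: W.add.nat_pow_distrib W.add.nat_pow_pow mult.commute\<close>)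
    moreover have "(\<Oplus>\<^bsub>W\<^esub>b\<in>carrier \<kappa>. [N b n] \<cdot>\<^bsub>W\<^esub> teich b) \<in> carrier W"
      by (rule W.finsum_closed) (simp add: tc)
    ultimately show ?case
      unfolding e using Suc v tc c(1) by (simp add: W.a_assoc)
  qed
  let ?S = "\<Oplus>\<^bsub>W\<^esub>b\<in>carrier \<kappa>. j (z b) \<otimes>\<^bsub>W\<^esub> teich b"
  have S: "?S \<in> carrier W" using z tc by (intro W.finsum_closed) simp
  have div: "\<exists>d\<in>carrier W. w \<ominus>\<^bsub>W\<^esub> ?S = [(p ^ n)] \<cdot>\<^bsub>W\<^esub> d" for n
  proof -
    \<comment> \<open>The approximation of \<open>z b\<close> is recorded as divisibility by
      \<open>p ^ n\<close>, a form that the ring homomorphism \<open>j\<close> preserves.\<close>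
    have "\<exists>y\<in>carrier (Zp p). z b = [N b n] \<cdot>\<^bsub>Zp p\<^esub> \<one>\<^bsub>Zp p\<^esub> \<oplus>\<^bsub>Zp p\<^esub> [(p ^ n)] \<cdot>\<^bsub>Zp p\<^esub> y" for b
    proof -
      let ?o = "[N b n] \<cdot>\<^bsub>Zp p\<^esub> \<one>\<^bsub>Zp p\<^esub>"
      let ?d = "z b \<ominus>\<^bsub>Zp p\<^esub> ?o"
      have d: "?d \<in> carrier (Zp p)" using z by simp
      have e: "?d \<oplus>\<^bsub>Zp p\<^esub> ?o = z b" using z by (simp add: a_minus_def Zp.a_assoc Zp.l_neg)
      have on: "?o n mod int p ^ n = z b n mod int p ^ n"
        by (simp add: z_def Zp_of_nat_mult [OF Zp.one_closed p_pos]) (simp add: Zp_simps mod_simps)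
      have "(?d n + ?o n) mod int p ^ n = z b n"
        using fun_cong [OF e, of n] by (simp add: Zp_simps(3))
      then have "(?d n + ?o n) mod int p ^ n = ?o n mod int p ^ n"
        using on Zp_nth_mod [OF z] by simp
      then have "?d n mod int p ^ n = 0" by (simp add: mod_eq_dvd_iff dvd_eq_mod_eq_0)
      then have "?d n = 0" using Zp_nth_mod [OF d] by simp
      then obtain y where "y \<in> carrier (Zp p)" "?d = [(p ^ n)] \<cdot>\<^bsub>Zp p\<^esub> y"
        using Zp_divisible [OF p_pos d] by metis
      then show ?thesis using e z by (metis Zp.a_comm Zp.add.nat_pow_closed Zp.one_closed)
    qed
    then obtain y where y: "\<And>b. y b \<in> carrier (Zp p)"
      "\<And>b. z b = [N b n] \<cdot>\<^bsub>Zp p\<^esub> \<one>\<^bsub>Zp p\<^esub> \<oplus>\<^bsub>Zp p\<^esub> [(p ^ n)] \<cdot>\<^bsub>Zp p\<^esub> y b" by metis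
    have jn: "j ([k] \<cdot>\<^bsub>Zp p\<^esub> x) = [k] \<cdot>\<^bsub>W\<^esub> j x" if "x \<in> carrier (Zp p)" for k :: nat and x
      using that by (induction k) simp_all
    let ?T = "\<Oplus>\<^bsub>W\<^esub>b\<in>carrier \<kappa>. j (y b) \<otimes>\<^bsub>W\<^esub> teich b"
    let ?N = "\<Oplus>\<^bsub>W\<^esub>b\<in>carrier \<kappa>. [N b n] \<cdot>\<^bsub>W\<^esub> teich b"
    have T: "?T \<in> carrier W" using y tc by (intro W.finsum_closed) simp
    have Nc: "?N \<in> carrier W" using tc by (intro W.finsum_closed) simp
    have "?S = (\<Oplus>\<^bsub>W\<^esub>b\<in>carrier \<kappa>. [N b n] \<cdot>\<^bsub>W\<^esub> teich b \<oplus>\<^bsub>W\<^esub> [(p ^ n)] \<cdot>\<^bsub>W\<^esub> \<one>\<^bsub>W\<^esub> \<otimes>\<^bsub>W\<^esub> (j (y b) \<otimes>\<^bsub>W\<^esub> teich b))"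
    proof (rule W.finsum_cong' [OF refl])
      fix b assume b: "b \<in> carrier \<kappa>"
      have "j (z b) = [N b n] \<cdot>\<^bsub>W\<^esub> \<one>\<^bsub>W\<^esub> \<oplus>\<^bsub>W\<^esub> [(p ^ n)] \<cdot>\<^bsub>W\<^esub> j (y b)"
        by (subst y(2)) (use y in \<open>simp add: jn\<close>)
      then show "j (z b) \<otimes>\<^bsub>W\<^esub> teich b = [N b n] \<cdot>\<^bsub>W\<^esub> teich b \<oplus>\<^bsub>W\<^esub> [(p ^ n)] \<cdot>\<^bsub>W\<^esub> \<one>\<^bsub>W\<^esub> \<otimes>\<^bsub>W\<^esub> (j (y b) \<otimes>\<^bsub>W\<^esub> teich b)"
        using y b tc by (simp add: W.l_distr W.add_pow_ldistr)
    qed (use y tc in auto)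
    also have "\<dots> = ?N \<oplus>\<^bsub>W\<^esub> (\<Oplus>\<^bsub>W\<^esub>b\<in>carrier \<kappa>. [(p ^ n)] \<cdot>\<^bsub>W\<^esub> \<one>\<^bsub>W\<^esub> \<otimes>\<^bsub>W\<^esub> (j (y b) \<otimes>\<^bsub>W\<^esub> teich b))"
      by (rule W.finsum_addf) (use y tc in auto)
    also have "(\<Oplus>\<^bsub>W\<^esub>b\<in>carrier \<kappa>. [(p ^ n)] \<cdot>\<^bsub>W\<^esub> \<one>\<^bsub>W\<^esub> \<otimes>\<^bsub>W\<^esub> (j (y b) \<otimes>\<^bsub>W\<^esub> teich b)) = [(p ^ n)] \<cdot>\<^bsub>W\<^esub> \<one>\<^bsub>W\<^esub> \<otimes>\<^bsub>W\<^esub> ?T"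
      by (rule W.finsum_rdistr [symmetric]) (use y tc fin in auto)
    finally have "?S = ?N \<oplus>\<^bsub>W\<^esub> [(p ^ n)] \<cdot>\<^bsub>W\<^esub> ?T" using T by (simp add: W.add_pow_ldistr)
    then have "w \<ominus>\<^bsub>W\<^esub> ?S = (?N \<oplus>\<^bsub>W\<^esub> [(p ^ n)] \<cdot>\<^bsub>W\<^esub> v n) \<ominus>\<^bsub>W\<^esub> (?N \<oplus>\<^bsub>W\<^esub> [(p ^ n)] \<cdot>\<^bsub>W\<^esub> ?T)"
      using part [of n] by simp
    also have "\<dots> = [(p ^ n)] \<cdot>\<^bsub>W\<^esub> v n \<ominus>\<^bsub>W\<^esub> [(p ^ n)] \<cdot>\<^bsub>W\<^esub> ?T"
      using Nc T v by (simp add: a_minus_def W.minus_add W.a_ac W.r_neg1 W.r_neg2)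
    also have "\<dots> = [(p ^ n)] \<cdot>\<^bsub>W\<^esub> (v n \<ominus>\<^bsub>W\<^esub> ?T)"
      using T v by (simp add: a_minus_def W.add.nat_pow_distrib W.add.nat_pow_inv)
    finally show ?thesis using T v by (intro bexI [of _ "v n \<ominus>\<^bsub>W\<^esub> ?T"]) simp_all
  qed
  have "(w \<ominus>\<^bsub>W\<^esub> ?S) i = \<zero>\<^bsub>\<kappa>\<^esub>" for i
  proof -
    obtain d where "d \<in> carrier W" "w \<ominus>\<^bsub>W\<^esub> ?S = [(p ^ Suc i)] \<cdot>\<^bsub>W\<^esub> d"
      using div [of "Suc i"] by blast
    then show ?thesis using W_p_power_times [of d i "Suc i"] by (simp only: lessI)
  qed
  then have "w \<ominus>\<^bsub>W\<^esub> ?S = \<zero>\<^bsub>W\<^esub>" unfolding W_simps(2) by (rule ext)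
  then have "w = ?S" using w S by simp
  then show ?thesis using z by blast
qed

end

section \<open>Tensor products of rings\<close>

locale tensor = A: cring A + B: cring B
  for A :: "('a, 'x) ring_scheme" and B :: "('b, 'y) ring_scheme" +
  fixes C :: "('c, 'z) ring_scheme" and f :: "'c \<Rightarrow> 'a" and g :: "'c \<Rightarrow> 'b"
  assumes f_closed: "\<And>c. c \<in> carrier C \<Longrightarrow> f c \<in> carrier A"
    and g_closed: "\<And>c. c \<in> carrier C \<Longrightarrow> g c \<in> carrier B"
begin

abbreviation "P \<equiv> pair_monoid_ring A B"

lemma P_simps:
  "carrier P = {s. Poly_Mapping.keys s \<subseteq> carrier A \<times> carrier B}" "\<zero>\<^bsub>P\<^esub> = 0" "s \<oplus>\<^bsub>P\<^esub> t = s + t"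
  "\<one>\<^bsub>P\<^esub> = frag_of (\<one>\<^bsub>A\<^esub>, \<one>\<^bsub>B\<^esub>)"
  by (simp_all add: pair_monoid_ring_def)

lemma P_diff_closed: "s \<in> carrier P \<Longrightarrow> t \<in> carrier P \<Longrightarrow> s - t \<in> carrier P"
  using Poly_Mapping.keys_diff [of s t] by (auto simp: P_simps)

lemma frag_of_closed: "a \<in> carrier A \<Longrightarrow> b \<in> carrier B \<Longrightarrow> frag_of (a, b) \<in> carrier P"
  by (auto simp: P_simps)

text \<open>The form of \<open>frag_induction\<close> that also tracks the carrier, so that closure
  facts are at hand in the difference case.\<close>

lemma P_induct [consumes 1, case_names zero one diff]:
  assumes "s \<in> carrier P" and "Q 0"
    and "\<And>a b. a \<in> carrier A \<Longrightarrow> b \<in> carrier B \<Longrightarrow> Q (frag_of (a, b))"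
    and "\<And>s t. s \<in> carrier P \<Longrightarrow> t \<in> carrier P \<Longrightarrow> Q s \<Longrightarrow> Q t \<Longrightarrow> Q (s - t)"
  shows "Q s"
proof -
  have "Poly_Mapping.keys s \<subseteq> carrier A \<times> carrier B" using assms(1) by (simp add: P_simps)
  then have "s \<in> carrier P \<and> Q s"
    by (induction rule: frag_induction) (use assms(2-) in \<open>auto simp: P_diff_closed frag_of_closed\<close>, simp add: P_simps)
  then show ?thesis by simp
qed

lemma P_mult_frag_of: "frag_of (a, b) \<otimes>\<^bsub>P\<^esub> frag_of (a', b') = frag_of (a \<otimes>\<^bsub>A\<^esub> a', b \<otimes>\<^bsub>B\<^esub> b')"
  by (simp add: pair_monoid_ring_def)

lemma P_mult_diff_left: "(s - s') \<otimes>\<^bsub>P\<^esub> t = s \<otimes>\<^bsub>P\<^esub> t - s' \<otimes>\<^bsub>P\<^esub> t"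
  by (simp add: pair_monoid_ring_def frag_extend_diff)

lemma P_mult_add_left: "(s + s') \<otimes>\<^bsub>P\<^esub> t = s \<otimes>\<^bsub>P\<^esub> t + s' \<otimes>\<^bsub>P\<^esub> t"
  by (simp add: pair_monoid_ring_def frag_extend_add)

lemma P_mult_zero_left: "0 \<otimes>\<^bsub>P\<^esub> t = 0"
  by (simp add: pair_monoid_ring_def)

lemma P_mult_diff_right: "s \<otimes>\<^bsub>P\<^esub> (t - t') = s \<otimes>\<^bsub>P\<^esub> t - s \<otimes>\<^bsub>P\<^esub> t'"
  by (induction s rule: frag_induction [OF subset_UNIV])
    (auto simp: P_mult_zero_left P_mult_diff_left, auto simp: pair_monoid_ring_def frag_extend_diff)

lemma P_mult_zero_right: "s \<otimes>\<^bsub>P\<^esub> 0 = 0"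
  using P_mult_diff_right [of s 0 0] by simp

lemma P_mult_closed: "s \<in> carrier P \<Longrightarrow> t \<in> carrier P \<Longrightarrow> s \<otimes>\<^bsub>P\<^esub> t \<in> carrier P"
proof (induction s rule: P_induct)
  case (one a b)
  from one(3) show ?case
    by (induction t rule: P_induct)
      (use one in \<open>auto simp: P_mult_zero_right P_mult_diff_right P_mult_frag_of frag_of_closed P_diff_closed\<close>,
       simp add: P_simps)
qed (auto simp: P_mult_zero_left P_mult_diff_left P_diff_closed, simp add: P_simps)

lemma P_mult_comm: "s \<in> carrier P \<Longrightarrow> t \<in> carrier P \<Longrightarrow> s \<otimes>\<^bsub>P\<^esub> t = t \<otimes>\<^bsub>P\<^esub> s"
proof (induction s rule: P_induct)
  case (one a b)
  from one(3) show ?case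
    by (induction t rule: P_induct)
      (use one in \<open>auto simp: P_mult_zero_right P_mult_diff_right P_mult_zero_left P_mult_diff_left
        P_mult_frag_of A.m_comm B.m_comm\<close>)
qed (auto simp: P_mult_zero_right P_mult_diff_right P_mult_zero_left P_mult_diff_left)

lemma P_mult_assoc:
  assumes "s \<in> carrier P" "t \<in> carrier P" "w \<in> carrier P"
  shows "s \<otimes>\<^bsub>P\<^esub> t \<otimes>\<^bsub>P\<^esub> w = s \<otimes>\<^bsub>P\<^esub> (t \<otimes>\<^bsub>P\<^esub> w)"
  using assms(1)
proof (induction s rule: P_induct)
  case (one a b)
  note ab = one
  from assms(2) show ?case
  proof (induction t rule: P_induct)
    case (one a' b')
    note ab' = one
    from assms(3) show ?case
    proof (induction w rule: P_induct)
      case (one c d)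
      then show ?case using ab ab' by (simp add: P_mult_frag_of A.m_assoc B.m_assoc)
    qed (auto simp: P_mult_zero_right P_mult_diff_right)
  qed (auto simp: P_mult_zero_right P_mult_diff_right P_mult_zero_left P_mult_diff_left)
qed (auto simp: P_mult_zero_left P_mult_diff_left)

lemma P_mult_one: "s \<in> carrier P \<Longrightarrow> \<one>\<^bsub>P\<^esub> \<otimes>\<^bsub>P\<^esub> s = s"
  by (induction s rule: P_induct) (auto simp: P_simps(4) P_mult_zero_right P_mult_diff_right P_mult_frag_of)

text \<open>This is the integral monoid ring of the product of the two multiplicative monoids;
  distributivity reduces its laws to pairs.\<close>

lemma cring_P: "cring P"
proof (rule cringI)
  have 0: "0 \<in> carrier P" by (simp add: P_simps)
  have add: "s + t \<in> carrier P" if "s \<in> carrier P" "t \<in> carrier P" for s t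
    using that Poly_Mapping.keys_add [of s t] by (auto simp: P_simps)
  show "abelian_group P"
  proof (rule abelian_groupI)
    fix s assume "s \<in> carrier P"
    then show "\<exists>t\<in>carrier P. t \<oplus>\<^bsub>P\<^esub> s = \<zero>\<^bsub>P\<^esub>"
      using P_diff_closed [OF 0] by (intro bexI [of _ "0 - s"]) (simp_all add: P_simps(2,3))
  qed (simp_all add: P_simps(2,3) add 0 add_ac)
  show "Group.comm_monoid P"
  proof (rule comm_monoidI)
    show "\<one>\<^bsub>P\<^esub> \<in> carrier P" by (simp add: P_simps(4) frag_of_closed)
  qed (blast intro: P_mult_closed P_mult_assoc P_mult_comm P_mult_one)+
qed (simp add: P_simps(3) P_mult_add_left)

sublocale P: cring P by (rule cring_P)

lemma P_minus_eq: "s \<in> carrier P \<Longrightarrow> t \<in> carrier P \<Longrightarrow> s \<ominus>\<^bsub>P\<^esub> t = s - t"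
proof -
  assume s: "s \<in> carrier P" and t: "t \<in> carrier P"
  have "s = (s - t) \<oplus>\<^bsub>P\<^esub> t" by (simp add: P_simps(3))
  then have "s \<ominus>\<^bsub>P\<^esub> t = ((s - t) \<oplus>\<^bsub>P\<^esub> t) \<ominus>\<^bsub>P\<^esub> t" by simp
  then show ?thesis using t P_diff_closed [OF s t] by (simp add: a_minus_def P.a_assoc P.r_neg)
qed

section \<open>The tensor product ring and its pure tensors\<close>

abbreviation "rels \<equiv> tensor_rels C (\<lambda>c a. f c \<otimes>\<^bsub>A\<^esub> a) A (\<lambda>c b. g c \<otimes>\<^bsub>B\<^esub> b) B"
abbreviation "I \<equiv> tensor_ideal C f A g B"
abbreviation "T \<equiv> tensor_ring C f A g B"
abbreviation "pure \<equiv> pure_tensor C f A g B"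

lemma rels_closed: "rels \<subseteq> carrier P"
  unfolding tensor_rels_def
  by (auto intro!: P_diff_closed frag_of_closed f_closed g_closed A.a_closed B.a_closed A.m_closed B.m_closed)

sublocale I: ideal I P
  unfolding tensor_ideal_def by (rule P.genideal_ideal [OF rels_closed])

lemma rels_in_I: "rels \<subseteq> I"
  unfolding tensor_ideal_def by (rule P.genideal_self [OF rels_closed])

lemma cring_T: "cring T"
  unfolding tensor_ring_def by (rule I.quotient_is_cring [OF cring_P])

sublocale T: cring T by (rule cring_T)

sublocale proj: ring_hom_cring P T "(+>\<^bsub>P\<^esub>) I"
  by (intro ring_hom_cringI cring_P cring_T) (simp add: tensor_ring_def I.rcos_ring_hom)

lemma proj_eqI: "s \<in> carrier P \<Longrightarrow> t \<in> carrier P \<Longrightarrow> s - t \<in> I \<Longrightarrow> I +>\<^bsub>P\<^esub> s = I +>\<^bsub>P\<^esub> t"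
  using P.quotient_eq_iff_same_a_r_cos [OF I.is_ideal] by (simp add: P_minus_eq)

lemma pure_eq: "pure a b = I +>\<^bsub>P\<^esub> frag_of (a, b)"
  by (simp add: pure_tensor_def)

lemma pure_closed: "a \<in> carrier A \<Longrightarrow> b \<in> carrier B \<Longrightarrow> pure a b \<in> carrier T"
  unfolding pure_eq by (intro proj.hom_closed frag_of_closed)

lemma pure_add_left:
  assumes "a \<in> carrier A" "a' \<in> carrier A" "b \<in> carrier B"
  shows "pure (a \<oplus>\<^bsub>A\<^esub> a') b = pure a b \<oplus>\<^bsub>T\<^esub> pure a' b"
proof -
  have "frag_of (a \<oplus>\<^bsub>A\<^esub> a', b) - (frag_of (a, b) + frag_of (a', b)) \<in> rels"
    using assms unfolding tensor_rels_def diff_diff_eq [symmetric] by blast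
  then have "I +>\<^bsub>P\<^esub> frag_of (a \<oplus>\<^bsub>A\<^esub> a', b) = I +>\<^bsub>P\<^esub> (frag_of (a, b) \<oplus>\<^bsub>P\<^esub> frag_of (a', b))"
    using assms rels_in_I P.a_closed [OF frag_of_closed frag_of_closed, of a b a' b]
    by (intro proj_eqI) (auto simp: frag_of_closed P_simps(3))
  then show ?thesis unfolding pure_eq using assms by (simp add: frag_of_closed)
qed

lemma pure_add_right:
  assumes "a \<in> carrier A" "b \<in> carrier B" "b' \<in> carrier B"
  shows "pure a (b \<oplus>\<^bsub>B\<^esub> b') = pure a b \<oplus>\<^bsub>T\<^esub> pure a b'"
proof -
  have "frag_of (a, b \<oplus>\<^bsub>B\<^esub> b') - (frag_of (a, b) + frag_of (a, b')) \<in> rels"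
    using assms unfolding tensor_rels_def diff_diff_eq [symmetric] by blast
  then have "I +>\<^bsub>P\<^esub> frag_of (a, b \<oplus>\<^bsub>B\<^esub> b') = I +>\<^bsub>P\<^esub> (frag_of (a, b) \<oplus>\<^bsub>P\<^esub> frag_of (a, b'))"
    using assms rels_in_I P.a_closed [OF frag_of_closed frag_of_closed, of a b a b']
    by (intro proj_eqI) (auto simp: frag_of_closed P_simps(3))
  then show ?thesis unfolding pure_eq using assms by (simp add: frag_of_closed)
qed

lemma pure_balanced:
  assumes "c \<in> carrier C" "a \<in> carrier A" "b \<in> carrier B"
  shows "pure (f c \<otimes>\<^bsub>A\<^esub> a) b = pure a (g c \<otimes>\<^bsub>B\<^esub> b)"
proof -
  have "frag_of (f c \<otimes>\<^bsub>A\<^esub> a, b) - frag_of (a, g c \<otimes>\<^bsub>B\<^esub> b) \<in> rels"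
    using assms unfolding tensor_rels_def by blast
  then show ?thesis
    unfolding pure_eq using assms rels_in_I f_closed g_closed
    by (intro proj_eqI) (auto simp: frag_of_closed)
qed

lemma pure_mult:
  assumes "a \<in> carrier A" "a' \<in> carrier A" "b \<in> carrier B" "b' \<in> carrier B"
  shows "pure a b \<otimes>\<^bsub>T\<^esub> pure a' b' = pure (a \<otimes>\<^bsub>A\<^esub> a') (b \<otimes>\<^bsub>B\<^esub> b')"
  unfolding pure_eq using assms
  by (simp add: frag_of_closed P_mult_frag_of flip: proj.hom_mult)

lemma pure_one: "pure \<one>\<^bsub>A\<^esub> \<one>\<^bsub>B\<^esub> = \<one>\<^bsub>T\<^esub>"
  unfolding pure_eq using proj.hom_one by (simp add: P_simps(4))

text \<open>Confines linearity proofs over the tensor ring to pure tensors; zero arises as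
  \<open>1 - 1\<close>, and negatives from the difference case.\<close>

lemma T_induct [consumes 1, case_names pure diff]:
  assumes t: "t \<in> carrier T"
    and pure: "\<And>a b. a \<in> carrier A \<Longrightarrow> b \<in> carrier B \<Longrightarrow> Q (pure a b)"
    and diff: "\<And>s t. s \<in> carrier T \<Longrightarrow> t \<in> carrier T \<Longrightarrow> Q s \<Longrightarrow> Q t \<Longrightarrow> Q (s \<ominus>\<^bsub>T\<^esub> t)"
  shows "Q t"
proof -
  have "t \<in> a_rcosets\<^bsub>P\<^esub> I" using t unfolding tensor_ring_def FactRing_simps .
  then obtain s where s: "s \<in> carrier P" "t = I +>\<^bsub>P\<^esub> s" unfolding A_RCOSETS_def' by blast
  have "Q (I +>\<^bsub>P\<^esub> s)"
    using s(1)
  proof (induction s rule: P_induct)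
    case zero
    have "pure \<one>\<^bsub>A\<^esub> \<one>\<^bsub>B\<^esub> \<ominus>\<^bsub>T\<^esub> pure \<one>\<^bsub>A\<^esub> \<one>\<^bsub>B\<^esub> = I +>\<^bsub>P\<^esub> 0"
      using proj.hom_zero by (simp add: pure_closed P_simps(2))
    then show ?case
      using diff [OF pure_closed pure_closed pure pure] by (metis A.one_closed B.one_closed)
  next
    case (one a b)
    then show ?case using pure by (simp add: pure_eq)
  next
    case (diff s t)
    then have "I +>\<^bsub>P\<^esub> (s - t) = (I +>\<^bsub>P\<^esub> s) \<ominus>\<^bsub>T\<^esub> (I +>\<^bsub>P\<^esub> t)"
      by (simp add: a_minus_def flip: P_minus_eq)
    then show ?case using assms(3) diff by simp
  qed
  then show ?thesis using s by simp
qed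

end

section \<open>Dual bases over power series\<close>

lemma (in abelian_group) eq_of_minus_eq_zero:
  assumes "x \<in> carrier G" "y \<in> carrier G" "x \<ominus> y = \<zero>"
  shows "x = y"
proof -
  have "x = (x \<ominus> y) \<oplus> y" using assms(1,2) by (simp add: a_minus_def a_assoc l_neg)
  then show ?thesis using assms by simp
qed

lemma (in abelian_group) add_minus_add_cancel:
  assumes "x \<in> carrier G" "y \<in> carrier G" "z \<in> carrier G"
  shows "(x \<oplus> y) \<ominus> (x \<oplus> z) = y \<ominus> z"
  using assms by (simp add: a_minus_def minus_add a_comm [of x y] a_assoc r_neg2)

lemma (in module) finsum_smult_rdistr:
  assumes "finite F" "x \<in> carrier M" "f \<in> F \<rightarrow> carrier R"
  shows "(\<Oplus>i\<in>F. f i) \<odot>\<^bsub>M\<^esub> x = (\<Oplus>\<^bsub>M\<^esub>i\<in>F. f i \<odot>\<^bsub>M\<^esub> x)"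
  using assms
proof (induction F rule: finite_induct)
  case (insert i F)
  then have "f \<in> F \<rightarrow> carrier R" "f i \<in> carrier R" by auto
  then show ?case using insert by (simp add: smult_l_distr Pi_iff)
qed simp

text \<open>The free module in \<open>projective_module\<close> is indexed by elements of the
  module, whereas \<open>m\<close> may repeat values. Coordinates with equal \<open>m i\<close> are
  therefore added up in \<open>c\<close>, which then splits the evaluation map on the image of
  \<open>m\<close>.\<close>

lemma dual_basis_imp_fin_gen_projective:
  assumes N: "module S N" and I: "finite I"
    and L: "\<And>i x. i \<in> I \<Longrightarrow> x \<in> carrier N \<Longrightarrow> L i x \<in> carrier S"
    and L_add: "\<And>i x y. i \<in> I \<Longrightarrow> x \<in> carrier N \<Longrightarrow> y \<in> carrier N \<Longrightarrow> L i (x \<oplus>\<^bsub>N\<^esub> y) = L i x \<oplus>\<^bsub>S\<^esub> L i y"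
    and L_smult: "\<And>i s x. i \<in> I \<Longrightarrow> s \<in> carrier S \<Longrightarrow> x \<in> carrier N \<Longrightarrow> L i (s \<odot>\<^bsub>N\<^esub> x) = s \<otimes>\<^bsub>S\<^esub> L i x"
    and m: "\<And>i. i \<in> I \<Longrightarrow> m i \<in> carrier N"
    and dual: "\<And>x. x \<in> carrier N \<Longrightarrow> x = (\<Oplus>\<^bsub>N\<^esub>i\<in>I. L i x \<odot>\<^bsub>N\<^esub> m i)"
  shows "fin_gen_module S N \<and> projective_module S N"
proof -
  interpret N: module S N by fact
  let ?B = "m ` I"
  define c where "c x b = (if b \<in> ?B then \<Oplus>\<^bsub>S\<^esub>i\<in>{i \<in> I. m i = b}. L i x else \<zero>\<^bsub>S\<^esub>)" for x b
  have cc: "c x b \<in> carrier S" if "x \<in> carrier N" for x b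
    using L that by (auto simp: c_def)
  have c_add: "c (x \<oplus>\<^bsub>N\<^esub> y) b = c x b \<oplus>\<^bsub>S\<^esub> c y b" if xy: "x \<in> carrier N" "y \<in> carrier N" for x y b
  proof (cases "b \<in> ?B")
    case True
    have "(\<Oplus>\<^bsub>S\<^esub>i\<in>{i \<in> I. m i = b}. L i (x \<oplus>\<^bsub>N\<^esub> y)) = (\<Oplus>\<^bsub>S\<^esub>i\<in>{i \<in> I. m i = b}. L i x \<oplus>\<^bsub>S\<^esub> L i y)"
      using xy L by (intro N.R.finsum_cong') (auto simp: L_add)
    also have "\<dots> = (\<Oplus>\<^bsub>S\<^esub>i\<in>{i \<in> I. m i = b}. L i x) \<oplus>\<^bsub>S\<^esub> (\<Oplus>\<^bsub>S\<^esub>i\<in>{i \<in> I. m i = b}. L i y)"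
      using xy L by (intro N.R.finsum_addf) auto
    finally show ?thesis using True by (simp add: c_def)
  qed (simp add: c_def)
  have c_smult: "c (s \<odot>\<^bsub>N\<^esub> x) b = s \<otimes>\<^bsub>S\<^esub> c x b" if xs: "x \<in> carrier N" "s \<in> carrier S" for x s b
  proof (cases "b \<in> ?B")
    case True
    have "(\<Oplus>\<^bsub>S\<^esub>i\<in>{i \<in> I. m i = b}. L i (s \<odot>\<^bsub>N\<^esub> x)) = (\<Oplus>\<^bsub>S\<^esub>i\<in>{i \<in> I. m i = b}. s \<otimes>\<^bsub>S\<^esub> L i x)"
      using xs L by (intro N.R.finsum_cong') (auto simp: L_smult)
    also have "\<dots> = s \<otimes>\<^bsub>S\<^esub> (\<Oplus>\<^bsub>S\<^esub>i\<in>{i \<in> I. m i = b}. L i x)"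
      using xs L I by (intro N.R.finsum_rdistr [symmetric]) auto
    finally show ?thesis using True by (simp add: c_def)
  qed (use xs in \<open>simp add: c_def\<close>)
  have sum: "x = (\<Oplus>\<^bsub>N\<^esub>b\<in>?B. c x b \<odot>\<^bsub>N\<^esub> b)" if x: "x \<in> carrier N" for x
  proof -
    have "(\<Oplus>\<^bsub>N\<^esub>b\<in>?B. c x b \<odot>\<^bsub>N\<^esub> b) = (\<Oplus>\<^bsub>N\<^esub>b\<in>?B. \<Oplus>\<^bsub>N\<^esub>i\<in>{i \<in> I. m i = b}. L i x \<odot>\<^bsub>N\<^esub> m i)"
    proof (rule N.finsum_cong' [OF refl])
      fix b assume b: "b \<in> ?B"
      then have bc: "b \<in> carrier N" using m by auto
      have "c x b \<odot>\<^bsub>N\<^esub> b = (\<Oplus>\<^bsub>N\<^esub>i\<in>{i \<in> I. m i = b}. L i x \<odot>\<^bsub>N\<^esub> b)"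
        unfolding c_def if_P [OF b] by (rule N.finsum_smult_rdistr) (use bc x L I in auto)
      also have "\<dots> = (\<Oplus>\<^bsub>N\<^esub>i\<in>{i \<in> I. m i = b}. L i x \<odot>\<^bsub>N\<^esub> m i)"
        using bc x L m by (intro N.finsum_cong') auto
      finally show "c x b \<odot>\<^bsub>N\<^esub> b = (\<Oplus>\<^bsub>N\<^esub>i\<in>{i \<in> I. m i = b}. L i x \<odot>\<^bsub>N\<^esub> m i)" .
    qed (use x L m in \<open>auto intro!: N.finsum_closed\<close>)
    also have "\<dots> = (\<Oplus>\<^bsub>N\<^esub>i\<in>(\<Union>b\<in>?B. {i \<in> I. m i = b}). L i x \<odot>\<^bsub>N\<^esub> m i)"
      using I x L m
      by (intro N.add.finprod_UN_disjoint [symmetric]) (auto simp: pairwise_def disjnt_def)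
    also have "(\<Union>b\<in>?B. {i \<in> I. m i = b}) = I" by auto
    finally show ?thesis using dual [OF x] by simp
  qed
  have B: "finite ?B" "?B \<subseteq> carrier N" using I m by auto
  have "fin_gen_module S N"
    unfolding fin_gen_module_def
  proof (intro conjI N exI [of _ ?B] B ballI)
    fix x assume "x \<in> carrier N"
    then show "\<exists>c\<in>?B \<rightarrow> carrier S. x = (\<Oplus>\<^bsub>N\<^esub>b\<in>?B. c b \<odot>\<^bsub>N\<^esub> b)"
      using sum cc by (intro bexI [of _ "c x"]) auto
  qed
  moreover have "projective_module S N"
    unfolding projective_module_def
  proof (intro conjI N exI ballI)
    have fs: "finite {b. c x b \<noteq> \<zero>\<^bsub>S\<^esub>}" "{b. c x b \<noteq> \<zero>\<^bsub>S\<^esub>} \<subseteq> ?B" for x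
      by (rule finite_subset [OF _ B(1)]) (auto simp: c_def)
    show "c \<in> mod_hom S N (free_module S ?B)"
      unfolding mod_hom_def free_module_def
      using fs by (auto simp: cc c_add c_smult fun_eq_iff)
    show "(\<lambda>c. \<Oplus>\<^bsub>N\<^esub>b\<in>?B. c b \<odot>\<^bsub>N\<^esub> b) \<in> mod_hom S (free_module S ?B) N"
      unfolding mod_hom_def
    proof (intro CollectI conjI ballI)
      have bN: "b \<in> carrier N" if "b \<in> ?B" for b using B that by auto
      show "(\<lambda>c. \<Oplus>\<^bsub>N\<^esub>b\<in>?B. c b \<odot>\<^bsub>N\<^esub> b) \<in> carrier (free_module S ?B) \<rightarrow> carrier N"
        using m by (auto simp: free_module_def intro!: N.finsum_closed)
      fix d assume "d \<in> carrier (free_module S ?B)"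
      then have d: "d b \<in> carrier S" for b by (simp add: free_module_def)
      {
        fix e assume "e \<in> carrier (free_module S ?B)"
        then have e: "e b \<in> carrier S" for b by (simp add: free_module_def)
        have "(\<Oplus>\<^bsub>N\<^esub>b\<in>?B. (d b \<oplus>\<^bsub>S\<^esub> e b) \<odot>\<^bsub>N\<^esub> b) = (\<Oplus>\<^bsub>N\<^esub>b\<in>?B. d b \<odot>\<^bsub>N\<^esub> b \<oplus>\<^bsub>N\<^esub> e b \<odot>\<^bsub>N\<^esub> b)"
          using d e bN by (intro N.finsum_cong') (auto simp: N.smult_l_distr)
        also have "\<dots> = (\<Oplus>\<^bsub>N\<^esub>b\<in>?B. d b \<odot>\<^bsub>N\<^esub> b) \<oplus>\<^bsub>N\<^esub> (\<Oplus>\<^bsub>N\<^esub>b\<in>?B. e b \<odot>\<^bsub>N\<^esub> b)"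
          using d e bN by (intro N.finsum_addf) auto
        finally show "(\<Oplus>\<^bsub>N\<^esub>b\<in>?B. (d \<oplus>\<^bsub>free_module S ?B\<^esub> e) b \<odot>\<^bsub>N\<^esub> b) =
          (\<Oplus>\<^bsub>N\<^esub>b\<in>?B. d b \<odot>\<^bsub>N\<^esub> b) \<oplus>\<^bsub>N\<^esub> (\<Oplus>\<^bsub>N\<^esub>b\<in>?B. e b \<odot>\<^bsub>N\<^esub> b)"
          by (simp add: free_module_def)
      }
      fix s assume s: "s \<in> carrier S"
      have "(\<Oplus>\<^bsub>N\<^esub>b\<in>?B. (s \<otimes>\<^bsub>S\<^esub> d b) \<odot>\<^bsub>N\<^esub> b) = (\<Oplus>\<^bsub>N\<^esub>b\<in>?B. s \<odot>\<^bsub>N\<^esub> (d b \<odot>\<^bsub>N\<^esub> b))"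
        using d s bN by (intro N.finsum_cong') (auto simp: N.smult_assoc1)
      also have "\<dots> = s \<odot>\<^bsub>N\<^esub> (\<Oplus>\<^bsub>N\<^esub>b\<in>?B. d b \<odot>\<^bsub>N\<^esub> b)"
        using B(1) d s bN by (intro N.finsum_smult_ldistr [symmetric]) auto
      finally show "(\<Oplus>\<^bsub>N\<^esub>b\<in>?B. (s \<odot>\<^bsub>free_module S ?B\<^esub> d) b \<odot>\<^bsub>N\<^esub> b) = s \<odot>\<^bsub>N\<^esub> (\<Oplus>\<^bsub>N\<^esub>b\<in>?B. d b \<odot>\<^bsub>N\<^esub> b)"
        by (simp add: free_module_def)
    qed
    fix x assume x: "x \<in> carrier N"
    show "(\<Oplus>\<^bsub>N\<^esub>b\<in>?B. c x b \<odot>\<^bsub>N\<^esub> b) = x" using sum [OF x] by simp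
  qed
  ultimately show ?thesis by blast
qed

section \<open>Lifting a dual basis to power series\<close>

context cring
begin

definition fps_shift :: "(nat \<Rightarrow> 'a) \<Rightarrow> nat \<Rightarrow> 'a"
  where "fps_shift f n = f (Suc n)"

lemma fps_const_mult_nth:
  assumes "a \<in> carrier R" "g \<in> UNIV \<rightarrow> carrier R"
  shows "(fps_const R a \<otimes>\<^bsub>fps_ring R\<^esub> g) n = a \<otimes> g n"
proof -
  have g: "g k \<in> carrier R" for k using assms by auto
  have "(fps_const R a \<otimes>\<^bsub>fps_ring R\<^esub> g) n = (\<Oplus>i\<in>{..n}. if 0 = i then a \<otimes> g (n - i) else \<zero>)"
    unfolding fps_ring_simps using assms g by (intro finsum_cong') (auto simp: fps_const_def)
  also have "\<dots> = a \<otimes> g (n - 0)"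
    using assms g by (intro add.finprod_singleton) auto
  finally show ?thesis by simp
qed

lemma fps_var_mult_nth:
  assumes "g \<in> UNIV \<rightarrow> carrier R"
  shows "(fps_var R \<otimes>\<^bsub>fps_ring R\<^esub> g) n = (if n = 0 then \<zero> else g (n - 1))"
proof -
  have g: "g k \<in> carrier R" for k using assms by auto
  have *: "(fps_var R \<otimes>\<^bsub>fps_ring R\<^esub> g) n = (\<Oplus>i\<in>{..n}. if 1 = i then g (n - i) else \<zero>)"
    unfolding fps_ring_simps using assms g by (intro finsum_cong') (auto simp: fps_var_def)
  show ?thesis
  proof (cases "n = 0")
    case True
    then show ?thesis unfolding * by simp
  next
    case False
    then have "(\<Oplus>i\<in>{..n}. if 1 = i then g (n - i) else \<zero>) = g (n - 1)"
      using g by (intro add.finprod_singleton) auto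
    then show ?thesis unfolding * using False by simp
  qed
qed

lemma fps_const_closed: "a \<in> carrier R \<Longrightarrow> fps_const R a \<in> carrier (fps_ring R)"
  by (auto simp: fps_const_def fps_ring_simps)

lemma fps_var_closed: "fps_var R \<in> carrier (fps_ring R)"
  by (auto simp: fps_var_def fps_ring_simps)

lemma fps_const_mult:
  assumes "a \<in> carrier R" "b \<in> carrier R"
  shows "fps_const R a \<otimes>\<^bsub>fps_ring R\<^esub> fps_const R b = fps_const R (a \<otimes> b)"
proof
  fix n
  show "(fps_const R a \<otimes>\<^bsub>fps_ring R\<^esub> fps_const R b) n = fps_const R (a \<otimes> b) n"
    using assms fps_const_closed [OF assms(2)]
    by (subst fps_const_mult_nth) (auto simp: fps_const_def fps_ring_simps(1))
qed

lemma fps_const_add: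
  "a \<in> carrier R \<Longrightarrow> b \<in> carrier R \<Longrightarrow> fps_const R a \<oplus>\<^bsub>fps_ring R\<^esub> fps_const R b = fps_const R (a \<oplus> b)"
  by (auto simp: fps_const_def fps_ring_simps)

lemma fps_decompose:
  assumes f: "f \<in> UNIV \<rightarrow> carrier R"
  shows "f = fps_const R (f 0) \<oplus>\<^bsub>fps_ring R\<^esub> fps_var R \<otimes>\<^bsub>fps_ring R\<^esub> fps_shift f"
proof
  fix n
  have f': "f k \<in> carrier R" for k using f by auto
  then have "fps_shift f \<in> UNIV \<rightarrow> carrier R" by (auto simp: fps_shift_def)
  then show "f n = (fps_const R (f 0) \<oplus>\<^bsub>fps_ring R\<^esub> fps_var R \<otimes>\<^bsub>fps_ring R\<^esub> fps_shift f) n"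
    unfolding fps_ring_simps(4) using f' by (simp add: fps_var_mult_nth) (simp add: fps_const_def fps_shift_def)
qed

text \<open>The dual basis is lifted explicitly: \<open>\<tau> x = \<Sum> \<lambda>\<^sub>i(x) m\<^sub>i\<close> agrees with \<open>x\<close> modulo \<open>u\<close>, the operator
  \<open>D x = (x - \<tau> x) / u\<close> is a left inverse of \<open>u\<close>, and \<open>\<Sum>\<^sub>n \<lambda>\<^sub>i(D\<^sup>n x) u\<^sup>n\<close> are the new coordinates.\<close>

lemma fps_dual_basis:
  assumes N: "module (fps_ring R) N"
  defines "U \<equiv> smult N (fps_var R)"
  assumes sep: "\<And>x. x \<in> carrier N \<Longrightarrow> (\<And>n. \<exists>y\<in>carrier N. x = (U ^^ n) y) \<Longrightarrow> x = \<zero>\<^bsub>N\<^esub>"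
    and tf: "\<And>x. x \<in> carrier N \<Longrightarrow> U x = \<zero>\<^bsub>N\<^esub> \<Longrightarrow> x = \<zero>\<^bsub>N\<^esub>"
    and I: "finite I"
    and l: "\<And>i x. i \<in> I \<Longrightarrow> x \<in> carrier N \<Longrightarrow> l i x \<in> carrier R"
    and l_add: "\<And>i x y. i \<in> I \<Longrightarrow> x \<in> carrier N \<Longrightarrow> y \<in> carrier N \<Longrightarrow> l i (x \<oplus>\<^bsub>N\<^esub> y) = l i x \<oplus> l i y"
    and l_smult: "\<And>i a x. i \<in> I \<Longrightarrow> a \<in> carrier R \<Longrightarrow> x \<in> carrier N \<Longrightarrow> l i (fps_const R a \<odot>\<^bsub>N\<^esub> x) = a \<otimes> l i x"
    and l_U: "\<And>i x. i \<in> I \<Longrightarrow> x \<in> carrier N \<Longrightarrow> l i (U x) = \<zero>"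
    and m: "\<And>i. i \<in> I \<Longrightarrow> m i \<in> carrier N"
    and dual: "\<And>x. x \<in> carrier N \<Longrightarrow> \<exists>y\<in>carrier N. x = (\<Oplus>\<^bsub>N\<^esub>i\<in>I. fps_const R (l i x) \<odot>\<^bsub>N\<^esub> m i) \<oplus>\<^bsub>N\<^esub> U y"
  shows "fin_gen_module (fps_ring R) N \<and> projective_module (fps_ring R) N"
proof -
  interpret N: module "fps_ring R" N by fact
  let ?c = "fps_const R" and ?S = "fps_ring R"
  note cc = fps_const_closed and vc = fps_var_closed
  have Uc [simp]: "U x \<in> carrier N" if "x \<in> carrier N" for x using that vc by (simp add: U_def)
  have U_add: "U (x \<oplus>\<^bsub>N\<^esub> y) = U x \<oplus>\<^bsub>N\<^esub> U y" if "x \<in> carrier N" "y \<in> carrier N" for x y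
    using that vc by (simp add: U_def N.smult_r_distr)
  have U_minus: "U (\<ominus>\<^bsub>N\<^esub> x) = \<ominus>\<^bsub>N\<^esub> U x" if "x \<in> carrier N" for x
    using that vc by (simp add: U_def N.smult_r_minus)
  have U_smult: "U (s \<odot>\<^bsub>N\<^esub> x) = s \<odot>\<^bsub>N\<^esub> U x" if "x \<in> carrier N" "s \<in> carrier ?S" for x s
    using that vc by (simp add: U_def N.R.m_comm flip: N.smult_assoc1)
  have U_inj: "x = y" if "x \<in> carrier N" "y \<in> carrier N" "U x = U y" for x y
  proof -
    have "U (x \<ominus>\<^bsub>N\<^esub> y) = \<zero>\<^bsub>N\<^esub>"
      using that by (simp add: a_minus_def U_add U_minus N.r_neg)
    then have "x \<ominus>\<^bsub>N\<^esub> y = \<zero>\<^bsub>N\<^esub>" using tf that by simp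
    then show ?thesis using N.eq_of_minus_eq_zero that by blast
  qed
  define \<tau> where "\<tau> x = (\<Oplus>\<^bsub>N\<^esub>i\<in>I. ?c (l i x) \<odot>\<^bsub>N\<^esub> m i)" for x
  have \<tau>c [simp]: "\<tau> x \<in> carrier N" if "x \<in> carrier N" for x
    unfolding \<tau>_def using that l m cc by (intro N.finsum_closed) auto
  have \<tau>_add: "\<tau> (x \<oplus>\<^bsub>N\<^esub> y) = \<tau> x \<oplus>\<^bsub>N\<^esub> \<tau> y" if xy: "x \<in> carrier N" "y \<in> carrier N" for x y
  proof -
    have "\<tau> (x \<oplus>\<^bsub>N\<^esub> y) = (\<Oplus>\<^bsub>N\<^esub>i\<in>I. ?c (l i x) \<odot>\<^bsub>N\<^esub> m i \<oplus>\<^bsub>N\<^esub> ?c (l i y) \<odot>\<^bsub>N\<^esub> m i)"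
      unfolding \<tau>_def using xy l m cc
      by (intro N.finsum_cong') (auto simp: l_add N.smult_l_distr simp flip: fps_const_add)
    also have "\<dots> = \<tau> x \<oplus>\<^bsub>N\<^esub> \<tau> y"
      unfolding \<tau>_def using xy l m cc by (intro N.finsum_addf) auto
    finally show ?thesis .
  qed
  have \<tau>_smult: "\<tau> (?c a \<odot>\<^bsub>N\<^esub> x) = ?c a \<odot>\<^bsub>N\<^esub> \<tau> x" if xa: "x \<in> carrier N" "a \<in> carrier R" for x a
  proof -
    have "\<tau> (?c a \<odot>\<^bsub>N\<^esub> x) = (\<Oplus>\<^bsub>N\<^esub>i\<in>I. ?c a \<odot>\<^bsub>N\<^esub> (?c (l i x) \<odot>\<^bsub>N\<^esub> m i))"
      unfolding \<tau>_def using xa l m cc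
      by (intro N.finsum_cong') (auto simp: l_smult N.smult_assoc1 simp flip: fps_const_mult)
    also have "\<dots> = ?c a \<odot>\<^bsub>N\<^esub> \<tau> x"
      unfolding \<tau>_def using xa l m cc I by (intro N.finsum_smult_ldistr [symmetric]) auto
    finally show ?thesis .
  qed
  have c0: "?c \<zero> = \<zero>\<^bsub>?S\<^esub>" by (auto simp: fps_const_def fps_ring_simps)
  have \<tau>_U: "\<tau> (U x) = \<zero>\<^bsub>N\<^esub>" if "x \<in> carrier N" for x
    unfolding \<tau>_def using that m by (intro N.add.finprod_one_eqI) (simp add: l_U c0)
  have "\<forall>x\<in>carrier N. \<exists>y\<in>carrier N. x = \<tau> x \<oplus>\<^bsub>N\<^esub> U y" using dual by (simp add: \<tau>_def)
  then obtain D where Dc [simp]: "\<And>x. x \<in> carrier N \<Longrightarrow> D x \<in> carrier N"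
    and D: "\<And>x. x \<in> carrier N \<Longrightarrow> x = \<tau> x \<oplus>\<^bsub>N\<^esub> U (D x)" by metis
  \<comment> \<open>Injectivity of \<open>U\<close> makes the decomposition unique; additivity of
    \<open>D\<close>, its linearity over constants and \<open>D (U x) = x\<close> all
    follow.\<close>
  have D_eqI: "D x = y" if "x \<in> carrier N" "y \<in> carrier N" "x = \<tau> x \<oplus>\<^bsub>N\<^esub> U y" for x y
  proof (rule U_inj)
    have "\<tau> x \<oplus>\<^bsub>N\<^esub> U (D x) = \<tau> x \<oplus>\<^bsub>N\<^esub> U y" using D that by metis
    then show "U (D x) = U y" using that(1,2) by simp
  qed (use that in simp_all)
  have D_add: "D (x \<oplus>\<^bsub>N\<^esub> y) = D x \<oplus>\<^bsub>N\<^esub> D y" if "x \<in> carrier N" "y \<in> carrier N" for x y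
  proof (rule D_eqI)
    have "x \<oplus>\<^bsub>N\<^esub> y = (\<tau> x \<oplus>\<^bsub>N\<^esub> U (D x)) \<oplus>\<^bsub>N\<^esub> (\<tau> y \<oplus>\<^bsub>N\<^esub> U (D y))" using D that by metis
    also have "\<dots> = \<tau> (x \<oplus>\<^bsub>N\<^esub> y) \<oplus>\<^bsub>N\<^esub> U (D x \<oplus>\<^bsub>N\<^esub> D y)"
      using that by (simp add: \<tau>_add U_add N.a_ac)
    finally show "x \<oplus>\<^bsub>N\<^esub> y = \<tau> (x \<oplus>\<^bsub>N\<^esub> y) \<oplus>\<^bsub>N\<^esub> U (D x \<oplus>\<^bsub>N\<^esub> D y)" .
  qed (use that in simp_all)
  have D_smult: "D (?c a \<odot>\<^bsub>N\<^esub> x) = ?c a \<odot>\<^bsub>N\<^esub> D x" if "x \<in> carrier N" "a \<in> carrier R" for x a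
  proof (rule D_eqI)
    have "?c a \<odot>\<^bsub>N\<^esub> x = ?c a \<odot>\<^bsub>N\<^esub> (\<tau> x \<oplus>\<^bsub>N\<^esub> U (D x))" using D that by metis
    also have "\<dots> = \<tau> (?c a \<odot>\<^bsub>N\<^esub> x) \<oplus>\<^bsub>N\<^esub> U (?c a \<odot>\<^bsub>N\<^esub> D x)"
      using that cc by (simp add: \<tau>_smult U_smult N.smult_r_distr)
    finally show "?c a \<odot>\<^bsub>N\<^esub> x = \<tau> (?c a \<odot>\<^bsub>N\<^esub> x) \<oplus>\<^bsub>N\<^esub> U (?c a \<odot>\<^bsub>N\<^esub> D x)" .
  qed (use that cc in simp_all)
  have D_U: "D (U x) = x" if "x \<in> carrier N" for x
    by (rule D_eqI) (use that in \<open>simp_all add: \<tau>_U\<close>)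
  define L where "L i x n = l i ((D ^^ n) x)" for i x n
  have Dn: "(D ^^ n) x \<in> carrier N" if "x \<in> carrier N" for n x
    by (induction n) (use that in simp_all)
  have Lc: "L i x n \<in> carrier R" if "i \<in> I" "x \<in> carrier N" for i x n
    unfolding L_def using that Dn l by simp
  have Dn_add: "(D ^^ n) (x \<oplus>\<^bsub>N\<^esub> y) = (D ^^ n) x \<oplus>\<^bsub>N\<^esub> (D ^^ n) y" if "x \<in> carrier N" "y \<in> carrier N" for n x y
    by (induction n) (use that Dn in \<open>simp_all add: D_add\<close>)
  have Dn_smult: "(D ^^ n) (?c a \<odot>\<^bsub>N\<^esub> x) = ?c a \<odot>\<^bsub>N\<^esub> (D ^^ n) x" if "x \<in> carrier N" "a \<in> carrier R" for n x a
    by (induction n) (use that Dn in \<open>simp_all add: D_smult\<close>)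
  have L_add: "L i (x \<oplus>\<^bsub>N\<^esub> y) n = L i x n \<oplus> L i y n" if "i \<in> I" "x \<in> carrier N" "y \<in> carrier N" for i x y n
    unfolding L_def using that Dn by (simp add: Dn_add l_add)
  have L_Suc: "L i x (Suc n) = L i (D x) n" for i x n
    by (simp add: L_def funpow_swap1)
  \<comment> \<open>A power series is its constant term plus the variable times its shift, and the
    action inherits this.\<close>
  have decomp: "f \<odot>\<^bsub>N\<^esub> x = ?c (f 0) \<odot>\<^bsub>N\<^esub> x \<oplus>\<^bsub>N\<^esub> U (fps_shift f \<odot>\<^bsub>N\<^esub> x)"
    and shc: "fps_shift f \<in> carrier ?S" and f0: "f 0 \<in> carrier R"
    if "f \<in> carrier ?S" "x \<in> carrier N" for f x
  proof -
    show sh: "fps_shift f \<in> carrier ?S" and f0: "f 0 \<in> carrier R"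
      using that by (auto simp: fps_shift_def fps_ring_simps)
    have "f \<odot>\<^bsub>N\<^esub> x = (?c (f 0) \<oplus>\<^bsub>?S\<^esub> fps_var R \<otimes>\<^bsub>?S\<^esub> fps_shift f) \<odot>\<^bsub>N\<^esub> x"
      using fps_decompose [of f] that by (simp add: fps_ring_simps(1))
    also have "\<dots> = ?c (f 0) \<odot>\<^bsub>N\<^esub> x \<oplus>\<^bsub>N\<^esub> U (fps_shift f \<odot>\<^bsub>N\<^esub> x)"
      unfolding U_def using sh f0 cc vc that by (simp add: N.smult_l_distr N.smult_assoc1)
    finally show "f \<odot>\<^bsub>N\<^esub> x = ?c (f 0) \<odot>\<^bsub>N\<^esub> x \<oplus>\<^bsub>N\<^esub> U (fps_shift f \<odot>\<^bsub>N\<^esub> x)" .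
  qed
  \<comment> \<open>This convolution is linearity over power series. The induction rests on
    \<open>D (f x) = f 0 D x + (shift f) x\<close>.\<close>
  have L_smult: "L i (f \<odot>\<^bsub>N\<^esub> x) n = (\<Oplus>k\<in>{..n}. f k \<otimes> L i x (n - k))"
    if "i \<in> I" "f \<in> carrier ?S" "x \<in> carrier N" for i f x n
    using that
  proof (induction n arbitrary: f x)
    case 0
    have "L i (f \<odot>\<^bsub>N\<^esub> x) 0 = f 0 \<otimes> l i x"
      unfolding L_def decomp [OF 0(2,3)]
      using 0 shc [OF 0(2,3)] f0 [OF 0(2,3)] cc l by (simp add: l_add l_smult l_U)
    then show ?case using 0 f0 [OF 0(2,3)] l by (simp add: L_def)
  next
    case (Suc n)
    note sh = shc [OF Suc.prems(2,3)] and f0 = f0 [OF Suc.prems(2,3)]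
    have fk: "f k \<in> carrier R" for k using Suc.prems(2) by (auto simp: fps_ring_simps)
    have "D (f \<odot>\<^bsub>N\<^esub> x) = ?c (f 0) \<odot>\<^bsub>N\<^esub> D x \<oplus>\<^bsub>N\<^esub> fps_shift f \<odot>\<^bsub>N\<^esub> x"
      unfolding decomp [OF Suc.prems(2,3)] using Suc.prems sh f0 cc by (simp add: D_add D_smult D_U)
    then have "L i (f \<odot>\<^bsub>N\<^esub> x) (Suc n) = L i (?c (f 0) \<odot>\<^bsub>N\<^esub> D x) n \<oplus> L i (fps_shift f \<odot>\<^bsub>N\<^esub> x) n"
      unfolding L_Suc using Suc.prems sh f0 cc by (simp add: L_add)
    also have "L i (?c (f 0) \<odot>\<^bsub>N\<^esub> D x) n = f 0 \<otimes> L i x (Suc n)"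
      unfolding L_Suc unfolding L_def using Suc.prems f0 Dn by (simp add: Dn_smult l_smult)
    also have "L i (fps_shift f \<odot>\<^bsub>N\<^esub> x) n = (\<Oplus>k\<in>{..n}. f (Suc k) \<otimes> L i x (n - k))"
      unfolding Suc.IH [OF Suc.prems(1) sh Suc.prems(3)] by (simp only: fps_shift_def)
    also have "f 0 \<otimes> L i x (Suc n) \<oplus> (\<Oplus>k\<in>{..n}. f (Suc k) \<otimes> L i x (n - k)) = (\<Oplus>k\<in>{..Suc n}. f k \<otimes> L i x (Suc n - k))"
      using Suc.prems fk Lc by (subst finsum_Suc2) (auto simp: a_comm)
    finally show ?case .
  qed
  have LS: "L i x \<in> carrier ?S" if "i \<in> I" "x \<in> carrier N" for i x
    using Lc that by (auto simp: fps_ring_simps)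
  define Q where "Q x = (\<Oplus>\<^bsub>N\<^esub>i\<in>I. L i x \<odot>\<^bsub>N\<^esub> m i)" for x
  have Qc [simp]: "Q x \<in> carrier N" if "x \<in> carrier N" for x
    unfolding Q_def using that LS m by (intro N.finsum_closed) auto
  have Q: "Q x = \<tau> x \<oplus>\<^bsub>N\<^esub> U (Q (D x))" if x: "x \<in> carrier N" for x
  proof -
    have sh: "fps_shift (L i x) = L i (D x)" for i by (auto simp: fps_shift_def L_Suc)
    have "Q x = (\<Oplus>\<^bsub>N\<^esub>i\<in>I. ?c (l i x) \<odot>\<^bsub>N\<^esub> m i \<oplus>\<^bsub>N\<^esub> U (L i (D x) \<odot>\<^bsub>N\<^esub> m i))"
      unfolding Q_def
    proof (rule N.finsum_cong' [OF refl])
      fix i assume i: "i \<in> I"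
      have "L i x 0 = l i x" by (simp add: L_def)
      then show "L i x \<odot>\<^bsub>N\<^esub> m i = ?c (l i x) \<odot>\<^bsub>N\<^esub> m i \<oplus>\<^bsub>N\<^esub> U (L i (D x) \<odot>\<^bsub>N\<^esub> m i)"
        using decomp [OF LS [OF i x] m [OF i]] by (simp add: sh)
    qed (use x LS m l cc in auto)
    also have "\<dots> = \<tau> x \<oplus>\<^bsub>N\<^esub> (\<Oplus>\<^bsub>N\<^esub>i\<in>I. U (L i (D x) \<odot>\<^bsub>N\<^esub> m i))"
      unfolding \<tau>_def using x LS m l cc by (intro N.finsum_addf) auto
    also have "(\<Oplus>\<^bsub>N\<^esub>i\<in>I. U (L i (D x) \<odot>\<^bsub>N\<^esub> m i)) = U (Q (D x))"
      unfolding U_def Q_def using x LS m vc I by (intro N.finsum_smult_ldistr [symmetric]) auto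
    finally show ?thesis .
  qed
  \<comment> \<open>The defect at \<open>x\<close> is \<open>U\<close> of the defect at
    \<open>D x\<close>; iterating puts it in the image of every power of \<open>U\<close>, where
    separatedness makes it 0.\<close>
  have step: "x \<ominus>\<^bsub>N\<^esub> Q x = U (D x \<ominus>\<^bsub>N\<^esub> Q (D x))" if x: "x \<in> carrier N" for x
  proof -
    have "x \<ominus>\<^bsub>N\<^esub> Q x = (\<tau> x \<oplus>\<^bsub>N\<^esub> U (D x)) \<ominus>\<^bsub>N\<^esub> (\<tau> x \<oplus>\<^bsub>N\<^esub> U (Q (D x)))"
      using D [OF x] Q [OF x] by simp
    also have "\<dots> = U (D x) \<ominus>\<^bsub>N\<^esub> U (Q (D x))"
      using x by (intro N.add_minus_add_cancel) simp_all
    also have "\<dots> = U (D x \<ominus>\<^bsub>N\<^esub> Q (D x))"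
      using x by (simp add: a_minus_def U_add U_minus)
    finally show ?thesis .
  qed
  have "x \<ominus>\<^bsub>N\<^esub> Q x = (U ^^ n) ((D ^^ n) x \<ominus>\<^bsub>N\<^esub> Q ((D ^^ n) x))" if "x \<in> carrier N" for x n
    by (induction n) (use that step Dn in \<open>simp_all add: funpow_swap1\<close>)
  then have "x \<ominus>\<^bsub>N\<^esub> Q x = \<zero>\<^bsub>N\<^esub>" if "x \<in> carrier N" for x
    using that Dn by (intro sep) (auto intro!: bexI [of _ "(D ^^ _) x \<ominus>\<^bsub>N\<^esub> Q ((D ^^ _) x)"])
  then have dual': "x = (\<Oplus>\<^bsub>N\<^esub>i\<in>I. L i x \<odot>\<^bsub>N\<^esub> m i)" if "x \<in> carrier N" for x
    using N.eq_of_minus_eq_zero [OF that Qc [OF that]] that by (simp add: Q_def)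
  show ?thesis
    by (rule dual_basis_imp_fin_gen_projective [OF N I LS _ _ m dual'])
      (auto simp: fps_ring_simps L_add L_smult fun_eq_iff)
qed

end

text \<open>A dual basis of the quotient of \<open>V\<close> by \<open>N\<close>, with the basis lifted to \<open>V\<close> and the coordinate
  functionals inflated to \<open>V\<close>.\<close>

definition dual_basis_mod ::
    "('r, 'c) ring_scheme \<Rightarrow> ('r, 'm) module \<Rightarrow> 'm set \<Rightarrow> 'i set \<Rightarrow> ('i \<Rightarrow> 'm \<Rightarrow> 'r) \<Rightarrow> ('i \<Rightarrow> 'm) \<Rightarrow> bool"
  where "dual_basis_mod R V N I L m \<longleftrightarrow> finite I \<and> (\<forall>i\<in>I. m i \<in> carrier V) \<and>
    (\<forall>i\<in>I. \<forall>x\<in>carrier V. L i x \<in> carrier R) \<and>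
    (\<forall>i\<in>I. \<forall>x\<in>carrier V. \<forall>y\<in>carrier V. L i (x \<oplus>\<^bsub>V\<^esub> y) = L i x \<oplus>\<^bsub>R\<^esub> L i y) \<and>
    (\<forall>i\<in>I. \<forall>r\<in>carrier R. \<forall>x\<in>carrier V. L i (r \<odot>\<^bsub>V\<^esub> x) = r \<otimes>\<^bsub>R\<^esub> L i x) \<and>
    (\<forall>i\<in>I. \<forall>x\<in>N. L i x = \<zero>\<^bsub>R\<^esub>) \<and>
    (\<forall>x\<in>carrier V. x \<ominus>\<^bsub>V\<^esub> (\<Oplus>\<^bsub>V\<^esub>i\<in>I. L i x \<odot>\<^bsub>V\<^esub> m i) \<in> N)"

text \<open>The coordinates of the splitting \<open>s\<close> are the functionals. On a finite
  generating set \<open>s\<close> involves finitely many indices, and by linearity no other index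
  occurs on the whole module.\<close>

lemma projective_imp_dual_basis:
  fixes P :: "('r, 'm) module"
  assumes fg: "fin_gen_module R P" and proj: "projective_module R P"
  obtains I :: "'m set" and L m where "dual_basis_mod R P {\<zero>\<^bsub>P\<^esub>} I L m"
proof -
  interpret P: module R P using fg by (simp add: fin_gen_module_def)
  obtain G where G: "finite G" "G \<subseteq> carrier P"
    "\<And>x. x \<in> carrier P \<Longrightarrow> \<exists>c\<in>G \<rightarrow> carrier R. x = (\<Oplus>\<^bsub>P\<^esub>b\<in>G. c b \<odot>\<^bsub>P\<^esub> b)"
    using fg by (auto simp: fin_gen_module_def)
  obtain B :: "'m set" and s q where s: "s \<in> mod_hom R P (free_module R B)"
    and q: "q \<in> mod_hom R (free_module R B) P" and qs: "\<And>x. x \<in> carrier P \<Longrightarrow> q (s x) = x"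
    using proj by (auto simp: projective_module_def)
  let ?F = "free_module R B"
  have F: "carrier ?F = {c. (\<forall>x. c x \<in> carrier R) \<and> {x. c x \<noteq> \<zero>\<^bsub>R\<^esub>} \<subseteq> B \<and> finite {x. c x \<noteq> \<zero>\<^bsub>R\<^esub>}}"
    "c \<oplus>\<^bsub>?F\<^esub> d = (\<lambda>x. c x \<oplus>\<^bsub>R\<^esub> d x)" "r \<odot>\<^bsub>?F\<^esub> c = (\<lambda>x. r \<otimes>\<^bsub>R\<^esub> c x)" for c d r
    by (simp_all add: free_module_def)
  have sF: "s x \<in> carrier ?F" if "x \<in> carrier P" for x using s that by (auto simp: mod_hom_def)
  have s_add: "s (x \<oplus>\<^bsub>P\<^esub> y) b = s x b \<oplus>\<^bsub>R\<^esub> s y b" if "x \<in> carrier P" "y \<in> carrier P" for x y b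
    using s that by (simp add: mod_hom_def F(2))
  have s_smult: "s (r \<odot>\<^bsub>P\<^esub> x) b = r \<otimes>\<^bsub>R\<^esub> s x b" if "x \<in> carrier P" "r \<in> carrier R" for x r b
    using s that by (simp add: mod_hom_def F(3))
  have sc: "s x b \<in> carrier R" if "x \<in> carrier P" for x b using sF [OF that] by (simp add: F)
  have s_zero: "s \<zero>\<^bsub>P\<^esub> b = \<zero>\<^bsub>R\<^esub>" for b
    using s_add [of "\<zero>\<^bsub>P\<^esub>" "\<zero>\<^bsub>P\<^esub>" b] sc [of "\<zero>\<^bsub>P\<^esub>" b] by simp
  define I where "I = (\<Union>g\<in>G. {b. s g b \<noteq> \<zero>\<^bsub>R\<^esub>})"
  have I: "finite I" "I \<subseteq> B"
  proof -
    have "finite {b. s g b \<noteq> \<zero>\<^bsub>R\<^esub>} \<and> {b. s g b \<noteq> \<zero>\<^bsub>R\<^esub>} \<subseteq> B" if "g \<in> G" for g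
      using sF [of g] G(2) that by (auto simp: F)
    then show "finite I" "I \<subseteq> B" unfolding I_def using G(1) by blast+
  qed
  have s_supp: "s x b = \<zero>\<^bsub>R\<^esub>" if x: "x \<in> carrier P" and b: "b \<notin> I" for x b
  proof -
    obtain c where c: "c \<in> G \<rightarrow> carrier R" "x = (\<Oplus>\<^bsub>P\<^esub>g\<in>G. c g \<odot>\<^bsub>P\<^esub> g)" using G(3) [OF x] by blast
    have "s (\<Oplus>\<^bsub>P\<^esub>g\<in>H. c g \<odot>\<^bsub>P\<^esub> g) b = \<zero>\<^bsub>R\<^esub>" if "H \<subseteq> G" for H
      using finite_subset [OF that G(1)] that
    proof (induction H rule: finite_induct)
      case (insert g H)
      have "g \<in> carrier P" "c g \<in> carrier R" using insert G(2) c(1) by auto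
      moreover have "(\<lambda>g. c g \<odot>\<^bsub>P\<^esub> g) \<in> H \<rightarrow> carrier P" using insert G(2) c(1) by auto
      moreover have "s g b = \<zero>\<^bsub>R\<^esub>" using b insert by (auto simp: I_def)
      ultimately show ?case using insert by (simp add: s_add s_smult)
    qed (simp add: s_zero)
    then show ?thesis using c(2) by simp
  qed
  define e where "e b = (\<lambda>x. if x = b then \<one>\<^bsub>R\<^esub> else \<zero>\<^bsub>R\<^esub>)" for b :: 'm
  have e: "e b \<in> carrier ?F" if "b \<in> B" for b
    using that finite_subset [of "{x. e b x \<noteq> \<zero>\<^bsub>R\<^esub>}" "{b}"] by (auto simp: F e_def split: if_splits)
  have q_add: "q (c \<oplus>\<^bsub>?F\<^esub> d) = q c \<oplus>\<^bsub>P\<^esub> q d" if "c \<in> carrier ?F" "d \<in> carrier ?F" for c d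
    using q that by (simp add: mod_hom_def)
  have q_smult: "q (r \<odot>\<^bsub>?F\<^esub> c) = r \<odot>\<^bsub>P\<^esub> q c" if "c \<in> carrier ?F" "r \<in> carrier R" for c r
    using q that by (simp add: mod_hom_def)
  have qP: "q c \<in> carrier P" if "c \<in> carrier ?F" for c using q that by (auto simp: mod_hom_def)
  have qsum: "q c = (\<Oplus>\<^bsub>P\<^esub>b\<in>J. c b \<odot>\<^bsub>P\<^esub> q (e b))"
    if J: "finite J" "J \<subseteq> B" "\<And>b. c b \<in> carrier R" "{b. c b \<noteq> \<zero>\<^bsub>R\<^esub>} \<subseteq> J" for J c
    using that
  proof (induction J arbitrary: c rule: finite_induct)
    case empty
    then have c: "c = (\<lambda>x. \<zero>\<^bsub>R\<^esub>)" by auto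
    have "c \<in> carrier ?F" "c \<oplus>\<^bsub>?F\<^esub> c = c" by (simp_all add: c F)
    then have "q c \<oplus>\<^bsub>P\<^esub> q c = q c" "q c \<in> carrier P" using q_add [of c c] qP by simp_all
    then show ?case by simp
  next
    case (insert b J)
    let ?d = "\<lambda>x. if x = b then \<zero>\<^bsub>R\<^esub> else c x"
    have bB: "b \<in> B" using insert by simp
    have d: "?d \<in> carrier ?F"
    proof -
      have "{x. ?d x \<noteq> \<zero>\<^bsub>R\<^esub>} \<subseteq> J" using insert by auto
      then show ?thesis using insert finite_subset [of _ J] by (auto simp: F)
    qed
    have "r \<odot>\<^bsub>?F\<^esub> e b \<in> carrier ?F" if "r \<in> carrier R" for r
      using that bB finite_subset [of "{x. (r \<odot>\<^bsub>?F\<^esub> e b) x \<noteq> \<zero>\<^bsub>R\<^esub>}" "{b}"] by (auto simp: F e_def split: if_splits)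
    then have cb: "c b \<odot>\<^bsub>?F\<^esub> e b \<in> carrier ?F" using insert by simp
    have "c = (c b \<odot>\<^bsub>?F\<^esub> e b) \<oplus>\<^bsub>?F\<^esub> ?d"
      using insert.prems(2) by (auto simp: F e_def)
    then have "q c = c b \<odot>\<^bsub>P\<^esub> q (e b) \<oplus>\<^bsub>P\<^esub> q ?d"
      using q_add [OF cb d] q_smult [OF e [OF bB] insert.prems(2)] by metis
    also have "q ?d = (\<Oplus>\<^bsub>P\<^esub>x\<in>J. ?d x \<odot>\<^bsub>P\<^esub> q (e x))"
      using insert.prems by (intro insert.IH) (auto split: if_splits)
    also have "\<dots> = (\<Oplus>\<^bsub>P\<^esub>x\<in>J. c x \<odot>\<^bsub>P\<^esub> q (e x))"
      using insert e qP by (intro P.finsum_cong') auto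
    also have "c b \<odot>\<^bsub>P\<^esub> q (e b) \<oplus>\<^bsub>P\<^esub> \<dots> = (\<Oplus>\<^bsub>P\<^esub>x\<in>insert b J. c x \<odot>\<^bsub>P\<^esub> q (e x))"
      using insert e qP by (subst P.finsum_insert) auto
    finally show ?case .
  qed
  have "x \<ominus>\<^bsub>P\<^esub> (\<Oplus>\<^bsub>P\<^esub>i\<in>I. s x i \<odot>\<^bsub>P\<^esub> q (e i)) = \<zero>\<^bsub>P\<^esub>" if x: "x \<in> carrier P" for x
  proof -
    have "{b. s x b \<noteq> \<zero>\<^bsub>R\<^esub>} \<subseteq> I" using s_supp [OF x] by blast
    then have "x = (\<Oplus>\<^bsub>P\<^esub>i\<in>I. s x i \<odot>\<^bsub>P\<^esub> q (e i))"
      using qsum [OF I sc [OF x]] qs [OF x] by simp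
    then show ?thesis using x by (simp add: a_minus_def P.r_neg)
  qed
  moreover have "q (e i) \<in> carrier P" if "i \<in> I" for i using e qP I(2) that by blast
  ultimately have "dual_basis_mod R P {\<zero>\<^bsub>P\<^esub>} I (\<lambda>i x. s x i) (\<lambda>i. q (e i))"
    unfolding dual_basis_mod_def using I(1) by (simp add: sc s_add s_smult s_zero)
  then show ?thesis by (rule that)
qed

text \<open>Functionals are composed with the class map and basis elements are lifted arbitrarily;
  the identity in the quotient becomes a congruence modulo \<open>N\<close>.\<close>

lemma quotient_dual_basis:
  fixes V :: "('r, 'm) module"
  assumes V: "module R V" and sub: "subgroup N (add_monoid V)"
    and smult: "\<And>r n. r \<in> carrier R \<Longrightarrow> n \<in> N \<Longrightarrow> r \<odot>\<^bsub>V\<^esub> n \<in> N"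
    and fg: "fin_gen_module R (quot_module V N)" and proj: "projective_module R (quot_module V N)"
  obtains I :: "'m set set" and L m where "dual_basis_mod R V N I L m"
proof -
  interpret V: module R V by fact
  interpret N: abelian_subgroup N V
    by (rule abelian_subgroupI3) (use sub V.abelian_group_axioms in \<open>simp_all add: additive_subgroup_def\<close>)
  let ?Q = "quot_module V N"
  interpret Q: module R ?Q using fg by (simp add: fin_gen_module_def)
  let ?cl = "\<lambda>x. N +>\<^bsub>V\<^esub> x"
  have Qc: "carrier ?Q = a_rcosets\<^bsub>V\<^esub> N" and Q0: "\<zero>\<^bsub>?Q\<^esub> = N"
    and Qadd: "\<And>C D. C \<oplus>\<^bsub>?Q\<^esub> D = C <+>\<^bsub>V\<^esub> D"
    and Qsm: "\<And>r C. r \<odot>\<^bsub>?Q\<^esub> C = (\<Union>x\<in>C. N +>\<^bsub>V\<^esub> (r \<odot>\<^bsub>V\<^esub> x))"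
    by (simp_all add: quot_module_def)
  have cl: "?cl x \<in> carrier ?Q" if "x \<in> carrier V" for x
    unfolding Qc A_RCOSETS_def' using that by blast
  have cl_ex: "\<exists>x\<in>carrier V. C = ?cl x" if "C \<in> carrier ?Q" for C
    using that unfolding Qc A_RCOSETS_def' by blast
  have cl_add: "?cl (x \<oplus>\<^bsub>V\<^esub> y) = ?cl x \<oplus>\<^bsub>?Q\<^esub> ?cl y" if "x \<in> carrier V" "y \<in> carrier V" for x y
    unfolding Qadd using N.a_rcos_sum that by simp
  have NX: "n \<in> carrier V" if "n \<in> N" for n using that N.a_subset by blast
  have cl_N: "?cl n = \<zero>\<^bsub>?Q\<^esub>" if "n \<in> N" for n unfolding Q0 using that N.a_rcos_const by blast
  have cl_smult: "?cl (r \<odot>\<^bsub>V\<^esub> x) = r \<odot>\<^bsub>?Q\<^esub> ?cl x" if r: "r \<in> carrier R" and x: "x \<in> carrier V" for r x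
  proof -
    \<comment> \<open>The action on a coset is a union over its representatives; it collapses
      because all of them yield the same coset.\<close>
    have eq: "?cl (r \<odot>\<^bsub>V\<^esub> y) = ?cl (r \<odot>\<^bsub>V\<^esub> x)" if y: "y \<in> ?cl x" for y
    proof -
      obtain n where n: "n \<in> N" "y = n \<oplus>\<^bsub>V\<^esub> x" using y by (auto simp: a_r_coset_def')
      have rn: "r \<odot>\<^bsub>V\<^esub> n \<in> N" using smult r n by blast
      have "?cl (r \<odot>\<^bsub>V\<^esub> y) = ?cl (r \<odot>\<^bsub>V\<^esub> n) \<oplus>\<^bsub>?Q\<^esub> ?cl (r \<odot>\<^bsub>V\<^esub> x)"
        unfolding n(2) using n(1) NX r x by (simp add: V.smult_r_distr cl_add)
      then show ?thesis using cl_N [OF rn] cl r x by simp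
    qed
    have "x \<in> ?cl x" using N.a_rcos_self [OF x] .
    then show ?thesis unfolding Qsm using eq by blast
  qed
  have cl_sum: "?cl (\<Oplus>\<^bsub>V\<^esub>i\<in>J. f i) = (\<Oplus>\<^bsub>?Q\<^esub>i\<in>J. ?cl (f i))" if "finite J" "f \<in> J \<rightarrow> carrier V" for J and f :: "'m set \<Rightarrow> 'm"
    using that
  proof (induction J rule: finite_induct)
    case empty
    have "\<zero>\<^bsub>V\<^esub> \<in> N" by simp
    then show ?case using cl_N by simp
  next
    case (insert j J)
    then have "f \<in> J \<rightarrow> carrier V" "f j \<in> carrier V" by auto
    moreover then have "(\<lambda>i. ?cl (f i)) \<in> J \<rightarrow> carrier ?Q" using cl by blast
    ultimately show ?case using insert cl by (simp add: cl_add)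
  qed
  obtain I :: "'m set set" and L m where db: "dual_basis_mod R ?Q {\<zero>\<^bsub>?Q\<^esub>} I L m"
    by (rule projective_imp_dual_basis [OF fg proj])
  have I: "finite I" and m: "\<And>i. i \<in> I \<Longrightarrow> m i \<in> carrier ?Q"
    and L: "\<And>i x. i \<in> I \<Longrightarrow> x \<in> carrier ?Q \<Longrightarrow> L i x \<in> carrier R"
      "\<And>i x y. i \<in> I \<Longrightarrow> x \<in> carrier ?Q \<Longrightarrow> y \<in> carrier ?Q \<Longrightarrow> L i (x \<oplus>\<^bsub>?Q\<^esub> y) = L i x \<oplus>\<^bsub>R\<^esub> L i y"
      "\<And>i r x. i \<in> I \<Longrightarrow> r \<in> carrier R \<Longrightarrow> x \<in> carrier ?Q \<Longrightarrow> L i (r \<odot>\<^bsub>?Q\<^esub> x) = r \<otimes>\<^bsub>R\<^esub> L i x"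
      "\<And>i. i \<in> I \<Longrightarrow> L i \<zero>\<^bsub>?Q\<^esub> = \<zero>\<^bsub>R\<^esub>"
    and d: "\<And>x. x \<in> carrier ?Q \<Longrightarrow> x \<ominus>\<^bsub>?Q\<^esub> (\<Oplus>\<^bsub>?Q\<^esub>i\<in>I. L i x \<odot>\<^bsub>?Q\<^esub> m i) = \<zero>\<^bsub>?Q\<^esub>"
    using db by (simp_all add: dual_basis_mod_def)
  have dual: "(\<Oplus>\<^bsub>?Q\<^esub>i\<in>I. L i x \<odot>\<^bsub>?Q\<^esub> m i) = x" if x: "x \<in> carrier ?Q" for x
  proof -
    have "(\<lambda>i. L i x \<odot>\<^bsub>?Q\<^esub> m i) \<in> I \<rightarrow> carrier ?Q" using L(1) m x by blast
    then show ?thesis using Q.eq_of_minus_eq_zero [OF x Q.finsum_closed d [OF x]] by metis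
  qed
  have "\<forall>i\<in>I. \<exists>x\<in>carrier V. m i = ?cl x" using m cl_ex by blast
  then obtain m' where m': "\<And>i. i \<in> I \<Longrightarrow> m' i \<in> carrier V" "\<And>i. i \<in> I \<Longrightarrow> m i = ?cl (m' i)" by metis
  have "x \<ominus>\<^bsub>V\<^esub> (\<Oplus>\<^bsub>V\<^esub>i\<in>I. L i (?cl x) \<odot>\<^bsub>V\<^esub> m' i) \<in> N" if x: "x \<in> carrier V" for x
  proof -
    let ?y = "\<Oplus>\<^bsub>V\<^esub>i\<in>I. L i (?cl x) \<odot>\<^bsub>V\<^esub> m' i"
    have c: "(\<lambda>i. L i (?cl x) \<odot>\<^bsub>V\<^esub> m' i) \<in> I \<rightarrow> carrier V" using L(1) m' cl [OF x] by auto
    have y: "?y \<in> carrier V" using c by (rule V.finsum_closed)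
    have "?cl ?y = (\<Oplus>\<^bsub>?Q\<^esub>i\<in>I. ?cl (L i (?cl x) \<odot>\<^bsub>V\<^esub> m' i))" by (rule cl_sum [OF I c])
    also have "\<dots> = (\<Oplus>\<^bsub>?Q\<^esub>i\<in>I. L i (?cl x) \<odot>\<^bsub>?Q\<^esub> m i)"
      using L(1) m m' cl [OF x] by (intro Q.finsum_cong') (auto simp: cl_smult)
    also have "\<dots> = ?cl x" using dual cl [OF x] by simp
    finally have "x \<in> ?cl ?y" using N.a_rcos_self [OF x] by simp
    then obtain n where n: "n \<in> N" and xn: "x = n \<oplus>\<^bsub>V\<^esub> ?y" by (auto simp: a_r_coset_def')
    have "x \<ominus>\<^bsub>V\<^esub> ?y = (n \<oplus>\<^bsub>V\<^esub> ?y) \<ominus>\<^bsub>V\<^esub> ?y" by (rule arg_cong [OF xn])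
    also have "\<dots> = n" using y NX [OF n] by (simp add: a_minus_def V.a_assoc V.r_neg)
    finally show ?thesis using n by (simp only:)
  qed
  moreover have "L i (?cl n) = \<zero>\<^bsub>R\<^esub>" if "i \<in> I" "n \<in> N" for i n
    using that by (simp add: cl_N L(4))
  ultimately have "dual_basis_mod R V N I (\<lambda>i x. L i (?cl x)) m'"
    unfolding dual_basis_mod_def using I m'(1) L(1-3) cl by (simp add: cl_add cl_smult)
  then show ?thesis by (rule that)
qed

section \<open>Averaging over the Teichmueller units\<close>

lemma (in abelian_monoid) finsum_swap:
  assumes "finite A" "finite B" "\<And>i j. i \<in> A \<Longrightarrow> j \<in> B \<Longrightarrow> f i j \<in> carrier G"
  shows "(\<Oplus>i\<in>A. \<Oplus>j\<in>B. f i j) = (\<Oplus>j\<in>B. \<Oplus>i\<in>A. f i j)"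
  using assms(1,3)
proof (induction A rule: finite_induct)
  case empty
  have "(\<Oplus>j\<in>B. \<zero>) = \<zero>" by (rule finsum_zero)
  then show ?case by simp
next
  case (insert i A)
  have "(\<Oplus>i\<in>insert i A. \<Oplus>j\<in>B. f i j) = (\<Oplus>j\<in>B. f i j) \<oplus> (\<Oplus>i\<in>A. \<Oplus>j\<in>B. f i j)"
    using insert by (subst finsum_insert) (auto intro!: finsum_closed)
  also have "(\<Oplus>i\<in>A. \<Oplus>j\<in>B. f i j) = (\<Oplus>j\<in>B. \<Oplus>i\<in>A. f i j)"
    using insert by auto
  also have "(\<Oplus>j\<in>B. f i j) \<oplus> \<dots> = (\<Oplus>j\<in>B. f i j \<oplus> (\<Oplus>i\<in>A. f i j))"
    using insert by (intro finsum_addf [symmetric]) (auto intro!: finsum_closed)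
  also have "\<dots> = (\<Oplus>j\<in>B. \<Oplus>i\<in>insert i A. f i j)"
    using insert by (intro finsum_cong') (auto intro!: finsum_closed)
  finally show ?case .
qed

lemma with_action_simps [simp]:
  "carrier (with_action M act) = carrier M" "\<zero>\<^bsub>with_action M act\<^esub> = \<zero>\<^bsub>M\<^esub>"
  "add (with_action M act) = add M" "r \<odot>\<^bsub>with_action M act\<^esub> x = act r x"
  by (simp_all add: with_action_def)

lemma with_action_minus: "x \<ominus>\<^bsub>with_action M act\<^esub> y = x \<ominus>\<^bsub>M\<^esub> y"
  by (simp add: a_minus_def a_inv_def m_inv_def)

lemma with_action_finsum: "finsum (with_action M act) f J = finsum M f J"
  by (simp add: finsum_def finprod_def)

locale coeff_ring = witt_cring K p \<iota> \<pi> j + tensor R "Wk p K \<iota>" "Zp p" a j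
  for K :: "'k ring" and p \<iota> \<pi> j and R :: "'r ring" and a +
  assumes a_hom: "a \<in> ring_hom (Zp p) R"
begin

sublocale a: ring_hom_cring "Zp p" R a
  by (intro ring_hom_cringI Zp.cring_axioms A.cring_axioms a_hom)

lemma pure_zero_left: "w \<in> carrier W \<Longrightarrow> pure \<zero>\<^bsub>R\<^esub> w = \<zero>\<^bsub>T\<^esub>"
  using pure_add_left [of "\<zero>\<^bsub>R\<^esub>" "\<zero>\<^bsub>R\<^esub>" w] pure_closed [of "\<zero>\<^bsub>R\<^esub>" w] by simp

lemma pure_zero_right: "r \<in> carrier R \<Longrightarrow> pure r \<zero>\<^bsub>W\<^esub> = \<zero>\<^bsub>T\<^esub>"
  using pure_add_right [of r "\<zero>\<^bsub>W\<^esub>" "\<zero>\<^bsub>W\<^esub>"] pure_closed [of r "\<zero>\<^bsub>W\<^esub>"] by simp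

lemma pure_factor:
  assumes "r \<in> carrier R" "w \<in> carrier W"
  shows "pure r w = pure r \<one>\<^bsub>W\<^esub> \<otimes>\<^bsub>T\<^esub> pure \<one>\<^bsub>R\<^esub> w"
  using assms by (simp add: pure_mult)

lemma inverse_card_units:
  obtains e where "e \<in> carrier R" "[(card (carrier \<kappa>) - 1)] \<cdot>\<^bsub>T\<^esub> pure e \<one>\<^bsub>W\<^esub> = \<one>\<^bsub>T\<^esub>"
proof -
  let ?n = "card (carrier \<kappa>) - 1"
  obtain y where y: "y \<in> carrier (Zp p)" "[?n] \<cdot>\<^bsub>Zp p\<^esub> y = \<one>\<^bsub>Zp p\<^esub>"
    by (rule Zp_inverse_card_units)
  have "[n] \<cdot>\<^bsub>T\<^esub> pure (a y) \<one>\<^bsub>W\<^esub> = pure (a ([n] \<cdot>\<^bsub>Zp p\<^esub> y)) \<one>\<^bsub>W\<^esub>" for n :: nat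
    by (induction n) (use y(1) in \<open>simp_all add: pure_zero_left pure_add_left\<close>)
  from this [of ?n] show ?thesis using that [of "a y"] y by (simp add: pure_one)
qed

text \<open>The new functional is \<open>L' i x = e (\<Sum>c. L i ([c]^-1 x) \<otimes> [c])\<close>
  with \<open>e = 1/(q - 1)\<close>; replacing \<open>c\<close> by \<open>d c\<close> makes it
  linear for each Teichmueller unit \<open>[d]\<close>. The map \<open>S = \<Sum>i. L i m i\<close>
  is the identity modulo \<open>N\<close>, hence so is every conjugate \<open>[c] S [c]^-1\<close>,
  and so is their average.\<close>

lemma average_dual_basis:
  assumes V: "module T V" and N: "subgroup N (add_monoid V)"
    and N_smult: "\<And>t n. t \<in> carrier T \<Longrightarrow> n \<in> N \<Longrightarrow> t \<odot>\<^bsub>V\<^esub> n \<in> N"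
    and db: "dual_basis_mod R (with_action V (\<lambda>r. smult V (pure r \<one>\<^bsub>W\<^esub>))) N J L m"
  obtains L' where "dual_basis_mod T V N J L' m"
proof -
  interpret V: module T V by fact
  interpret N: subgroup N "add_monoid V" by fact
  have NV: "n \<in> carrier V" if "n \<in> N" for n using N.mem_carrier that by simp
  have N_add: "x \<oplus>\<^bsub>V\<^esub> y \<in> N" if "x \<in> N" "y \<in> N" for x y using N.m_closed that by simp
  have N_neg: "\<ominus>\<^bsub>V\<^esub> x \<in> N" if "x \<in> N" for x
    using N.m_inv_closed that by (simp add: a_inv_def)
  have N_zero: "\<zero>\<^bsub>V\<^esub> \<in> N" using N.one_closed by simp
  let ?r = "\<lambda>r. pure r \<one>\<^bsub>W\<^esub>"
  have J: "finite J" and m: "\<And>i. i \<in> J \<Longrightarrow> m i \<in> carrier V"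
    and L: "\<And>i x. i \<in> J \<Longrightarrow> x \<in> carrier V \<Longrightarrow> L i x \<in> carrier R"
    and L_add: "\<And>i x y. i \<in> J \<Longrightarrow> x \<in> carrier V \<Longrightarrow> y \<in> carrier V \<Longrightarrow> L i (x \<oplus>\<^bsub>V\<^esub> y) = L i x \<oplus>\<^bsub>R\<^esub> L i y"
    and L_smult: "\<And>i r x. i \<in> J \<Longrightarrow> r \<in> carrier R \<Longrightarrow> x \<in> carrier V \<Longrightarrow> L i (?r r \<odot>\<^bsub>V\<^esub> x) = r \<otimes>\<^bsub>R\<^esub> L i x"
    and L_N: "\<And>i x. i \<in> J \<Longrightarrow> x \<in> N \<Longrightarrow> L i x = \<zero>\<^bsub>R\<^esub>"
    and dual: "\<And>x. x \<in> carrier V \<Longrightarrow> x \<ominus>\<^bsub>V\<^esub> (\<Oplus>\<^bsub>V\<^esub>i\<in>J. ?r (L i x) \<odot>\<^bsub>V\<^esub> m i) \<in> N"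
    using db by (simp_all add: dual_basis_mod_def with_action_minus with_action_finsum)
  obtain e where e: "e \<in> carrier R" "[(card (carrier \<kappa>) - 1)] \<cdot>\<^bsub>T\<^esub> ?r e = \<one>\<^bsub>T\<^esub>"
    by (rule inverse_card_units)
  have re: "?r e \<in> carrier T" using e by (simp add: pure_closed)
  define G where "G = carrier \<kappa> - {\<zero>\<^bsub>\<kappa>\<^esub>}"
  define g where "g c = pure \<one>\<^bsub>R\<^esub> (teich c)" for c
  have finG: "finite G" using finite_residue_field by (simp add: G_def)
  have Gc: "c \<in> carrier \<kappa>" "inv\<^bsub>\<kappa>\<^esub> c \<in> carrier \<kappa>" "inv\<^bsub>\<kappa>\<^esub> c \<otimes>\<^bsub>\<kappa>\<^esub> c = \<one>\<^bsub>\<kappa>\<^esub>" "c \<otimes>\<^bsub>\<kappa>\<^esub> inv\<^bsub>\<kappa>\<^esub> c = \<one>\<^bsub>\<kappa>\<^esub>"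
    if "c \<in> G" for c using that by (simp_all add: G_def k.field_Units)
  have gc: "g c \<in> carrier T" if "c \<in> carrier \<kappa>" for c
    using that by (simp add: g_def pure_closed teich_closed)
  have g_mult: "g c \<otimes>\<^bsub>T\<^esub> g d = g (c \<otimes>\<^bsub>\<kappa>\<^esub> d)" if "c \<in> carrier \<kappa>" "d \<in> carrier \<kappa>" for c d
    using that by (simp add: g_def pure_mult teich_closed teich_mult)
  have g_one: "g \<one>\<^bsub>\<kappa>\<^esub> = \<one>\<^bsub>T\<^esub>"
    unfolding g_def W_simps(3) [symmetric] by (rule pure_one)
  have pg: "pure r (teich c) = ?r r \<otimes>\<^bsub>T\<^esub> g c" if "r \<in> carrier R" "c \<in> carrier \<kappa>" for r c
    using that by (simp add: g_def pure_mult teich_closed)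
  define h where "h i x c = ?r (L i (g (inv\<^bsub>\<kappa>\<^esub> c) \<odot>\<^bsub>V\<^esub> x)) \<otimes>\<^bsub>T\<^esub> g c" for i x c
  have hc: "h i x c \<in> carrier T" if "i \<in> J" "x \<in> carrier V" "c \<in> G" for i x c
    using that Gc by (simp add: h_def gc L pure_closed)
  define L' where "L' i x = ?r e \<otimes>\<^bsub>T\<^esub> (\<Oplus>\<^bsub>T\<^esub>c\<in>G. h i x c)" for i x
  have L'c: "L' i x \<in> carrier T" if "i \<in> J" "x \<in> carrier V" for i x
    unfolding L'_def using that re hc by (simp add: Pi_def)
  have L'_add: "L' i (x \<oplus>\<^bsub>V\<^esub> y) = L' i x \<oplus>\<^bsub>T\<^esub> L' i y" if ixy: "i \<in> J" "x \<in> carrier V" "y \<in> carrier V" for i x y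
  proof -
    have "(\<Oplus>\<^bsub>T\<^esub>c\<in>G. h i (x \<oplus>\<^bsub>V\<^esub> y) c) = (\<Oplus>\<^bsub>T\<^esub>c\<in>G. h i x c \<oplus>\<^bsub>T\<^esub> h i y c)"
      using ixy hc Gc
      by (intro T.finsum_cong') (auto simp: h_def gc L L_add V.smult_r_distr pure_add_left pure_closed T.l_distr)
    also have "\<dots> = (\<Oplus>\<^bsub>T\<^esub>c\<in>G. h i x c) \<oplus>\<^bsub>T\<^esub> (\<Oplus>\<^bsub>T\<^esub>c\<in>G. h i y c)"
      using ixy hc by (intro T.finsum_addf) auto
    finally show ?thesis unfolding L'_def using ixy re hc by (simp add: T.r_distr Pi_def)
  qed
  have L'_N: "L' i x = \<zero>\<^bsub>T\<^esub>" if ix: "i \<in> J" "x \<in> N" for i x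
  proof -
    have "(\<Oplus>\<^bsub>T\<^esub>c\<in>G. h i x c) = \<zero>\<^bsub>T\<^esub>"
      using ix Gc by (intro T.add.finprod_one_eqI) (simp add: h_def L_N N_smult gc pure_zero_left)
    then show ?thesis unfolding L'_def using re by simp
  qed
  have L'_neg: "L' i (\<ominus>\<^bsub>V\<^esub> x) = \<ominus>\<^bsub>T\<^esub> L' i x" if "i \<in> J" "x \<in> carrier V" for i x
    using L'_add [of i "\<ominus>\<^bsub>V\<^esub> x" x] L'_N [OF that(1) N_zero] that
    by (simp add: V.l_neg T.minus_equality L'c)
  have L'_smult: "L' i (t \<odot>\<^bsub>V\<^esub> x) = t \<otimes>\<^bsub>T\<^esub> L' i x"
    if i: "i \<in> J" and t: "t \<in> carrier T" and x: "x \<in> carrier V" for i t x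
  proof -
    \<comment> \<open>The scalars over which \<open>L' i\<close> is linear form a subring, so it
      suffices to find in it the image of \<open>R\<close>, the Teichmueller elements and the image
      of the p-adic integers.\<close>
    define good where "good t \<longleftrightarrow> t \<in> carrier T \<and> (\<forall>x\<in>carrier V. L' i (t \<odot>\<^bsub>V\<^esub> x) = t \<otimes>\<^bsub>T\<^esub> L' i x)" for t
    have good_add: "good (s \<oplus>\<^bsub>T\<^esub> t)" if "good s" "good t" for s t
      using that i by (simp add: good_def V.smult_l_distr L'_add L'c T.l_distr)
    have good_neg: "good (\<ominus>\<^bsub>T\<^esub> t)" if "good t" for t
      using that i by (simp add: good_def V.smult_l_minus L'_neg L'c T.l_minus)
    have good_mult: "good (s \<otimes>\<^bsub>T\<^esub> t)" if "good s" "good t" for s t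
      using that i by (simp add: good_def V.smult_assoc1 L'c T.m_assoc)
    have good_zero: "good \<zero>\<^bsub>T\<^esub>"
      using i L'_N [OF i N_zero] by (simp add: good_def L'c)
    have good_r: "good (?r r)" if r: "r \<in> carrier R" for r
      unfolding good_def
    proof (intro conjI ballI)
      show rr: "?r r \<in> carrier T" using r by (simp add: pure_closed)
      fix x assume x: "x \<in> carrier V"
      have "h i (?r r \<odot>\<^bsub>V\<^esub> x) c = ?r r \<otimes>\<^bsub>T\<^esub> h i x c" if c: "c \<in> G" for c
      proof -
        have "g (inv\<^bsub>\<kappa>\<^esub> c) \<odot>\<^bsub>V\<^esub> (?r r \<odot>\<^bsub>V\<^esub> x) = ?r r \<odot>\<^bsub>V\<^esub> (g (inv\<^bsub>\<kappa>\<^esub> c) \<odot>\<^bsub>V\<^esub> x)"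
          using x rr gc Gc [OF c] by (simp add: T.m_comm flip: V.smult_assoc1)
        moreover have "?r (r \<otimes>\<^bsub>R\<^esub> s) = ?r r \<otimes>\<^bsub>T\<^esub> ?r s" if "s \<in> carrier R" for s
          using r that by (simp add: pure_mult)
        ultimately show ?thesis
          unfolding h_def using x r i gc Gc [OF c] L rr by (simp add: L_smult T.m_assoc pure_closed)
      qed
      then have "(\<Oplus>\<^bsub>T\<^esub>c\<in>G. h i (?r r \<odot>\<^bsub>V\<^esub> x) c) = (\<Oplus>\<^bsub>T\<^esub>c\<in>G. ?r r \<otimes>\<^bsub>T\<^esub> h i x c)"
        using x i rr hc by (intro T.finsum_cong') auto
      also have "\<dots> = ?r r \<otimes>\<^bsub>T\<^esub> (\<Oplus>\<^bsub>T\<^esub>c\<in>G. h i x c)"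
        using x i rr hc finG by (intro T.finsum_rdistr [symmetric]) auto
      finally show "L' i (?r r \<odot>\<^bsub>V\<^esub> x) = ?r r \<otimes>\<^bsub>T\<^esub> L' i x"
        unfolding L'_def using x i rr hc re by (simp add: T.m_lcomm Pi_def)
    qed
    have good_g: "good (g d)" if d: "d \<in> carrier \<kappa>" for d
    proof (cases "d = \<zero>\<^bsub>\<kappa>\<^esub>")
      case True
      then show ?thesis using good_zero by (simp add: g_def teich_zero pure_zero_right)
    next
      case False
      then have dG: "d \<in> G" using d by (simp add: G_def)
      \<comment> \<open>The sum over \<open>G\<close> will be reindexed by
        \<open>c \<mapsto> d c\<close>, the invariance argument of Maschke's theorem.\<close>
      have bij: "(\<lambda>c. d \<otimes>\<^bsub>\<kappa>\<^esub> c) ` G = G"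
      proof (rule card_subset_eq [OF finG])
        show "(\<lambda>c. d \<otimes>\<^bsub>\<kappa>\<^esub> c) ` G \<subseteq> G" using d False k.integral by (auto simp: G_def)
        show "card ((\<lambda>c. d \<otimes>\<^bsub>\<kappa>\<^esub> c) ` G) = card G"
          by (rule card_image) (use d False in \<open>auto simp: G_def inj_on_def k.m_lcancel\<close>)
      qed
      have inj: "inj_on (\<lambda>c. d \<otimes>\<^bsub>\<kappa>\<^esub> c) G"
        using d False by (auto simp: G_def inj_on_def k.m_lcancel)
      show ?thesis
        unfolding good_def
      proof (intro conjI ballI)
        show gd: "g d \<in> carrier T" by (rule gc [OF d])
        fix x assume x: "x \<in> carrier V"
        have hd: "h i (g d \<odot>\<^bsub>V\<^esub> x) (d \<otimes>\<^bsub>\<kappa>\<^esub> c) = g d \<otimes>\<^bsub>T\<^esub> h i x c" if c: "c \<in> G" for c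
        proof -
          have dc: "d \<otimes>\<^bsub>\<kappa>\<^esub> c \<in> G" using bij c by blast
          have "inv\<^bsub>\<kappa>\<^esub> (d \<otimes>\<^bsub>\<kappa>\<^esub> c) \<otimes>\<^bsub>\<kappa>\<^esub> d = inv\<^bsub>\<kappa>\<^esub> (d \<otimes>\<^bsub>\<kappa>\<^esub> c) \<otimes>\<^bsub>\<kappa>\<^esub> d \<otimes>\<^bsub>\<kappa>\<^esub> (c \<otimes>\<^bsub>\<kappa>\<^esub> inv\<^bsub>\<kappa>\<^esub> c)"
            using Gc [OF c] Gc [OF dc] d by simp
          also have "\<dots> = (inv\<^bsub>\<kappa>\<^esub> (d \<otimes>\<^bsub>\<kappa>\<^esub> c) \<otimes>\<^bsub>\<kappa>\<^esub> (d \<otimes>\<^bsub>\<kappa>\<^esub> c)) \<otimes>\<^bsub>\<kappa>\<^esub> inv\<^bsub>\<kappa>\<^esub> c"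
            using Gc(1,2) [OF c] Gc(2) [OF dc] d by (simp add: k.m_assoc)
          also have "\<dots> = inv\<^bsub>\<kappa>\<^esub> c" using Gc [OF c] Gc [OF dc] by simp
          finally have i1: "inv\<^bsub>\<kappa>\<^esub> (d \<otimes>\<^bsub>\<kappa>\<^esub> c) \<otimes>\<^bsub>\<kappa>\<^esub> d = inv\<^bsub>\<kappa>\<^esub> c" .
          have "g (inv\<^bsub>\<kappa>\<^esub> (d \<otimes>\<^bsub>\<kappa>\<^esub> c)) \<odot>\<^bsub>V\<^esub> (g d \<odot>\<^bsub>V\<^esub> x) = g (inv\<^bsub>\<kappa>\<^esub> c) \<odot>\<^bsub>V\<^esub> x"
            using x gd gc [OF Gc(2) [OF dc]] g_mult [OF Gc(2) [OF dc] d] i1 by (simp flip: V.smult_assoc1)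
          moreover have "g (d \<otimes>\<^bsub>\<kappa>\<^esub> c) = g d \<otimes>\<^bsub>T\<^esub> g c" using g_mult [OF d Gc(1) [OF c]] by simp
          ultimately show ?thesis
            unfolding h_def using x i gd gc [OF Gc(1) [OF c]] gc [OF Gc(2) [OF c]] L by (simp add: T.m_lcomm pure_closed)
        qed
        have "(\<Oplus>\<^bsub>T\<^esub>c\<in>G. h i (g d \<odot>\<^bsub>V\<^esub> x) c) = (\<Oplus>\<^bsub>T\<^esub>c\<in>(\<lambda>c. d \<otimes>\<^bsub>\<kappa>\<^esub> c) ` G. h i (g d \<odot>\<^bsub>V\<^esub> x) c)"
          unfolding bij ..
        also have "\<dots> = (\<Oplus>\<^bsub>T\<^esub>c\<in>G. h i (g d \<odot>\<^bsub>V\<^esub> x) (d \<otimes>\<^bsub>\<kappa>\<^esub> c))"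
          by (rule T.finsum_reindex [OF _ inj]) (use x i gd hc bij in auto)
        also have "\<dots> = (\<Oplus>\<^bsub>T\<^esub>c\<in>G. g d \<otimes>\<^bsub>T\<^esub> h i x c)"
          using x i gd hc hd by (intro T.finsum_cong') auto
        also have "\<dots> = g d \<otimes>\<^bsub>T\<^esub> (\<Oplus>\<^bsub>T\<^esub>c\<in>G. h i x c)"
          using x i gd hc finG by (intro T.finsum_rdistr [symmetric]) auto
        finally show "L' i (g d \<odot>\<^bsub>V\<^esub> x) = g d \<otimes>\<^bsub>T\<^esub> L' i x"
          unfolding L'_def using x i gd hc re by (simp add: T.m_lcomm Pi_def)
      qed
    qed
    \<comment> \<open>The balancing relation gives \<open>1 \<otimes> j z = a z \<otimes> 1\<close>,
      which falls under \<open>good_r\<close>.\<close>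
    have good_j: "good (pure \<one>\<^bsub>R\<^esub> (j z))" if "z \<in> carrier (Zp p)" for z
      using good_r [of "a z"] pure_balanced [of z "\<one>\<^bsub>R\<^esub>" "\<one>\<^bsub>W\<^esub>"] that by simp
    have good_w: "good (pure \<one>\<^bsub>R\<^esub> w)" if w: "w \<in> carrier W" for w
    proof -
      obtain z where z: "z \<in> UNIV \<rightarrow> carrier (Zp p)" "w = (\<Oplus>\<^bsub>W\<^esub>b\<in>carrier \<kappa>. j (z b) \<otimes>\<^bsub>W\<^esub> teich b)"
        using W_span_teich [OF w] by blast
      have zc: "z b \<in> carrier (Zp p)" for b using z(1) by auto
      have "good (pure \<one>\<^bsub>R\<^esub> (\<Oplus>\<^bsub>W\<^esub>b\<in>F. j (z b) \<otimes>\<^bsub>W\<^esub> teich b))" if "finite F" "F \<subseteq> carrier \<kappa>" for F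
        using that
      proof (induction F rule: finite_induct)
        case empty
        then show ?case using good_zero by (simp add: pure_zero_right)
      next
        case (insert b F)
        have b: "b \<in> carrier \<kappa>" and F: "F \<subseteq> carrier \<kappa>" using insert by auto
        have c: "(\<lambda>b. j (z b) \<otimes>\<^bsub>W\<^esub> teich b) \<in> F \<rightarrow> carrier W"
          using F zc teich_closed by (auto simp: Pi_iff subset_iff)
        have "pure \<one>\<^bsub>R\<^esub> (j (z b) \<otimes>\<^bsub>W\<^esub> teich b) = pure \<one>\<^bsub>R\<^esub> (j (z b)) \<otimes>\<^bsub>T\<^esub> g b"
          using b zc teich_closed by (simp add: g_def pure_mult)
        then have "good (pure \<one>\<^bsub>R\<^esub> (j (z b) \<otimes>\<^bsub>W\<^esub> teich b))"
          using good_mult [OF good_j [OF zc] good_g [OF b]] by simp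
        moreover have "(\<Oplus>\<^bsub>W\<^esub>b\<in>insert b F. j (z b) \<otimes>\<^bsub>W\<^esub> teich b) =
            j (z b) \<otimes>\<^bsub>W\<^esub> teich b \<oplus>\<^bsub>W\<^esub> (\<Oplus>\<^bsub>W\<^esub>b\<in>F. j (z b) \<otimes>\<^bsub>W\<^esub> teich b)"
          using insert c b zc teich_closed by (intro W.finsum_insert) auto
        moreover have "pure \<one>\<^bsub>R\<^esub> (j (z b) \<otimes>\<^bsub>W\<^esub> teich b \<oplus>\<^bsub>W\<^esub> (\<Oplus>\<^bsub>W\<^esub>b\<in>F. j (z b) \<otimes>\<^bsub>W\<^esub> teich b)) =
          pure \<one>\<^bsub>R\<^esub> (j (z b) \<otimes>\<^bsub>W\<^esub> teich b) \<oplus>\<^bsub>T\<^esub> pure \<one>\<^bsub>R\<^esub> (\<Oplus>\<^bsub>W\<^esub>b\<in>F. j (z b) \<otimes>\<^bsub>W\<^esub> teich b)"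
          using W.finsum_closed [OF c] b zc teich_closed by (intro pure_add_right) auto
        ultimately show ?case using good_add insert.IH [OF F] by simp
      qed
      from this [OF finite_residue_field] show ?thesis using z(2) by simp
    qed
    have "good t"
      using t
    proof (induction t rule: T_induct)
      case (pure r w)
      then show ?case using good_mult [OF good_r good_w] by (simp add: pure_factor [of r w])
    next
      case (diff s t)
      then show ?case unfolding a_minus_def by (intro good_add good_neg)
    qed
    then show ?thesis using x by (simp add: good_def)
  qed
  have L'_dual: "x \<ominus>\<^bsub>V\<^esub> (\<Oplus>\<^bsub>V\<^esub>i\<in>J. L' i x \<odot>\<^bsub>V\<^esub> m i) \<in> N" if x: "x \<in> carrier V" for x
  proof -
    define S where "S y = (\<Oplus>\<^bsub>V\<^esub>i\<in>J. ?r (L i y) \<odot>\<^bsub>V\<^esub> m i)" for y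
    have Sc: "S y \<in> carrier V" if "y \<in> carrier V" for y
      unfolding S_def using that L m by (intro V.finsum_closed) (auto simp: pure_closed)
    let ?y = "\<lambda>c. g (inv\<^bsub>\<kappa>\<^esub> c) \<odot>\<^bsub>V\<^esub> x"
    have yc: "?y c \<in> carrier V" if "c \<in> G" for c using that Gc gc x by simp
    have gS: "g c \<odot>\<^bsub>V\<^esub> S (?y c) \<in> carrier V" if "c \<in> G" for c using that Gc gc yc Sc by simp
    have hm: "h i x c \<odot>\<^bsub>V\<^esub> m i = g c \<odot>\<^bsub>V\<^esub> (?r (L i (?y c)) \<odot>\<^bsub>V\<^esub> m i)" if "i \<in> J" "c \<in> G" for i c
      unfolding h_def using that Gc gc yc L m by (simp add: T.m_comm pure_closed V.smult_assoc1)
    have "(\<Oplus>\<^bsub>V\<^esub>i\<in>J. L' i x \<odot>\<^bsub>V\<^esub> m i) = (\<Oplus>\<^bsub>V\<^esub>i\<in>J. ?r e \<odot>\<^bsub>V\<^esub> (\<Oplus>\<^bsub>V\<^esub>c\<in>G. h i x c \<odot>\<^bsub>V\<^esub> m i))"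
    proof (rule V.finsum_cong' [OF refl])
      fix i assume i: "i \<in> J"
      have "(\<Oplus>\<^bsub>T\<^esub>c\<in>G. h i x c) \<in> carrier T" using i x hc by (intro T.finsum_closed) auto
      then show "L' i x \<odot>\<^bsub>V\<^esub> m i = ?r e \<odot>\<^bsub>V\<^esub> (\<Oplus>\<^bsub>V\<^esub>c\<in>G. h i x c \<odot>\<^bsub>V\<^esub> m i)"
        unfolding L'_def using i x re m hc finG
        by (simp add: V.smult_assoc1) (subst V.finsum_smult_rdistr, auto)
    qed (use x re m hc in \<open>auto intro!: V.smult_closed V.finsum_closed\<close>)
    also have "\<dots> = ?r e \<odot>\<^bsub>V\<^esub> (\<Oplus>\<^bsub>V\<^esub>i\<in>J. \<Oplus>\<^bsub>V\<^esub>c\<in>G. h i x c \<odot>\<^bsub>V\<^esub> m i)"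
      using J x re m hc by (intro V.finsum_smult_ldistr [symmetric]) (auto intro!: V.finsum_closed)
    also have "(\<Oplus>\<^bsub>V\<^esub>i\<in>J. \<Oplus>\<^bsub>V\<^esub>c\<in>G. h i x c \<odot>\<^bsub>V\<^esub> m i) = (\<Oplus>\<^bsub>V\<^esub>c\<in>G. \<Oplus>\<^bsub>V\<^esub>i\<in>J. h i x c \<odot>\<^bsub>V\<^esub> m i)"
      using J finG x m hc by (intro V.finsum_swap) auto
    also have "\<dots> = (\<Oplus>\<^bsub>V\<^esub>c\<in>G. g c \<odot>\<^bsub>V\<^esub> S (?y c))"
    proof (rule V.finsum_cong' [OF refl])
      fix c assume c: "c \<in> G"
      have "(\<Oplus>\<^bsub>V\<^esub>i\<in>J. h i x c \<odot>\<^bsub>V\<^esub> m i) = (\<Oplus>\<^bsub>V\<^esub>i\<in>J. g c \<odot>\<^bsub>V\<^esub> (?r (L i (?y c)) \<odot>\<^bsub>V\<^esub> m i))"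
        using c m L yc gc Gc(1) [OF c] by (intro V.finsum_cong') (auto simp: hm pure_closed)
      also have "\<dots> = g c \<odot>\<^bsub>V\<^esub> S (?y c)"
        unfolding S_def using J c m L yc gc Gc(1) [OF c]
        by (intro V.finsum_smult_ldistr [symmetric]) (auto simp: pure_closed)
      finally show "(\<Oplus>\<^bsub>V\<^esub>i\<in>J. h i x c \<odot>\<^bsub>V\<^esub> m i) = g c \<odot>\<^bsub>V\<^esub> S (?y c)" .
    qed (use gS in auto)
    finally have sum: "(\<Oplus>\<^bsub>V\<^esub>i\<in>J. L' i x \<odot>\<^bsub>V\<^esub> m i) = ?r e \<odot>\<^bsub>V\<^esub> (\<Oplus>\<^bsub>V\<^esub>c\<in>G. g c \<odot>\<^bsub>V\<^esub> S (?y c))" .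
    \<comment> \<open>The congruence of \<open>S\<close> with the identity at
      \<open>[c]^-1 x\<close> is multiplied by \<open>[c]\<close>, under which \<open>N\<close> is
      stable.\<close>
    have one: "x \<ominus>\<^bsub>V\<^esub> g c \<odot>\<^bsub>V\<^esub> S (?y c) \<in> N" if c: "c \<in> G" for c
    proof -
      have "g c \<odot>\<^bsub>V\<^esub> ?y c = x"
        using g_mult [OF Gc(1,2) [OF c]] Gc [OF c] gc x g_one by (simp flip: V.smult_assoc1)
      then have "x \<ominus>\<^bsub>V\<^esub> g c \<odot>\<^bsub>V\<^esub> S (?y c) = g c \<odot>\<^bsub>V\<^esub> (?y c \<ominus>\<^bsub>V\<^esub> S (?y c))"
        using yc [OF c] Sc [OF yc [OF c]] gc [OF Gc(1) [OF c]]
        by (simp add: a_minus_def V.smult_r_distr V.smult_r_minus)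
      then show ?thesis using N_smult [OF gc [OF Gc(1) [OF c]] dual [OF yc [OF c]]] by (simp add: S_def)
    qed
    \<comment> \<open>For \<open>F = G\<close> the congruences add up to one for
      \<open>(q - 1) x\<close>; multiplication by \<open>e\<close> then restores
      \<open>x\<close>.\<close>
    have part: "[(card F)] \<cdot>\<^bsub>V\<^esub> x \<ominus>\<^bsub>V\<^esub> (\<Oplus>\<^bsub>V\<^esub>c\<in>F. g c \<odot>\<^bsub>V\<^esub> S (?y c)) \<in> N" if "finite F" "F \<subseteq> G" for F
      using that
    proof (induction F rule: finite_induct)
      case empty
      then show ?case using N_zero by (simp add: a_minus_def V.r_neg)
    next
      case (insert c F)
      have c: "c \<in> G" and F: "(\<lambda>c. g c \<odot>\<^bsub>V\<^esub> S (?y c)) \<in> F \<rightarrow> carrier V" using insert gS by auto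
      have Fc: "(\<Oplus>\<^bsub>V\<^esub>c\<in>F. g c \<odot>\<^bsub>V\<^esub> S (?y c)) \<in> carrier V" by (rule V.finsum_closed [OF F])
      have "[(card (insert c F))] \<cdot>\<^bsub>V\<^esub> x \<ominus>\<^bsub>V\<^esub> (\<Oplus>\<^bsub>V\<^esub>c\<in>insert c F. g c \<odot>\<^bsub>V\<^esub> S (?y c)) =
        ([(card F)] \<cdot>\<^bsub>V\<^esub> x \<oplus>\<^bsub>V\<^esub> x) \<ominus>\<^bsub>V\<^esub> (g c \<odot>\<^bsub>V\<^esub> S (?y c) \<oplus>\<^bsub>V\<^esub> (\<Oplus>\<^bsub>V\<^esub>c\<in>F. g c \<odot>\<^bsub>V\<^esub> S (?y c)))"
        using insert gS [OF c] F by simp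
      also have "\<dots> = ([(card F)] \<cdot>\<^bsub>V\<^esub> x \<ominus>\<^bsub>V\<^esub> (\<Oplus>\<^bsub>V\<^esub>c\<in>F. g c \<odot>\<^bsub>V\<^esub> S (?y c))) \<oplus>\<^bsub>V\<^esub> (x \<ominus>\<^bsub>V\<^esub> g c \<odot>\<^bsub>V\<^esub> S (?y c))"
        using x gS [OF c] Fc by (simp add: a_minus_def V.minus_add V.a_ac)
      finally show ?case using N_add insert one [OF c] by simp
    qed
    have cG: "card G = card (carrier \<kappa>) - 1"
      using finite_residue_field by (simp add: G_def card_Diff_singleton)
    let ?s = "\<Oplus>\<^bsub>V\<^esub>c\<in>G. g c \<odot>\<^bsub>V\<^esub> S (?y c)"
    have sc: "?s \<in> carrier V" using gS by (intro V.finsum_closed) auto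
    have "?r e \<odot>\<^bsub>V\<^esub> ([n] \<cdot>\<^bsub>V\<^esub> x) = ([n] \<cdot>\<^bsub>T\<^esub> ?r e) \<odot>\<^bsub>V\<^esub> x" for n :: nat
      by (induction n) (use x re in \<open>simp_all add: V.smult_r_distr V.smult_l_distr\<close>)
    then have "?r e \<odot>\<^bsub>V\<^esub> ([(card G)] \<cdot>\<^bsub>V\<^esub> x) = x" using e(2) x cG by simp
    then have "x \<ominus>\<^bsub>V\<^esub> ?r e \<odot>\<^bsub>V\<^esub> ?s = ?r e \<odot>\<^bsub>V\<^esub> ([(card G)] \<cdot>\<^bsub>V\<^esub> x \<ominus>\<^bsub>V\<^esub> ?s)"
      using x re sc by (simp add: a_minus_def V.smult_r_distr V.smult_r_minus)
    then show ?thesis unfolding sum using N_smult [OF re part [OF finG]] by simp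
  qed
  have "dual_basis_mod T V N J L' m"
    unfolding dual_basis_mod_def using J m L'c L'_add L'_smult L'_N L'_dual by simp
  then show ?thesis by (rule that)
qed

end

theorem theorem2p8:
  fixes p h :: nat
    and K :: "'k ring" and \<iota> :: "(nat \<Rightarrow> int) \<Rightarrow> 'k" and \<pi> :: 'k
    and j :: "(nat \<Rightarrow> int) \<Rightarrow> nat \<Rightarrow> 'k set" and e :: "(nat \<Rightarrow> 'k set) \<Rightarrow> 'k"
    and E u :: "nat \<Rightarrow> nat \<Rightarrow> 'k set"
    and R :: "'r ring" and a :: "(nat \<Rightarrow> int) \<Rightarrow> 'r"
    and M :: "(nat \<Rightarrow> nat \<Rightarrow> 'k set, 'm) module" and \<phi> :: "'m \<Rightarrow> 'm"
    and \<rho> :: "'r \<Rightarrow> 'm \<Rightarrow> 'm"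
    and \<sigma> :: "(nat \<Rightarrow> ('r \<times> (nat \<Rightarrow> 'k set) \<Rightarrow>\<^sub>0 int) set) \<Rightarrow> 'm \<Rightarrow> 'm"
  assumes "Factorial_Ring.prime p"
    and "finite_extension_Qp p K \<iota>"
    and "uniformizer p K \<iota> \<pi>"
    and "j \<in> ring_hom (Zp p) (Wk p K \<iota>)"
    and "Wk_embedding p K \<iota> e"
    and "minimal_poly_Wk p K \<iota> e \<pi> E"
    and "u = fps_var (Wk p K \<iota>)"
    and "cring R" and "a \<in> ring_hom (Zp p) R"
    and "h > 0"
    and "BK_module (BK_ring p K \<iota>) (BK_frob p K \<iota>) E h M \<phi>"
    and "coefficient_action p R a (BK_ring p K \<iota>) (\<lambda>c. fps_const (Wk p K \<iota>) (j c)) M \<phi> \<rho>"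
    and "BK_coeff_structure p K \<iota> j R a M \<rho> \<sigma>"
    and "fin_gen_module R (quot_module (with_action M \<rho>) (mult_image M u))"
    and "projective_module R (quot_module (with_action M \<rho>) (mult_image M u))"
    and "adically_complete (BK_ring p K \<iota>) M u"
    and "adically_separated (BK_ring p K \<iota>) M u"
    and "torsion_free M u"
  shows "fin_gen_module (BK_coeff_ring p K \<iota> j R a) (with_action M \<sigma>) \<and>
    projective_module (BK_coeff_ring p K \<iota> j R a) (with_action M \<sigma>)"
proof -
  have "field K" using assms(2) by (simp add: finite_extension_Qp_def)
  interpret U: finite_ext_unif K p \<iota> \<pi>
    by (intro finite_ext_unif.intro finite_ext.intro finite_ext_axioms.intro finite_ext_unif_axioms.intro)
      (use \<open>field K\<close> assms(1-3) in simp_all)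
  let ?W = "Wk p K \<iota>" and ?S = "BK_ring p K \<iota>"
  have Seq: "?S = fps_ring ?W" by (simp add: BK_ring_def)
  interpret M: module ?S M using assms(11) by (simp add: BK_module_def fin_free_module_def)
  \<comment> \<open>The module axioms for \<open>M\<close> include commutativity and the ring laws
    of the power series over \<open>?W\<close>; on constant series these give the laws of
    \<open>?W\<close>.\<close>
  have "cring ?W"
  proof (rule cring_of_fps_ring)
    show "cring (fps_ring ?W)" using M.R.is_cring by (simp only: Seq)
    show "\<one>\<^bsub>?W\<^esub> \<in> carrier ?W" by (auto simp: Wk_def witt_ring_def)
    show "x \<otimes>\<^bsub>?W\<^esub> y \<in> carrier ?W" if "x \<in> carrier ?W" "y \<in> carrier ?W" for x y
      using U.k.witt_ring_closed(2) [of x y p] that by (simp add: Wk_def witt_ring_def)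
  qed
  interpret Wt: witt_cring K p \<iota> \<pi> j
    by (intro witt_cring.intro witt_cring_axioms.intro U.finite_ext_unif_axioms \<open>cring ?W\<close> assms(4))
  interpret R: cring R by fact
  interpret C: coeff_ring K p \<iota> \<pi> j R a
    by (intro coeff_ring.intro coeff_ring_axioms.intro tensor.intro tensor_axioms.intro
        Wt.witt_cring_axioms assms(8,9) \<open>cring ?W\<close> ring_hom_closed [OF assms(9)] ring_hom_closed [OF assms(4)])
  let ?T = "tensor_ring (Zp p) a R j ?W"
  let ?pure = "pure_tensor (Zp p) a R j ?W"
  let ?c = "fps_const ?T"
  have SR: "BK_coeff_ring p K \<iota> j R a = fps_ring ?T" by (simp add: BK_coeff_ring_def)
  have sm: "module (fps_ring ?T) (with_action M \<sigma>)"
    and s_S: "\<And>s x. s \<in> carrier ?S \<Longrightarrow> x \<in> carrier M \<Longrightarrow> \<sigma> (\<lambda>n. ?pure \<one>\<^bsub>R\<^esub> (s n)) x = s \<odot>\<^bsub>M\<^esub> x"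
    and s_R: "\<And>r x. r \<in> carrier R \<Longrightarrow> x \<in> carrier M \<Longrightarrow> \<sigma> (?c (?pure r \<one>\<^bsub>?W\<^esub>)) x = \<rho> r x"
    using assms(13) by (simp_all add: BK_coeff_structure_def SR)
  interpret N: module "fps_ring ?T" "with_action M \<sigma>" by (rule sm)
  have rm: "module R (with_action M \<rho>)"
    and r_S: "\<And>r s x. r \<in> carrier R \<Longrightarrow> s \<in> carrier ?S \<Longrightarrow> x \<in> carrier M \<Longrightarrow> \<rho> r (s \<odot>\<^bsub>M\<^esub> x) = s \<odot>\<^bsub>M\<^esub> \<rho> r x"
    using assms(12) by (simp_all add: coefficient_action_def)
  interpret Mr: module R "with_action M \<rho>" by (rule rm)
  note cc = C.T.fps_const_closed and vc = C.T.fps_var_closed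
  have uS: "u \<in> carrier ?S" unfolding assms(7) Seq by (rule Wt.W.fps_var_closed)
  \<comment> \<open>The coefficients of \<open>u\<close> are 0 and 1, so its image in the larger
    power series ring is again the variable, and both act alike on \<open>M\<close>.\<close>
  have \<sigma>_u: "\<sigma> (fps_var ?T) x = u \<odot>\<^bsub>M\<^esub> x" if "x \<in> carrier M" for x
  proof -
    have "fps_var ?T = (\<lambda>n. ?pure \<one>\<^bsub>R\<^esub> (u n))"
      by (rule ext) (simp add: fps_var_def assms(7) C.pure_one C.pure_zero_right)
    then show ?thesis using s_S [OF uS that] by simp
  qed
  have \<sigma>_closed: "\<sigma> s x \<in> carrier M" if "s \<in> carrier (fps_ring ?T)" "x \<in> carrier M" for s x
    using N.smult_closed that by simp
  \<comment> \<open>The tensor ring acts through constant series; averaging takes place over it,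
    modulo \<open>?N\<close>, before power series enter again.\<close>
  let ?V = "with_action M (\<lambda>t. \<sigma> (?c t))"
  let ?N = "mult_image M u"
  have V: "module ?T ?V"
  proof (rule moduleI)
    show "cring ?T" by (rule C.cring_T)
    show "abelian_group ?V"
    proof (rule abelian_groupI)
      fix x assume "x \<in> carrier ?V"
      then show "\<exists>y\<in>carrier ?V. y \<oplus>\<^bsub>?V\<^esub> x = \<zero>\<^bsub>?V\<^esub>"
        by (intro bexI [of _ "\<ominus>\<^bsub>M\<^esub> x"]) (simp_all add: M.l_neg)
    qed (simp_all add: M.a_ac)
  next
    fix s t x y assume st: "s \<in> carrier ?T" and x: "x \<in> carrier ?V"
    then show "s \<odot>\<^bsub>?V\<^esub> x \<in> carrier ?V" using \<sigma>_closed cc by simp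
    {
      assume "t \<in> carrier ?T"
      then show "(s \<oplus>\<^bsub>?T\<^esub> t) \<odot>\<^bsub>?V\<^esub> x = s \<odot>\<^bsub>?V\<^esub> x \<oplus>\<^bsub>?V\<^esub> t \<odot>\<^bsub>?V\<^esub> x"
        using N.smult_l_distr [OF cc cc, of s t x] st x by (simp add: C.T.fps_const_add)
      show "(s \<otimes>\<^bsub>?T\<^esub> t) \<odot>\<^bsub>?V\<^esub> x = s \<odot>\<^bsub>?V\<^esub> (t \<odot>\<^bsub>?V\<^esub> x)"
        using N.smult_assoc1 [OF cc cc, of s t x] st \<open>t \<in> carrier ?T\<close> x by (simp add: C.T.fps_const_mult)
    }
    assume "y \<in> carrier ?V"
    then show "s \<odot>\<^bsub>?V\<^esub> (x \<oplus>\<^bsub>?V\<^esub> y) = s \<odot>\<^bsub>?V\<^esub> x \<oplus>\<^bsub>?V\<^esub> s \<odot>\<^bsub>?V\<^esub> y"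
      using N.smult_r_distr [OF cc, of s x y] st x by simp
  next
    fix x assume "x \<in> carrier ?V"
    then show "\<one>\<^bsub>?T\<^esub> \<odot>\<^bsub>?V\<^esub> x = x" using N.smult_one [of x] by (simp add: fps_ring_simps(3))
  qed
  have N_iff: "n \<in> ?N \<longleftrightarrow> (\<exists>x\<in>carrier M. n = u \<odot>\<^bsub>M\<^esub> x)" for n by (auto simp: mult_image_def)
  have N_sub: "?N \<subseteq> carrier M" using uS by (auto simp: N_iff)
  have N_zero: "\<zero>\<^bsub>M\<^esub> \<in> ?N" using uS M.smult_r_null by (auto simp: N_iff intro!: bexI [of _ "\<zero>\<^bsub>M\<^esub>"])
  have N_add: "x \<oplus>\<^bsub>M\<^esub> y \<in> ?N" if "x \<in> ?N" "y \<in> ?N" for x y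
    using that uS by (auto simp: N_iff simp flip: M.smult_r_distr)
  have N_neg: "\<ominus>\<^bsub>M\<^esub> x \<in> ?N" if "x \<in> ?N" for x
    using that uS by (auto simp: N_iff simp flip: M.smult_r_minus)
  have neg: "\<ominus>\<^bsub>with_action M act\<^esub> x = \<ominus>\<^bsub>M\<^esub> x" for act :: "'z \<Rightarrow> 'm \<Rightarrow> 'm" and x
    by (simp add: a_inv_def m_inv_def)
  have subr: "subgroup ?N (add_monoid (with_action M \<rho>))"
    by (rule Mr.add.subgroupI) (use N_sub N_zero N_add N_neg in \<open>auto simp: neg simp flip: a_inv_def\<close>)
  interpret V: module ?T ?V by (rule V)
  have subV: "subgroup ?N (add_monoid ?V)"
    by (rule V.add.subgroupI) (use N_sub N_zero N_add N_neg in \<open>auto simp: neg simp flip: a_inv_def\<close>)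
  have r_N: "r \<odot>\<^bsub>with_action M \<rho>\<^esub> n \<in> ?N" if "r \<in> carrier R" "n \<in> ?N" for r n
    using that r_S uS Mr.smult_closed by (auto simp: N_iff)
  obtain I :: "'m set set" and L m where db: "dual_basis_mod R (with_action M \<rho>) ?N I L m"
    by (rule quotient_dual_basis [OF rm subr r_N assms(14,15)])
  \<comment> \<open>Constants \<open>r \<otimes> 1\<close> act as \<open>\<rho> r\<close>, so the
    dual basis over \<open>R\<close> is also one for the action restricted from the tensor
    ring.\<close>
  have db_V: "dual_basis_mod R (with_action ?V (\<lambda>r. smult ?V (?pure r \<one>\<^bsub>?W\<^esub>))) ?N I L m"
  proof -
    have "(\<Oplus>\<^bsub>M\<^esub>i\<in>I. \<rho> (L i x) (m i)) = (\<Oplus>\<^bsub>M\<^esub>i\<in>I. \<sigma> (?c (?pure (L i x) \<one>\<^bsub>?W\<^esub>)) (m i))"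
      if "x \<in> carrier M" for x
      using db that s_R Mr.smult_closed by (intro M.finsum_cong') (auto simp: dual_basis_mod_def)
    then show ?thesis
      using db s_R by (simp add: dual_basis_mod_def with_action_minus with_action_finsum)
  qed
  \<comment> \<open>Constant series commute with the variable, so multiples of \<open>u\<close> are
    preserved.\<close>
  have t_N: "t \<odot>\<^bsub>?V\<^esub> n \<in> ?N" if t: "t \<in> carrier ?T" and n: "n \<in> ?N" for t n
  proof -
    obtain x where x: "x \<in> carrier M" "n = u \<odot>\<^bsub>M\<^esub> x" using n by (auto simp: N_iff)
    have "\<sigma> (?c t) (\<sigma> (fps_var ?T) x) = \<sigma> (fps_var ?T) (\<sigma> (?c t) x)"
      using N.smult_assoc1 [OF cc [OF t] vc, of x] N.smult_assoc1 [OF vc cc [OF t], of x] x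
        N.R.m_comm [OF cc [OF t] vc] by simp
    then have "\<sigma> (?c t) n = u \<odot>\<^bsub>M\<^esub> \<sigma> (?c t) x"
      using x \<sigma>_u \<sigma>_closed [OF cc [OF t]] by simp
    then show ?thesis using x \<sigma>_closed [OF cc [OF t]] by (auto simp: N_iff)
  qed
  obtain L' where db': "dual_basis_mod ?T ?V ?N I L' m"
    by (rule C.average_dual_basis [OF V subV t_N db_V])
  \<comment> \<open>Separatedness is given for powers of \<open>u\<close> in the Breuil-Kisin ring,
    while \<open>fps_dual_basis\<close> iterates an operator; the two are matched here.\<close>
  have funpow: "((smult (with_action M \<sigma>) (fps_var ?T)) ^^ n) x = (u [^]\<^bsub>?S\<^esub> n) \<odot>\<^bsub>M\<^esub> x \<and> (u [^]\<^bsub>?S\<^esub> n) \<odot>\<^bsub>M\<^esub> x \<in> carrier M"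
    if x: "x \<in> carrier M" for n x
  proof (induction n)
    case (Suc n)
    have "(u [^]\<^bsub>?S\<^esub> Suc n) \<odot>\<^bsub>M\<^esub> x = u \<odot>\<^bsub>M\<^esub> ((u [^]\<^bsub>?S\<^esub> n) \<odot>\<^bsub>M\<^esub> x)"
      using uS x by (simp add: M.R.m_comm M.smult_assoc1)
    then show ?case using Suc \<sigma>_u uS by simp
  qed (use x in simp)
  have "fin_gen_module (fps_ring ?T) (with_action M \<sigma>) \<and> projective_module (fps_ring ?T) (with_action M \<sigma>)"
  proof (rule C.T.fps_dual_basis [OF sm, where I = I and l = L' and m = m])
    fix x assume x: "x \<in> carrier (with_action M \<sigma>)"
      and d: "\<And>n. \<exists>y\<in>carrier (with_action M \<sigma>). x = ((smult (with_action M \<sigma>) (fps_var ?T)) ^^ n) y"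
    have "x \<in> mult_image M (u [^]\<^bsub>?S\<^esub> n)" for n :: nat
      using d [of n] funpow by (auto simp: mult_image_def simp del: with_action_simps(4))
    then have "x \<in> (\<Inter>n::nat. mult_image M (u [^]\<^bsub>?S\<^esub> n))" by blast
    then have "x \<in> {\<zero>\<^bsub>M\<^esub>}" using assms(17) unfolding adically_separated_def by (simp only:)
    then show "x = \<zero>\<^bsub>with_action M \<sigma>\<^esub>" by simp
  next
    fix x assume "x \<in> carrier (with_action M \<sigma>)" "fps_var ?T \<odot>\<^bsub>with_action M \<sigma>\<^esub> x = \<zero>\<^bsub>with_action M \<sigma>\<^esub>"
    then show "x = \<zero>\<^bsub>with_action M \<sigma>\<^esub>" using assms(18) \<sigma>_u by (simp add: torsion_free_def)
  next
    fix x assume x: "x \<in> carrier (with_action M \<sigma>)"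
    let ?s = "\<Oplus>\<^bsub>M\<^esub>i\<in>I. \<sigma> (?c (L' i x)) (m i)"
    have s: "?s \<in> carrier M"
      using db' x \<sigma>_closed cc by (intro M.finsum_closed) (auto simp: dual_basis_mod_def)
    have "x \<ominus>\<^bsub>M\<^esub> ?s \<in> ?N"
      using db' x by (simp add: dual_basis_mod_def with_action_minus with_action_finsum)
    then obtain y where y: "y \<in> carrier M" "x \<ominus>\<^bsub>M\<^esub> ?s = u \<odot>\<^bsub>M\<^esub> y" by (auto simp: N_iff)
    have "x = ?s \<oplus>\<^bsub>M\<^esub> (x \<ominus>\<^bsub>M\<^esub> ?s)"
      using x s by (simp add: a_minus_def M.a_lcomm [of ?s] M.r_neg)
    then show "\<exists>y\<in>carrier (with_action M \<sigma>). x = (\<Oplus>\<^bsub>with_action M \<sigma>\<^esub>i\<in>I. ?c (L' i x) \<odot>\<^bsub>with_action M \<sigma>\<^esub> m i)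
        \<oplus>\<^bsub>with_action M \<sigma>\<^esub> fps_var ?T \<odot>\<^bsub>with_action M \<sigma>\<^esub> y"
      using y \<sigma>_u by (intro bexI [of _ y]) (simp_all add: with_action_finsum)
  next
    fix i x assume i: "i \<in> I" and x: "x \<in> carrier (with_action M \<sigma>)"
    then have "fps_var ?T \<odot>\<^bsub>with_action M \<sigma>\<^esub> x \<in> ?N" using \<sigma>_u by (auto simp: N_iff)
    then show "L' i (fps_var ?T \<odot>\<^bsub>with_action M \<sigma>\<^esub> x) = \<zero>\<^bsub>?T\<^esub>"
      using db' i by (simp add: dual_basis_mod_def)
  qed (use db' in \<open>simp_all add: dual_basis_mod_def\<close>)
  then show ?thesis by (simp add: SR)
qed

end
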